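(* The even Weyl group of the hyperbolic Kac--Moody algebra $F_4^{++}$ satisfies $$W^+(F_4^{++})\cong PSL_2^{(0)}(\mathtt{H})\rtimes\mathfrak{S}_3\cong PSL_2(\mathtt{H})\rtimes 2,$$ where $\mathfrak{S}_3$ is the symmetric group on three letters, $\mathtt{H}$ is the ring of Hurwitz quaternions and $$PSL_2^{(0)}(\mathtt{H})=\Big\{S=\begin{pmatrix}a&b\\c&d\end{pmatrix}\in PSL_2(\mathtt{H})\ \Big|\ ad-bc\equiv1\ (\mathrm{mod}\ \mathtt{C})\Big\},$$ with $\mathtt{C}$ the two-sided ideal of $\mathtt{H}$ generated by all commutators.
   Context: For a Kac--Moody algebra with Cartan matrix $[A_{IJ}]$, the Weyl group $W$ is the Coxeter group with generators $w_I$ and relations $w_I^2=1$, $(w_Iw_J)^{m_{IJ}}=1$ for $I\ne J$, where $m_{IJ}=2,3,4,6,\infty$ according as $A_{IJ}A_{JI}=0,1,2,3,\ge4$. $W^+\subset W$ is the index 2 subgroup of products of an even number of generators. $F_4^{++}$ is the over-extension of $F_4$ (the untwisted affine extension with one more node attached by a single line to the affine node). Its nodes are $-1,0,1,2,3,4$ in a chain, with $m_{-1,0}=m_{0,1}=m_{1,2}=3$, $m_{2,3}=4$, $m_{3,4}=3$, and $m_{IJ}=2$ for the other pairs. $\mathtt{H}=\{n_0+n_1i+n_2j+n_3k: \text{all }n_r\in\mathbb{Z}\text{ or all }n_r\in\mathbb{Z}+\tfrac12\}$ is the ring of Hurwitz integers. $\mathtt{C}$ is the two-sided ideal of $\mathtt{H}$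 generated by all $ab-ba$, $a,b\in\mathtt{H}$; the quotient $\mathtt{H}/\mathtt{C}$ is the field $\mathbb{F}_4$. $SL_2(\mathbb{H})$ is the group of $2\times2$ quaternionic matrices $S$ with $\det(SS^\dagger)=1$, where $S^\dagger$ is the conjugate transpose and the determinant of a Hermitian quaternionic matrix $\begin{pmatrix}p&q\\\bar q&r\end{pmatrix}$ ($p,r\in\mathbb{R}$) is $pr-q\bar q$. $PSL_2(\mathbb{H})=SL_2(\mathbb{H})/\{\pm1\}$, and $PSL_2(\mathtt{H})\subset PSL_2(\mathbb{H})$ is the subgroup of (classes of) matrices with all entries in $\mathtt{H}$. The notation $A\rtimes B$ means a semi-direct product: a group with a normal subgroup isomorphic to $A$ and a complementary subgroup isomorphic to $B$, acting on $A$ by conjugation as automorphisms; $2$ denotes $\mathbb{Z}/2\mathbb{Z}$. *)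

theory Defs
  imports
    "HOL-Library.Extended_Nat"
    "HOL-Analysis.Finite_Cartesian_Product"
    "HOL-Algebra.Ideal"
    "HOL-Algebra.Elementary_Groups"
    "HOL-Algebra.Sym_Groups"
begin

section \<open>Groups given by generators and relations\<close>

text \<open>A letter \<open>(x, True)\<close> stands for the generator \<open>x\<close>, and \<open>(x, False)\<close> for its inverse.
  The relators \<open>R\<close> are supposed to be words over the generators \<open>X\<close>.\<close>

inductive pres_eq :: "'a set \<Rightarrow> ('a \<times> bool) list set \<Rightarrow> ('a \<times> bool) list \<Rightarrow> ('a \<times> bool) list \<Rightarrow> bool"
  for X :: "'a set" and R :: "('a \<times> bool) list set" where
  pres_refl: "pres_eq X R u u"
| pres_sym: "pres_eq X R u v \<Longrightarrow> pres_eq X R v u"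
| pres_trans: "pres_eq X R u v \<Longrightarrow> pres_eq X R v w \<Longrightarrow> pres_eq X R u w"
| pres_cancel: "x \<in> X \<Longrightarrow> pres_eq X R (u @ [(x, b), (x, \<not> b)] @ v) (u @ v)"
| pres_relator: "r \<in> R \<Longrightarrow> pres_eq X R (u @ r @ v) (u @ v)"

definition pres_class :: "'a set \<Rightarrow> ('a \<times> bool) list set \<Rightarrow> ('a \<times> bool) list \<Rightarrow> ('a \<times> bool) list set" where
  "pres_class X R u = {v. pres_eq X R u v}"

definition presented_group :: "'a set \<Rightarrow> ('a \<times> bool) list set \<Rightarrow> ('a \<times> bool) list set monoid" where
  "presented_group X R =
    \<lparr>carrier = pres_class X R ` lists (X \<times> UNIV),
     monoid.mult = (\<lambda>P Q. \<Union>u\<in>P. \<Union>v\<in>Q. pres_class X R (u @ v)),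
     one = pres_class X R []\<rparr>"


section \<open>Weyl groups of Kac--Moody algebras\<close>

definition coxeter_exponent :: "('a \<Rightarrow> 'a \<Rightarrow> int) \<Rightarrow> 'a \<Rightarrow> 'a \<Rightarrow> enat" where
  "coxeter_exponent A i j =
    (if A i j * A j i = 0 then 2 else
     if A i j * A j i = 1 then 3 else
     if A i j * A j i = 2 then 4 else
     if A i j * A j i = 3 then 6 else \<infinity>)"

definition coxeter_relators :: "('a \<Rightarrow> 'a \<Rightarrow> int) \<Rightarrow> 'a set \<Rightarrow> ('a \<times> bool) list set" where
  "coxeter_relators A I =
    {[(i, True), (i, True)] | i. i \<in> I} \<union>
    {concat (replicate m [(i, True), (j, True)]) | i j m.
       i \<in> I \<and> j \<in> I \<and> i \<noteq> j \<and> coxeter_exponent A i j = enat m}"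

definition weyl_group :: "('a \<Rightarrow> 'a \<Rightarrow> int) \<Rightarrow> 'a set \<Rightarrow> ('a \<times> bool) list set monoid" where
  "weyl_group A I = presented_group I (coxeter_relators A I)"

definition even_weyl_group :: "('a \<Rightarrow> 'a \<Rightarrow> int) \<Rightarrow> 'a set \<Rightarrow> ('a \<times> bool) list set monoid" where
  "even_weyl_group A I = (weyl_group A I)
    \<lparr>carrier := {pres_class I (coxeter_relators A I) (map (\<lambda>i. (i, True)) is) | is.
                   is \<in> lists I \<and> even (length is)}\<rparr>"

text \<open>The Dynkin diagram of $F_4^{++}$ is the chain of the nodes $-1, 0, 1, 2, 3, 4$ with a double
  line between $2$ and $3$; the simple roots $3$ and $4$ are the short ones. The convention is
  $A_{ij} = 2 (\alpha_i, \alpha_j) / (\alpha_i, \alpha_i)$; the Weyl group depends only on the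
  products $A_{ij} A_{ji}$.\<close>

definition F4pp_nodes :: "int set" where
  "F4pp_nodes = {-1..4}"

definition F4pp_cartan :: "int \<Rightarrow> int \<Rightarrow> int" where
  "F4pp_cartan i j =
    (if i = j then 2 else
     if i = 3 \<and> j = 2 then -2 else
     if \<bar>i - j\<bar> = 1 then -1 else 0)"

lemma F4pp_coxeter_exponents:
  "coxeter_exponent F4pp_cartan (-1) 0 = 3"
  "coxeter_exponent F4pp_cartan 0 1 = 3"
  "coxeter_exponent F4pp_cartan 1 2 = 3"
  "coxeter_exponent F4pp_cartan 2 3 = 4"
  "coxeter_exponent F4pp_cartan 3 4 = 3"
  "coxeter_exponent F4pp_cartan i j = coxeter_exponent F4pp_cartan j i"
  "\<bar>i - j\<bar> \<ge> 2 \<Longrightarrow> coxeter_exponent F4pp_cartan i j = 2"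
  by (auto simp: coxeter_exponent_def F4pp_cartan_def)


section \<open>Quaternions and Hurwitz integers\<close>

datatype quat = Quat (qRe: real) (qI: real) (qJ: real) (qK: real)

lemma quat_eq_iff: "x = y \<longleftrightarrow> qRe x = qRe y \<and> qI x = qI y \<and> qJ x = qJ y \<and> qK x = qK y"
  by (cases x; cases y) auto

instantiation quat :: ring_1
begin

definition "0 = Quat 0 0 0 0"
definition "1 = Quat 1 0 0 0"
definition "x + y = Quat (qRe x + qRe y) (qI x + qI y) (qJ x + qJ y) (qK x + qK y)"
definition "x - y = Quat (qRe x - qRe y) (qI x - qI y) (qJ x - qJ y) (qK x - qK y)"
definition "- x = Quat (- qRe x) (- qI x) (- qJ x) (- qK x)"
definition "x * y =
  Quat (qRe x * qRe y - qI x * qI y - qJ x * qJ y - qK x * qK y)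
       (qRe x * qI y + qI x * qRe y + qJ x * qK y - qK x * qJ y)
       (qRe x * qJ y - qI x * qK y + qJ x * qRe y + qK x * qI y)
       (qRe x * qK y + qI x * qJ y - qJ x * qI y + qK x * qRe y)"

instance
  by standard
    (auto simp: quat_eq_iff zero_quat_def one_quat_def plus_quat_def minus_quat_def
      uminus_quat_def times_quat_def algebra_simps)

end

definition qcnj :: "quat \<Rightarrow> quat" where
  "qcnj x = Quat (qRe x) (- qI x) (- qJ x) (- qK x)"

definition Hurwitz :: "quat set" where
  "Hurwitz = {Quat a b c d | a b c d. {a, b, c, d} \<subseteq> \<int> \<or> {a, b, c, d} \<subseteq> (\<lambda>n. n + 1/2) ` \<int>}"

definition Hurwitz_ring :: "quat ring" where
  "Hurwitz_ring = \<lparr>carrier = Hurwitz, monoid.mult = (*), one = 1, zero = 0, add = (+)\<rparr>"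

definition Hurwitz_commutator_ideal :: "quat set" where
  "Hurwitz_commutator_ideal = Idl\<^bsub>Hurwitz_ring\<^esub> {a * b - b * a | a b. a \<in> Hurwitz \<and> b \<in> Hurwitz}"

text \<open>\<^const>\<open>genideal\<close> is only meaningful over a ring, which the Hurwitz integers form by the lemmas below.\<close>

lemma Hurwitz_iff:
  "x \<in> Hurwitz \<longleftrightarrow> (\<exists>a b c d e :: int.
     2 * qRe x = of_int (2 * a + e) \<and> 2 * qI x = of_int (2 * b + e) \<and>
     2 * qJ x = of_int (2 * c + e) \<and> 2 * qK x = of_int (2 * d + e))" (is "_ \<longleftrightarrow> ?R")
proof
  assume "x \<in> Hurwitz"
  then obtain a b c d where x: "x = Quat a b c d"
    and "{a, b, c, d} \<subseteq> \<int> \<or> {a, b, c, d} \<subseteq> (\<lambda>n. n + 1/2) ` \<int>"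
    unfolding Hurwitz_def by blast
  then consider
    (int) a' b' c' d' :: int where "a = of_int a'" "b = of_int b'" "c = of_int c'" "d = of_int d'"
  | (half) a' b' c' d' :: int where "a = of_int a' + 1/2" "b = of_int b' + 1/2"
      "c = of_int c' + 1/2" "d = of_int d' + 1/2"
    by (fastforce elim!: Ints_cases)
  then show ?R
  proof cases
    case int
    then show ?thesis
      by (intro exI[of _ a'] exI[of _ b'] exI[of _ c'] exI[of _ d'] exI[of _ 0]) (simp add: x)
  next
    case half
    then show ?thesis
      by (intro exI[of _ a'] exI[of _ b'] exI[of _ c'] exI[of _ d'] exI[of _ 1]) (simp add: x)
  qed
next
  assume ?R
  then obtain a b c d e :: int where
    e: "2 * qRe x = of_int (2 * a + e)" "2 * qI x = of_int (2 * b + e)"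
       "2 * qJ x = of_int (2 * c + e)" "2 * qK x = of_int (2 * d + e)" by blast
  obtain k r :: int where k: "e = 2 * k + r" and r: "r = 0 \<or> r = 1"
    by (metis mult_div_mod_eq not_mod_2_eq_1_eq_0)
  have q: "qRe x = of_int (a + k) + of_int r / 2" "qI x = of_int (b + k) + of_int r / 2"
    "qJ x = of_int (c + k) + of_int r / 2" "qK x = of_int (d + k) + of_int r / 2"
    using e unfolding k by simp_all
  have "{qRe x, qI x, qJ x, qK x} \<subseteq> \<int> \<or> {qRe x, qI x, qJ x, qK x} \<subseteq> (\<lambda>n. n + 1/2) ` \<int>"
    using r unfolding q by auto
  then have "Quat (qRe x) (qI x) (qJ x) (qK x) \<in> Hurwitz"
    unfolding Hurwitz_def by blast
  then show "x \<in> Hurwitz" by simp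
qed

lemma Hurwitz_mult:
  assumes "x \<in> Hurwitz" "y \<in> Hurwitz"
  shows "x * y \<in> Hurwitz"
proof -
  from assms(1) obtain a b c d e :: int where
    "2 * qRe x = of_int (2 * a + e)" "2 * qI x = of_int (2 * b + e)"
    "2 * qJ x = of_int (2 * c + e)" "2 * qK x = of_int (2 * d + e)"
    unfolding Hurwitz_iff by blast
  then have x: "qRe x = of_int a + of_int e / 2" "qI x = of_int b + of_int e / 2"
    "qJ x = of_int c + of_int e / 2" "qK x = of_int d + of_int e / 2" by simp_all
  from assms(2) obtain a' b' c' d' f :: int where
    "2 * qRe y = of_int (2 * a' + f)" "2 * qI y = of_int (2 * b' + f)"
    "2 * qJ y = of_int (2 * c' + f)" "2 * qK y = of_int (2 * d' + f)"
    unfolding Hurwitz_iff by blast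
  then have y: "qRe y = of_int a' + of_int f / 2" "qI y = of_int b' + of_int f / 2"
    "qJ y = of_int c' + of_int f / 2" "qK y = of_int d' + of_int f / 2" by simp_all
  define g where "g = f * (a + b + c + d) + e * (a' + b' + c' + d') + e * f"
  show ?thesis
    unfolding Hurwitz_iff
    by (rule exI[of _ "a * a' - b * b' - c * c' - d * d' - f * (b + c + d) - e * (b' + c' + d') - e * f"],
        rule exI[of _ "a * b' + b * a' + c * d' - d * c' - f * d - e * c'"],
        rule exI[of _ "a * c' - b * d' + c * a' + d * b' - f * b - e * d'"],
        rule exI[of _ "a * d' + b * c' - c * b' + d * a' - f * c - e * b'"],
        rule exI[of _ g])
      (simp add: times_quat_def x y g_def field_simps)
qed

lemma Hurwitz_add:
  assumes "x \<in> Hurwitz" "y \<in> Hurwitz"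
  shows "x + y \<in> Hurwitz"
proof -
  from assms(1) obtain a b c d e :: int where x:
    "2 * qRe x = of_int (2 * a + e)" "2 * qI x = of_int (2 * b + e)"
    "2 * qJ x = of_int (2 * c + e)" "2 * qK x = of_int (2 * d + e)"
    unfolding Hurwitz_iff by blast
  from assms(2) obtain a' b' c' d' f :: int where y:
    "2 * qRe y = of_int (2 * a' + f)" "2 * qI y = of_int (2 * b' + f)"
    "2 * qJ y = of_int (2 * c' + f)" "2 * qK y = of_int (2 * d' + f)"
    unfolding Hurwitz_iff by blast
  show ?thesis
    unfolding Hurwitz_iff using x y
    by (intro exI[of _ "a + a'"] exI[of _ "b + b'"] exI[of _ "c + c'"] exI[of _ "d + d'"]
        exI[of _ "e + f"]) (simp add: plus_quat_def)
qed

lemma Hurwitz_0: "0 \<in> Hurwitz" and Hurwitz_1: "1 \<in> Hurwitz" and Hurwitz_m1: "- 1 \<in> Hurwitz"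
  by (auto simp: Hurwitz_def zero_quat_def one_quat_def uminus_quat_def)

lemma ring_Hurwitz_ring: "ring Hurwitz_ring"
proof (rule ringI)
  show "abelian_group Hurwitz_ring"
  proof (rule abelian_groupI)
    fix x assume "x \<in> carrier Hurwitz_ring"
    then have "- x \<in> Hurwitz"
      using Hurwitz_mult[OF Hurwitz_m1, of x] by (simp add: Hurwitz_ring_def)
    then show "\<exists>y\<in>carrier Hurwitz_ring. y \<oplus>\<^bsub>Hurwitz_ring\<^esub> x = \<zero>\<^bsub>Hurwitz_ring\<^esub>"
      by (intro bexI[of _ "- x"]) (simp_all add: Hurwitz_ring_def)
  qed (auto simp: Hurwitz_ring_def Hurwitz_add Hurwitz_0 algebra_simps)
  show "Group.monoid Hurwitz_ring"
    by (rule monoidI) (auto simp: Hurwitz_ring_def Hurwitz_mult Hurwitz_1 algebra_simps)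
qed (auto simp: Hurwitz_ring_def algebra_simps)


section \<open>The groups $SL_2$ and $PSL_2$ over the quaternions\<close>

definition conj_transpose :: "quat^2^2 \<Rightarrow> quat^2^2" where
  "conj_transpose S = (\<chi> i j. qcnj (S $ j $ i))"

text \<open>Only meant for Hermitian arguments. The value is then a real quaternion.\<close>

definition hermitian_det :: "quat^2^2 \<Rightarrow> quat" where
  "hermitian_det M = M $ 1 $ 1 * M $ 2 $ 2 - M $ 1 $ 2 * qcnj (M $ 1 $ 2)"

definition SL2_quat :: "(quat^2^2) monoid" where
  "SL2_quat = \<lparr>carrier = {S. hermitian_det (S ** conj_transpose S) = 1}, monoid.mult = (**), one = mat 1\<rparr>"

definition PSL2_quat :: "(quat^2^2) set monoid" where
  "PSL2_quat = SL2_quat Mod {mat 1, - mat 1}"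

definition PSL2_Hurwitz :: "(quat^2^2) set monoid" where
  "PSL2_Hurwitz = PSL2_quat
    \<lparr>carrier := {X \<in> carrier PSL2_quat. \<exists>S\<in>X. \<forall>i j. S $ i $ j \<in> Hurwitz}\<rparr>"

text \<open>The congruence does not depend on the representative \<open>S\<close>: replacing \<open>S\<close> by \<open>- S\<close> does not
  change $ad - bc$.\<close>

definition PSL2_0_Hurwitz :: "(quat^2^2) set monoid" where
  "PSL2_0_Hurwitz = PSL2_Hurwitz
    \<lparr>carrier := {X \<in> carrier PSL2_Hurwitz.
       \<exists>S\<in>X. S $ 1 $ 1 * S $ 2 $ 2 - S $ 1 $ 2 * S $ 2 $ 1 - 1 \<in> Hurwitz_commutator_ideal}\<rparr>"


section \<open>Semi-direct products\<close>

definition is_semidirect_product :: "('a, 'm) monoid_scheme \<Rightarrow> ('b, 'n) monoid_scheme \<Rightarrow> ('c, 'k) monoid_scheme \<Rightarrow> bool" where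
  "is_semidirect_product G A B \<longleftrightarrow>
    (\<exists>N K. N \<lhd> G \<and> subgroup K G \<and> N \<inter> K = {\<one>\<^bsub>G\<^esub>} \<and> N <#>\<^bsub>G\<^esub> K = carrier G \<and>
       G\<lparr>carrier := N\<rparr> \<cong> A \<and> G\<lparr>carrier := K\<rparr> \<cong> B)"

end

theory Submission
  imports Defs "HOL-Analysis.Cartesian_Space"
begin

text \<open>
  The root lattice of $F_4^{++}$ embeds into the six-dimensional space of Hermitian quaternionic
  \<open>2 \<times> 2\<close> matrices, with \<open>- det\<close> as quadratic form: the simple roots become the matrices
  \<open>root_matrix i\<close>, up to the factor \<open>\<surd>2\<close> that normalises the short ones to determinant \<open>-1\<close>. For a
  Hermitian \<open>M\<close> with \<open>det M = -1\<close> the reflection along \<open>M\<close> is \<open>X \<mapsto> M adj(X) M\<close>, so a product of two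
  reflections is \<open>X \<mapsto> S X S\<dagger>\<close> with \<open>S = M adj(N)\<close>. Multiplying the matrices \<open>M\<close> and
  \<open>adj(M)\<close> alternately along a word therefore lifts the action of the even Weyl group to matrices;
  this is the function \<open>spin\<close>. Since \<open>S = M adj(N)\<close> satisfies \<open>S\<^sup>2 - c S + 1 = 0\<close> with
  \<open>c\<^sup>2 = A\<^sub>i\<^sub>j A\<^sub>j\<^sub>i\<close>, the Coxeter relators go to \<open>\<plusminus>1\<close> (lemma \<open>spin_braid\<close>), and
  \<open>spin\<close> descends to a homomorphism from $W^+$ to $PSL_2$ over the quaternions.

  It is injective (\<open>spin_faithful\<close>): a word with \<open>spin\<close> equal to \<open>\<plusminus>1\<close> acts trivially on the root
  lattice, and by a theorem of Tits (\<open>root_action_faithful\<close>) only the identity of a Weyl group does so.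

  Its image (\<open>spin_image_eq\<close>) consists of the matrices of determinant one whose entries all lie in the
  Hurwitz order or all lie in \<open>\<theta>\<close> times that order, where \<open>\<theta> = (i - j)/\<surd>2\<close> normalises the
  order. The factor \<open>\<theta>\<close> comes from the short roots. That everything is reached is the Euclidean
  algorithm (\<open>SL2_Hurwitz_generated\<close>): short words give the diagonal matrices of units, the
  translations and the matrix that swaps the rows up to sign.

  Both semi-direct decompositions are then visible in the image. The matrices with Hurwitz entries form
  a normal subgroup, complemented by the group of order two that the scalar \<open>\<theta>\<close> generates modulo sign.
  Modulo the commutator ideal \<open>ad - bc\<close> is multiplicative on Hurwitz matrices, and on those of
  determinant one it takes values in the three nonzero residues \<open>1, \<omega>, \<omega>\<^sup>2\<close>. The unit scalars \<open>1, \<omega>, \<omega>\<^sup>2\<close> and the three quaternions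
  \<open>(e\<^sub>a - e\<^sub>b)/\<surd>2\<close>, for imaginary units \<open>e\<^sub>a, e\<^sub>b\<close>, permute the three imaginary axes by conjugation. Up
  to sign they form a symmetric group on three letters, which meets every coset of the
  subgroup given by \<open>ad - bc \<equiv> 1\<close> exactly once.
\<close>

section \<open>Faithfulness of the reflection representation\<close>

abbreviation pos_word :: "'a list \<Rightarrow> ('a \<times> bool) list" where
  "pos_word w \<equiv> map (\<lambda>i. (i, True)) w"

lemma pres_eq_context: "pres_eq X R u v \<Longrightarrow> pres_eq X R (p @ u @ q) (p @ v @ q)"
proof (induction rule: pres_eq.induct)
  case (pres_cancel x u b v)
  then show ?case
    using pres_eq.pres_cancel[of x X R "p @ u" b "v @ q"] by simp
next
  case (pres_relator r u v)
  then show ?case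
    using pres_eq.pres_relator[of r R X "p @ u" "v @ q"] by simp
qed (auto intro: pres_eq.intros)

lemma pres_eq_append:
  "pres_eq X R u u' \<Longrightarrow> pres_eq X R v v' \<Longrightarrow> pres_eq X R (u @ v) (u' @ v')"
  using pres_eq_context[of X R u u' "[]" v] pres_eq_context[of X R v v' u' "[]"]
  by (auto intro: pres_trans)

lemma even_length_coxeter_relator:
  "r \<in> coxeter_relators A I \<Longrightarrow> even (length r)"
  by (auto simp: coxeter_relators_def length_concat sum_list_replicate)

lemma coxeter_pres_eq_parity:
  "pres_eq I (coxeter_relators A I) u v \<Longrightarrow> even (length u) = even (length v)"
  by (induction rule: pres_eq.induct) (auto dest: even_length_coxeter_relator)

text \<open>The coordinates are those with respect to the simple roots, so a simple reflection changes a single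
  coordinate.\<close>

fun root_action :: "('a \<Rightarrow> 'a \<Rightarrow> int) \<Rightarrow> 'a set \<Rightarrow> 'a list \<Rightarrow> ('a \<Rightarrow> int) \<Rightarrow> 'a \<Rightarrow> int" where
  "root_action A I [] v = v"
| "root_action A I (i # w) v =
    (let v' = root_action A I w v in v'(i := v' i - (\<Sum>j\<in>I. A i j * v' j)))"

definition simple_root :: "'a \<Rightarrow> 'a \<Rightarrow> int" where
  "simple_root i = (\<lambda>k. if k = i then 1 else 0)"

lemma root_action_append: "root_action A I (u @ w) v = root_action A I u (root_action A I w v)"
  by (induction u) auto

lemma root_action_linear:
  "root_action A I u (\<lambda>k. a * x k + b * y k) =
     (\<lambda>k. a * root_action A I u x k + b * root_action A I u y k)"
  by (induction u)
    (auto simp: Let_def fun_eq_iff sum.distrib sum_distrib_left algebra_simps)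

text \<open>With \<open>A\<^sub>i\<^sub>j A\<^sub>j\<^sub>i \<le> 2\<close> all rank two parabolic subgroups are finite dihedral groups of order
  at most eight, small enough to be treated letter by letter.\<close>

locale doubly_laced_cartan =
  fixes A :: "'a \<Rightarrow> 'a \<Rightarrow> int" and I :: "'a set"
  assumes fin: "finite I"
    and diag: "i \<in> I \<Longrightarrow> A i i = 2"
    and off_diag: "i \<in> I \<Longrightarrow> j \<in> I \<Longrightarrow> i \<noteq> j \<Longrightarrow> A i j \<le> 0"
    and zero_sym: "i \<in> I \<Longrightarrow> j \<in> I \<Longrightarrow> A i j = 0 \<Longrightarrow> A j i = 0"
    and bond: "i \<in> I \<Longrightarrow> j \<in> I \<Longrightarrow> i \<noteq> j \<Longrightarrow> A i j * A j i \<le> 2"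
begin

definition eqv :: "'a list \<Rightarrow> 'a list \<Rightarrow> bool" where
  "eqv u v \<longleftrightarrow> pres_eq I (coxeter_relators A I) (pos_word u) (pos_word v)"

lemma eqv_refl [simp]: "eqv u u"
  and eqv_sym: "eqv u v \<Longrightarrow> eqv v u"
  and eqv_trans [trans]: "eqv u v \<Longrightarrow> eqv v w \<Longrightarrow> eqv u w"
  unfolding eqv_def by (auto intro: pres_eq.intros)

lemma eqv_context: "eqv u v \<Longrightarrow> eqv (p @ u @ q) (p @ v @ q)"
  using pres_eq_context[of I "coxeter_relators A I" "pos_word u" "pos_word v" "pos_word p" "pos_word q"]
  by (simp add: eqv_def)

lemma eqv_append: "eqv u u' \<Longrightarrow> eqv v v' \<Longrightarrow> eqv (u @ v) (u' @ v')"
  using pres_eq_append by (simp add: eqv_def)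

lemma eqv_parity: "eqv u v \<Longrightarrow> even (length u) = even (length v)"
  unfolding eqv_def by (drule coxeter_pres_eq_parity) simp

lemma eqv_square: "i \<in> I \<Longrightarrow> eqv [i, i] []"
  using pres_relator[of "[(i, True), (i, True)]" "coxeter_relators A I" I "[]" "[]"]
  by (simp add: eqv_def coxeter_relators_def)

lemma eqv_braid_power:
  assumes "i \<in> I" "j \<in> I" "i \<noteq> j" "coxeter_exponent A i j = enat m"
  shows "eqv (concat (replicate m [i, j])) []"
proof -
  have "map (\<lambda>i. (i, True)) (concat (replicate m [i, j])) = concat (replicate m [(i, True), (j, True)])"
    by (simp add: map_concat)
  then show ?thesis
    using assms pres_relator[of "concat (replicate m [(i, True), (j, True)])" "coxeter_relators A I" I "[]" "[]"]
    unfolding eqv_def coxeter_relators_def by auto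
qed

lemma eqv_rev: assumes "u \<in> lists I" shows "eqv (u @ rev u) []"
  using assms
proof (induction u)
  case (Cons i u)
  then have "eqv ([i] @ (u @ rev u) @ [i]) ([i] @ [] @ [i])"
    by (intro eqv_context) auto
  also have "eqv ([i] @ [] @ [i]) []"
    using Cons eqv_square by simp
  finally show ?case by simp
qed simp

text \<open>Since generators are involutions, a tail can be moved across an equation by reversing it.\<close>

lemma eqv_move:
  assumes "eqv (u @ w) []" "w \<in> lists I"
  shows "eqv u (rev w)"
proof -
  have "eqv u (u @ (w @ rev w))"
    using eqv_context[OF eqv_rev[OF assms(2)], of u "[]"] by (simp add: eqv_sym)
  also have "eqv (u @ (w @ rev w)) (rev w)"
    using eqv_context[OF assms(1), of "[]" "rev w"] by simp
  finally show ?thesis .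
qed

text \<open>The Coxeter length of the element represented by a word.\<close>

definition len :: "'a list \<Rightarrow> nat" where
  "len u = (LEAST n. \<exists>v\<in>lists I. length v = n \<and> eqv u v)"

lemma len_le: "v \<in> lists I \<Longrightarrow> eqv u v \<Longrightarrow> len u \<le> length v"
  unfolding len_def by (rule Least_le) auto

lemma len_witness:
  assumes "u \<in> lists I"
  obtains v where "v \<in> lists I" "eqv u v" "length v = len u"
proof -
  have "\<exists>v\<in>lists I. length v = len u \<and> eqv u v"
    unfolding len_def by (rule LeastI[of _ "length u"]) (use assms eqv_refl in blast)
  then show ?thesis using that by blast
qed

lemma len_eqv: "eqv u v \<Longrightarrow> len u = len v"
  unfolding len_def by (metis eqv_sym eqv_trans)

lemma len_parity: "u \<in> lists I \<Longrightarrow> even (len u) = even (length u)"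
  by (metis len_witness eqv_parity)

lemma len_append_le:
  assumes "u \<in> lists I" "w \<in> lists I"
  shows "len (u @ w) \<le> len u + length w"
proof -
  obtain v where v: "v \<in> lists I" "eqv u v" "length v = len u"
    using len_witness assms(1) by blast
  have "eqv (u @ w) (v @ w)" using eqv_append v(2) by simp
  then have "len (u @ w) \<le> length (v @ w)" using v assms by (intro len_le) auto
  then show ?thesis using v by simp
qed

text \<open>The length changes by at most one, and parity excludes that it stays the same.\<close>

lemma len_snoc_cases:
  assumes "u \<in> lists I" "i \<in> I"
  shows "len (u @ [i]) = len u + 1 \<or> len u = len (u @ [i]) + 1"
proof -
  have "len (u @ [i]) \<le> len u + 1" using len_append_le[of u "[i]"] assms by simp
  moreover have "eqv u ((u @ [i]) @ [i])"
    using eqv_context[OF eqv_square[OF assms(2)], of u "[]"] by (simp add: eqv_sym)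
  then have "len u \<le> len (u @ [i]) + 1"
    using len_append_le[of "u @ [i]" "[i]"] assms len_eqv by auto
  moreover have "len (u @ [i]) \<noteq> len u"
    using len_parity[of u] len_parity[of "u @ [i]"] assms by auto
  ultimately show ?thesis by linarith
qed

lemma root_action_single:
  "root_action A I [i] v = (\<lambda>k. v k - (\<Sum>l\<in>I. A i l * v l) * simple_root i k)"
  by (auto simp: simple_root_def fun_eq_iff)

lemma sum_simple_root: "j \<in> I \<Longrightarrow> (\<Sum>l\<in>I. A i l * simple_root j l) = A i j"
  using fin by (simp add: simple_root_def if_distrib cong: if_cong)

lemma root_action_simple:
  assumes "j \<in> I"
  shows "root_action A I [i] (simple_root j) = (\<lambda>k. simple_root j k - A i j * simple_root i k)"
  unfolding root_action_single sum_simple_root[OF assms] ..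

lemma root_action_pair_shift:
  assumes "i \<in> I" "j \<in> I"
  shows "root_action A I [i] (\<lambda>k. v k + x * simple_root i k + y * simple_root j k) =
    (\<lambda>k. v k + (- (\<Sum>l\<in>I. A i l * v l) - x - A i j * y) * simple_root i k + y * simple_root j k)"
proof -
  have "(\<Sum>l\<in>I. A i l * (v l + x * simple_root i l + y * simple_root j l)) =
    (\<Sum>l\<in>I. A i l * v l) + x * (\<Sum>l\<in>I. A i l * simple_root i l) + y * (\<Sum>l\<in>I. A i l * simple_root j l)"
    by (simp add: sum.distrib sum_distrib_left algebra_simps)
  then show ?thesis
    unfolding root_action_single sum_simple_root[OF assms(1)] sum_simple_root[OF assms(2)] diag[OF assms(1)]
    by (simp add: fun_eq_iff algebra_simps)
qed

lemma root_action_pair: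
  assumes "i \<in> I" "j \<in> I"
  shows "root_action A I [i] (\<lambda>k. a * simple_root i k + b * simple_root j k) =
    (\<lambda>k. (- a - A i j * b) * simple_root i k + b * simple_root j k)"
  using root_action_pair_shift[OF assms, of "\<lambda>_. 0" a b] by (simp del: root_action.simps)

lemma root_action_square:
  assumes "i \<in> I"
  shows "root_action A I [i, i] v = v"
  using root_action_pair_shift[OF assms assms, of v 0 0]
    root_action_pair_shift[OF assms assms, of v "- (\<Sum>l\<in>I. A i l * v l)" 0]
    root_action_append[of A I "[i]" "[i]" v]
  by simp

lemma bond_cases:
  assumes "i \<in> I" "j \<in> I" "i \<noteq> j"
  shows "A i j * A j i = 0 \<or> A i j * A j i = 1 \<or> A i j * A j i = 2"
proof -
  have "0 \<le> A i j * A j i" using off_diag assms by (simp add: mult_nonpos_nonpos)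
  then show ?thesis using bond[OF assms] by linarith
qed

text \<open>On the translates \<open>v + x \<alpha>\<^sub>i + y \<alpha>\<^sub>j\<close> the two reflections act by affine maps of \<open>(x, y)\<close>,
  and it is enough to follow the orbit of the origin.\<close>

lemma root_action_braid:
  assumes ij: "i \<in> I" "j \<in> I" "i \<noteq> j" and m: "coxeter_exponent A i j = enat m"
  shows "root_action A I (concat (replicate m [i, j])) v = v"
proof -
  define p q where "p = (\<Sum>l\<in>I. A i l * v l)" and "q = (\<Sum>l\<in>I. A j l * v l)"
  define a b where "a = - A i j" and "b = - A j i"
  have ab: "a \<ge> 0" "b \<ge> 0" "a * b = 0 \<or> a * b = 1 \<or> a * b = 2" "a = 0 \<longleftrightarrow> b = 0"
    using off_diag[OF ij] off_diag[OF ij(2,1)] ij(3) bond_cases[OF ij] zero_sym[OF ij(1,2)] zero_sym[OF ij(2,1)]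
    by (auto simp: a_def b_def)
  have cases: "a = 0 \<and> b = 0 \<and> m = 2 \<or> a = 1 \<and> b = 1 \<and> m = 3 \<or> a = 1 \<and> b = 2 \<and> m = 4 \<or> a = 2 \<and> b = 1 \<and> m = 4"
  proof -
    have "a \<le> 2 \<and> b \<le> 2"
    proof (cases "a = 0 \<or> b = 0")
      case False
      then have "a * 1 \<le> a * b" "1 * b \<le> a * b" using ab by (intro mult_mono; linarith)+
      then show ?thesis using ab(3) by linarith
    qed (use ab(4) in auto)
    then have "a = 0 \<or> a = 1 \<or> a = 2" "b = 0 \<or> b = 1 \<or> b = 2" using ab by auto
    moreover have "m = (if a * b = 0 then 2 else if a * b = 1 then 3 else 4)"
      using m ab(3) by (auto simp: coxeter_exponent_def a_def b_def numeral_eq_enat split: if_splits)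
    ultimately show ?thesis using ab by auto
  qed
  define f where "f x y = (\<lambda>k. v k + x * simple_root i k + y * simple_root j k)" for x y
  have fi: "root_action A I [i] (f x y) = f (a * y - p - x) y" for x y
  proof -
    have e: "- p - x - A i j * y = a * y - p - x" by (simp add: a_def)
    show ?thesis unfolding f_def root_action_pair_shift[OF ij(1,2)] p_def[symmetric] e ..
  qed
  have fj: "root_action A I [j] (f x y) = f x (b * x - q - y)" for x y
  proof -
    have e: "- q - y - A j i * x = b * x - q - y" by (simp add: b_def)
    have swap: "(\<lambda>k. v k + x * simple_root i k + y * simple_root j k) =
      (\<lambda>k. v k + y * simple_root j k + x * simple_root i k)" for x y
      by (simp add: fun_eq_iff)
    show ?thesis unfolding f_def swap[of x y] root_action_pair_shift[OF ij(2,1)] q_def[symmetric] e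
      by (simp add: fun_eq_iff)
  qed
  have si: "root_action A I (i # w) (f 0 0) = f (a * y - p - x) y"
    if "root_action A I w (f 0 0) = f x y" for w x y
    using root_action_append[of A I "[i]" w "f 0 0"] fi[of x y] that by (simp del: root_action.simps)
  have sj: "root_action A I (j # w) (f 0 0) = f x (b * x - q - y)"
    if "root_action A I w (f 0 0) = f x y" for w x y
    using root_action_append[of A I "[j]" w "f 0 0"] fj[of x y] that by (simp del: root_action.simps)
  have step: "root_action A I (i # j # w) (f 0 0) = f (a * (b * x - q - y) - p - x) (b * x - q - y)"
    if "root_action A I w (f 0 0) = f x y" for w x y
    by (rule si, rule sj, rule that)
  have s0: "root_action A I [] (f 0 0) = f 0 0" by simp
  note s1 = step[OF s0] note s2 = step[OF s1] note s3 = step[OF s2] note s4 = step[OF s3]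
  have "root_action A I (concat (replicate m [i, j])) (f 0 0) = f 0 0"
    using cases
  proof (elim disjE conjE)
    assume "a = 0" "b = 0" "m = 2"
    then show ?thesis using s2 by (simp add: eval_nat_numeral del: root_action.simps)
  next
    assume "a = 1" "b = 1" "m = 3"
    then show ?thesis using s3 by (simp add: eval_nat_numeral algebra_simps del: root_action.simps)
  next
    assume "a = 1" "b = 2" "m = 4"
    then show ?thesis using s4 by (simp add: eval_nat_numeral algebra_simps del: root_action.simps)
  next
    assume "a = 2" "b = 1" "m = 4"
    then show ?thesis using s4 by (simp add: eval_nat_numeral algebra_simps del: root_action.simps)
  qed
  then show ?thesis by (simp add: f_def)
qed

lemma root_action_pres_eq:
  "pres_eq I (coxeter_relators A I) u w \<Longrightarrow>
     root_action A I (map fst u) v = root_action A I (map fst w) v"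
proof (induction arbitrary: v rule: pres_eq.induct)
  case (pres_cancel x u b w)
  then show ?case
    using root_action_square[of x]
      root_action_append[of A I "map fst u" "[x, x] @ map fst w"]
      root_action_append[of A I "[x, x]" "map fst w"]
    by (simp add: root_action_append del: root_action.simps)
next
  case (pres_relator r u w)
  have "root_action A I (map fst r) v = v" for v
    using pres_relator
    by (auto simp: coxeter_relators_def root_action_square root_action_braid map_concat
        simp del: root_action.simps)
  then show ?case
    by (simp add: root_action_append del: root_action.simps)
qed auto

lemma root_action_eqv: "eqv u w \<Longrightarrow> root_action A I u v = root_action A I w v"
  using root_action_pres_eq[of "pos_word u" "pos_word w" v] by (simp add: eqv_def comp_def)

definition reduced :: "'a list \<Rightarrow> bool" where
  "reduced y \<longleftrightarrow> (\<forall>z\<in>lists I. eqv y z \<longrightarrow> length y \<le> length z)"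

lemma reduced_subword:
  assumes "reduced (p @ q @ r)" "eqv q q'" "p \<in> lists I" "q' \<in> lists I" "r \<in> lists I"
  shows "length q \<le> length q'"
  using assms eqv_context[OF assms(2), of p r] unfolding reduced_def
  by (metis add_le_cancel_left add_le_cancel_right append_in_lists_conv length_append)

text \<open>The rank two case of the positivity theorem. Reading \<open>x i\<close> from its end, letters must alternate, and
  an alternating word longer than the bond allows is shortened by the braid relation. What is left are the
  words \<open>1, j, ij, jij\<close> for \<open>x\<close>, and the last two only if \<open>A\<^sub>i\<^sub>j A\<^sub>j\<^sub>i\<close> is large enough.\<close>

lemma dihedral_positive:
  assumes ij: "i \<in> I" "j \<in> I" "i \<noteq> j"
    and x: "x \<in> lists {i, j}" and irr: "reduced (x @ [i])"
  obtains a b where "a \<ge> 0" "b \<ge> 0"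
    "root_action A I x (simple_root i) = (\<lambda>k. a * simple_root i k + b * simple_root j k)"
proof -
  have xI: "x \<in> lists I" using x ij by auto
  have no_square: "x @ [i] \<noteq> p @ [l, l] @ r" for p l r
  proof
    assume e: "x @ [i] = p @ [l, l] @ r"
    then have "p @ [l, l] @ r \<in> lists I" using xI ij by (metis append_in_lists_conv lists.simps)
    then show False
      using reduced_subword[of p "[l, l]" r "[]"] irr e eqv_square by auto
  qed
  have no_long: "length q \<le> length q'" if "x @ [i] = p @ q" "eqv q q'" "q' \<in> lists I" for p q q'
  proof -
    have "p \<in> lists I" using that(1) xI ij by (metis append_in_lists_conv lists.simps)
    then show ?thesis using reduced_subword[of p q "[]" q'] that irr by simp
  qed
  have step: "\<exists>x'. x' \<in> lists {i, j} \<and> y = x' @ [l']"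
    if "y \<in> lists {i, j}" "y \<noteq> []" "x @ [i] = y @ l # r" "(l, l') = (i, j) \<or> (l, l') = (j, i)" for y l l' r
    using that no_square[of "butlast y" l r]
    by (cases y rule: rev_cases) auto
  define a b where "a = - A i j" and "b = - A j i"
  have ab: "a \<ge> 0" "b \<ge> 0" using off_diag ij by (auto simp: a_def b_def)
  have s0: "simple_root i = (\<lambda>k. 1 * simple_root i k + 0 * simple_root j k)" by auto
  have si: "root_action A I [i] (\<lambda>k. p * simple_root i k + q * simple_root j k) =
      (\<lambda>k. (a * q - p) * simple_root i k + q * simple_root j k)" for p q
  proof -
    have e: "- p - A i j * q = a * q - p" by (simp add: a_def)
    show ?thesis unfolding root_action_pair[OF ij(1,2)] e ..
  qed
  have sj: "root_action A I [j] (\<lambda>k. p * simple_root i k + q * simple_root j k) =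
      (\<lambda>k. p * simple_root i k + (b * p - q) * simple_root j k)" for p q
  proof -
    have e: "- q - A j i * p = b * p - q" by (simp add: b_def)
    have swap: "(\<lambda>k. p * simple_root i k + q * simple_root j k) =
      (\<lambda>k. q * simple_root j k + p * simple_root i k)" for p q
      by (simp add: fun_eq_iff)
    show ?thesis unfolding swap[of p q] root_action_pair[OF ij(2,1)] e by (simp add: fun_eq_iff)
  qed
  have bc: "a * b = 0 \<or> a * b = 1 \<or> a * b = 2" using bond_cases[OF ij] by (simp add: a_def b_def)
  have expo: "coxeter_exponent A i j = enat (nat (a * b) + 2)"
    using bc by (auto simp: coxeter_exponent_def a_def b_def numeral_eq_enat)
  have rel: "eqv (concat (replicate (nat (a * b) + 2) [i, j])) []"
    by (rule eqv_braid_power[OF ij expo])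
  have act1: "root_action A I [j] (simple_root i) = (\<lambda>k. 1 * simple_root i k + b * simple_root j k)"
    using sj[of 1 0] by (simp del: root_action.simps)
  have act2: "root_action A I [i, j] (simple_root i) =
      (\<lambda>k. (a * b - 1) * simple_root i k + b * simple_root j k)"
    using root_action_append[of A I "[i]" "[j]"] act1 si[of 1 b]
    by (simp del: root_action.simps)
  have act3: "root_action A I [j, i, j] (simple_root i) =
      (\<lambda>k. (a * b - 1) * simple_root i k + b * (a * b - 2) * simple_root j k)"
    using root_action_append[of A I "[j]" "[i, j]"] act2 sj[of "a * b - 1" b]
    by (simp add: algebra_simps del: root_action.simps)
  consider "x = []" | x1 where "x1 \<in> lists {i, j}" "x = x1 @ [j]"
    using step[of x i "[]" j] x by auto
  then show ?thesis
  proof cases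
    case 1
    then show ?thesis using that[of 1 0] by simp
  next
    case x1: 2
    consider "x1 = []" | x2 where "x2 \<in> lists {i, j}" "x1 = x2 @ [i]"
      using step[of x1 j "[i]" i] x1 by auto
    then show ?thesis
    proof cases
      case 1
      then show ?thesis using that[of 1 b] act1 x1 ab by simp
    next
      case x2: 2
      have ab0: "a * b \<noteq> 0"
      proof
        assume "a * b = 0"
        then have "nat (a * b) = nat 0" by (rule arg_cong)
        then have "eqv ([i, j, i] @ [j]) []" using rel by (simp add: numeral_2_eq_2)
        then have "eqv [i, j, i] [j]" using eqv_move[of "[i, j, i]" "[j]"] ij by simp
        then show False using no_long[of x2 "[i, j, i]" "[j]"] x1 x2 ij by simp
      qed
      consider "x2 = []" | x3 where "x3 \<in> lists {i, j}" "x2 = x3 @ [j]"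
        using step[of x2 i "[j, i]" j] x1 x2 by auto
      then show ?thesis
      proof cases
        case 1
        then show ?thesis using that[of "a * b - 1" b] act2 x1 x2 ab bc ab0 by auto
      next
        case x3: 2
        have ab1: "a * b \<noteq> 1"
        proof
          assume "a * b = 1"
          then have "eqv ([i, j, i, j, i, j]) []" using rel by (simp add: numeral_3_eq_3)
          then have "eqv ([i, j] @ [i, j, i, j]) []" by simp
          then have "eqv [i, j] (rev [i, j, i, j])"
            using eqv_move[of "[i, j]" "[i, j, i, j]"] ij by simp
          then have "eqv (rev [i, j, i, j]) [i, j]" by (rule eqv_sym)
          then have "eqv [j, i, j, i] [i, j]" by simp
          then show False using no_long[of x3 "[j, i, j, i]" "[i, j]"] x1 x2 x3 ij by simp
        qed
        then have ab2: "a * b = 2" using bc ab0 by blast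
        consider "x3 = []" | x4 where "x4 \<in> lists {i, j}" "x3 = x4 @ [i]"
          using step[of x3 j "[i, j, i]" i] x1 x2 x3 by auto
        then show ?thesis
        proof cases
          case 1
          then show ?thesis using that[of 1 0] act3 x1 x2 x3 ab2 by simp
        next
          case x4: 2
          have "eqv ([i, j, i, j, i] @ [j, i, j]) []" using rel ab2 by (simp add: eval_nat_numeral)
          then have "eqv [i, j, i, j, i] [j, i, j]"
            using eqv_move[of "[i, j, i, j, i]" "[j, i, j]"] ij by simp
          then show ?thesis using no_long[of x4 "[i, j, i, j, i]" "[j, i, j]"] x1 x2 x3 x4 ij by simp
        qed
      qed
    qed
  qed
qed

text \<open>Tits' argument, by induction on the length of \<open>u\<close>. If \<open>j\<close> shortens \<open>u\<close>, write \<open>u = v x\<close>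
  with additive lengths, \<open>x\<close> in the dihedral group of \<open>i\<close> and \<open>j\<close>, and \<open>v\<close> as short as possible. Then
  \<open>v\<close> is lengthened by both \<open>i\<close> and \<open>j\<close>, so it keeps both simple roots positive, while \<open>x\<close> sends
  \<open>\<alpha>\<^sub>i\<close> to a nonnegative combination of the two.\<close>

theorem root_positive:
  assumes "u \<in> lists I" "i \<in> I" "len u < len (u @ [i])"
  shows "0 \<le> root_action A I u (simple_root i) k"
  using assms
proof (induction "len u" arbitrary: u i k rule: less_induct)
  case less
  show ?case
  proof (cases "len u = 0")
    case True
    then have "eqv u []" using len_witness[OF less(2)] by (metis length_0_conv)
    then show ?thesis using root_action_eqv[of u "[]"] by (simp add: simple_root_def)
  next
    case False
    obtain v0 j where v0: "v0 \<in> lists I" "j \<in> I" "eqv u (v0 @ [j])" "length v0 + 1 = len u"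
    proof -
      obtain v where v: "v \<in> lists I" "eqv u v" "length v = len u"
        using len_witness[OF less(2)] by blast
      then obtain v' j where "v = v' @ [j]" using False by (cases v rule: rev_cases) auto
      then show ?thesis using that[of v' j] v by simp
    qed
    have ji: "i \<noteq> j"
    proof
      assume "i = j"
      have "eqv (u @ [i]) ((v0 @ [j]) @ [i])" using eqv_append[OF v0(3)] by simp
      also have "eqv ((v0 @ [j]) @ [i]) v0"
        using eqv_context[OF eqv_square[of i], of v0 "[]"] \<open>i = j\<close> less(3) by simp
      finally have "len (u @ [i]) \<le> length v0" using len_le v0(1) by blast
      then show False using less(4) v0(4) by simp
    qed
    define good where "good = (\<lambda>(v, x). v \<in> lists I \<and> x \<in> lists {i, j} \<and> eqv u (v @ x) \<and>
      len v + length x = len u)"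
    have "good (v0, [j])"
    proof -
      have "len u \<le> len v0 + 1"
        using len_append_le[of v0 "[j]"] v0 len_eqv[OF v0(3)] by simp
      moreover have "len v0 \<le> length v0" using len_le v0(1) by simp
      ultimately show ?thesis using v0 by (simp add: good_def)
    qed
    then obtain vx where vx: "good vx" "\<And>z. good z \<Longrightarrow> len (fst vx) \<le> len (fst z)"
      using ex_has_least_nat[of good "(v0, [j])" "\<lambda>z. len (fst z)"] by blast
    obtain v x where vx_eq: "vx = (v, x)" by force
    have v: "v \<in> lists I" "x \<in> lists {i, j}" "eqv u (v @ x)" "len v + length x = len u"
      using vx(1) by (auto simp: vx_eq good_def)
    have xI: "x \<in> lists I" using v(2) v0(2) less(3) by auto
    have "len v \<le> len v0" using vx(2)[OF \<open>good (v0, [j])\<close>] by (simp add: vx_eq)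
    moreover have "len v0 \<le> length v0" using len_le v0(1) by simp
    ultimately have short: "len v < len u" using v0(4) by simp
    have up: "len v < len (v @ [l])" if "l = i \<or> l = j" for l
    proof (rule ccontr)
      assume "\<not> len v < len (v @ [l])"
      have l: "l \<in> I" using that less(3) v0(2) by auto
      then have len_l: "len v = len (v @ [l]) + 1"
        using len_snoc_cases[OF v(1) l] \<open>\<not> len v < len (v @ [l])\<close> by auto
      have "eqv (v @ x) (v @ [l, l] @ x)"
        using eqv_context[OF eqv_square[OF l], of v x] by (simp add: eqv_sym)
      then have "eqv u ((v @ [l]) @ l # x)" using eqv_trans[OF v(3)] by simp
      then have "good (v @ [l], l # x)"
        using v that l len_l by (auto simp: good_def)
      then show False using vx(2) len_l by (fastforce simp: vx_eq)
    qed
    have irr: "reduced (x @ [i])"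
      unfolding reduced_def
    proof (intro ballI impI)
      fix z assume z: "z \<in> lists I" "eqv (x @ [i]) z"
      have "eqv (u @ [i]) ((v @ x) @ [i])" using eqv_append[OF v(3)] by simp
      also have "eqv ((v @ x) @ [i]) (v @ z)" using eqv_context[OF z(2), of v "[]"] by simp
      finally have "len (u @ [i]) \<le> len v + length z"
        using len_append_le[OF v(1) z(1)] len_eqv by metis
      then show "length (x @ [i]) \<le> length z" using less(4) v(4) by simp
    qed
    obtain a b where ab: "a \<ge> 0" "b \<ge> 0"
      "root_action A I x (simple_root i) = (\<lambda>k. a * simple_root i k + b * simple_root j k)"
      using dihedral_positive[OF less(3) v0(2) ji v(2) irr] by blast
    have "root_action A I u (simple_root i) k =
        a * root_action A I v (simple_root i) k + b * root_action A I v (simple_root j) k"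
      by (simp add: root_action_eqv[OF v(3)] root_action_append ab(3) root_action_linear)
    moreover have "0 \<le> root_action A I v (simple_root i) k" "0 \<le> root_action A I v (simple_root j) k"
      using less(1)[OF short v(1)] up less(3) v0(2) by auto
    ultimately show ?thesis using ab by simp
  qed
qed

text \<open>A nontrivial element is shortened by some \<open>i\<close>, and then sends \<open>\<alpha>\<^sub>i\<close> to a negative root.\<close>

theorem root_action_faithful:
  assumes u: "u \<in> lists I" and id: "\<And>i. i \<in> I \<Longrightarrow> root_action A I u (simple_root i) = simple_root i"
  shows "eqv u []"
proof -
  obtain v where v: "v \<in> lists I" "eqv u v" "length v = len u" using len_witness[OF u] by blast
  have "v = []"
  proof (rule ccontr)
    assume "v \<noteq> []"
    then obtain v' i where v': "v = v' @ [i]" by (cases v rule: rev_cases) auto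
    have i: "i \<in> I" "v' \<in> lists I" using v(1) v' by auto
    have "len v' < len (v' @ [i])"
      using len_le[of v' v'] i(2) v(3) len_eqv[OF v(2)] v' by simp
    then have "0 \<le> root_action A I v' (simple_root i) i" using root_positive i by blast
    moreover have neg: "root_action A I [i] (simple_root i) = (\<lambda>k. (-1) * simple_root i k + 0 * simple_root i k)"
      using root_action_simple[of i i] i diag by (simp add: fun_eq_iff del: root_action.simps)
    have "root_action A I v (simple_root i) i = - root_action A I v' (simple_root i) i"
      unfolding v' root_action_append neg root_action_linear by simp
    moreover have "root_action A I v (simple_root i) i = 1"
      using id[OF i(1)] root_action_eqv[OF v(2)] by (simp add: simple_root_def)
    ultimately show False by simp
  qed
  then show ?thesis using v by simp
qed

end


section \<open>Quaternionic matrices and the Study determinant\<close>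

definition qnorm :: "quat \<Rightarrow> real" where
  "qnorm x = (qRe x)\<^sup>2 + (qI x)\<^sup>2 + (qJ x)\<^sup>2 + (qK x)\<^sup>2"

definition qreal :: "real \<Rightarrow> quat" where
  "qreal r = Quat r 0 0 0"

lemma quat_sel [simp]:
  "qRe 0 = 0" "qI 0 = 0" "qJ 0 = 0" "qK 0 = 0"
  "qRe 1 = 1" "qI 1 = 0" "qJ 1 = 0" "qK 1 = 0"
  "qRe (x + y) = qRe x + qRe y" "qI (x + y) = qI x + qI y"
  "qJ (x + y) = qJ x + qJ y" "qK (x + y) = qK x + qK y"
  "qRe (x - y) = qRe x - qRe y" "qI (x - y) = qI x - qI y"
  "qJ (x - y) = qJ x - qJ y" "qK (x - y) = qK x - qK y"
  "qRe (- x) = - qRe x" "qI (- x) = - qI x" "qJ (- x) = - qJ x" "qK (- x) = - qK x"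
  "qRe (qcnj x) = qRe x" "qI (qcnj x) = - qI x" "qJ (qcnj x) = - qJ x" "qK (qcnj x) = - qK x"
  "qRe (qreal r) = r" "qI (qreal r) = 0" "qJ (qreal r) = 0" "qK (qreal r) = 0"
  by (simp_all add: zero_quat_def one_quat_def plus_quat_def minus_quat_def uminus_quat_def
      qcnj_def qreal_def)

lemma quat_mult_sel:
  "qRe (x * y) = qRe x * qRe y - qI x * qI y - qJ x * qJ y - qK x * qK y"
  "qI (x * y) = qRe x * qI y + qI x * qRe y + qJ x * qK y - qK x * qJ y"
  "qJ (x * y) = qRe x * qJ y - qI x * qK y + qJ x * qRe y + qK x * qI y"
  "qK (x * y) = qRe x * qK y + qI x * qJ y - qJ x * qI y + qK x * qRe y"
  by (simp_all add: times_quat_def)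

lemma Quat_arith:
  "Quat a b c d + Quat a' b' c' d' = Quat (a + a') (b + b') (c + c') (d + d')"
  "Quat a b c d - Quat a' b' c' d' = Quat (a - a') (b - b') (c - c') (d - d')"
  "- Quat a b c d = Quat (- a) (- b) (- c) (- d)"
  "Quat a b c d * Quat a' b' c' d' =
    Quat (a * a' - b * b' - c * c' - d * d') (a * b' + b * a' + c * d' - d * c')
         (a * c' - b * d' + c * a' + d * b') (a * d' + b * c' - c * b' + d * a')"
  "qcnj (Quat a b c d) = Quat a (- b) (- c) (- d)"
  by (simp_all add: plus_quat_def minus_quat_def uminus_quat_def times_quat_def qcnj_def)

lemma qcnj_simps [simp]:
  "qcnj 0 = 0" "qcnj 1 = 1" "qcnj (qcnj x) = x" "qcnj (- x) = - qcnj x"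
  "qcnj (x + y) = qcnj x + qcnj y" "qcnj (x - y) = qcnj x - qcnj y"
  "qcnj (qreal r) = qreal r"
  by (simp_all add: quat_eq_iff)

lemma qcnj_mult: "qcnj (x * y) = qcnj y * qcnj x"
  by (simp add: quat_eq_iff quat_mult_sel algebra_simps)

lemma mult_qcnj: "x * qcnj x = qreal (qnorm x)" "qcnj x * x = qreal (qnorm x)"
  by (simp_all add: quat_eq_iff quat_mult_sel qnorm_def power2_eq_square)

lemma qreal_simps [simp]:
  "qreal 0 = 0" "qreal 1 = 1" "qreal r + qreal s = qreal (r + s)"
  "qreal r - qreal s = qreal (r - s)" "qreal r * qreal s = qreal (r * s)" "- qreal r = qreal (- r)"
  "qreal r = qreal s \<longleftrightarrow> r = s"
  by (simp_all add: quat_eq_iff quat_mult_sel)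

lemma qreal_eq_1 [simp]: "qreal r = 1 \<longleftrightarrow> r = 1"
  by (simp add: quat_eq_iff)

lemma qreal_commute: "x * qreal r = qreal r * x"
  by (simp add: quat_eq_iff quat_mult_sel)

lemma qreal_left_commute: "x * (qreal r * y) = qreal r * (x * y)"
  by (metis qreal_commute mult.assoc)

lemma qRe_qreal_mult [simp]: "qRe (qreal r * x) = r * qRe x"
  by (simp add: quat_mult_sel)

lemma qRe_mult_qreal: "qRe (x * (qreal r * y)) = r * qRe (x * y)"
  by (simp add: qreal_left_commute)

lemma qcnj_qreal_mult: "qcnj (qreal r * x) = qreal r * qcnj x"
  by (simp add: qcnj_mult qreal_commute)

lemma qRe_commute: "qRe (x * y) = qRe (y * x)"
  by (simp add: quat_mult_sel)

lemma qnorm_mult: "qnorm (x * y) = qnorm x * qnorm y"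
  by (simp add: qnorm_def quat_mult_sel power2_eq_square algebra_simps)

lemma qnorm_simps [simp]:
  "qnorm 0 = 0" "qnorm 1 = 1" "qnorm (- x) = qnorm x" "qnorm (qcnj x) = qnorm x"
  "qnorm (qreal r) = r\<^sup>2"
  by (simp_all add: qnorm_def)

lemma qnorm_add: "qnorm (x + y) = qnorm x + qnorm y + 2 * qRe (x * qcnj y)"
  by (simp add: qnorm_def quat_mult_sel power2_eq_square algebra_simps)

lemma qnorm_diff: "qnorm (x - y) = qnorm x + qnorm y - 2 * qRe (x * qcnj y)"
  using qnorm_add[of x "- y"] by simp

lemma qnorm_nonneg: "0 \<le> qnorm x"
  by (simp add: qnorm_def)

lemma qnorm_eq_0_iff: "qnorm x = 0 \<longleftrightarrow> x = 0"
proof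
  assume "qnorm x = 0"
  then have "(qRe x)\<^sup>2 = 0 \<and> (qI x)\<^sup>2 = 0 \<and> (qJ x)\<^sup>2 = 0 \<and> (qK x)\<^sup>2 = 0"
    unfolding qnorm_def by (smt (verit) zero_le_power2)
  then show "x = 0" by (simp add: quat_eq_iff)
qed simp

lemma qRe_mult_sum: "2 * qRe x * qRe y = qRe (x * y) + qRe (x * qcnj y)"
  by (simp add: quat_mult_sel)

definition mat2 :: "quat \<Rightarrow> quat \<Rightarrow> quat \<Rightarrow> quat \<Rightarrow> quat^2^2" where
  "mat2 a b c d = (\<chi> i j. if i = 1 then if j = 1 then a else b else if j = 1 then c else d)"

lemma mat2_nth [simp]:
  "mat2 a b c d $ 1 $ 1 = a" "mat2 a b c d $ 1 $ 2 = b"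
  "mat2 a b c d $ 2 $ 1 = c" "mat2 a b c d $ 2 $ 2 = d"
  by (simp_all add: mat2_def)

lemma mat2_cases: obtains a b c d where "S = mat2 a b c d"
proof
  show "S = mat2 (S $ 1 $ 1) (S $ 1 $ 2) (S $ 2 $ 1) (S $ 2 $ 2)"
    by (simp add: vec_eq_iff forall_2)
qed

lemma mat2_eq_iff [simp]:
  "mat2 a b c d = mat2 a' b' c' d' \<longleftrightarrow> a = a' \<and> b = b' \<and> c = c' \<and> d = d'"
  by (metis mat2_nth)

lemma mat2_mult:
  "mat2 a b c d ** mat2 a' b' c' d' =
    mat2 (a * a' + b * c') (a * b' + b * d') (c * a' + d * c') (c * b' + d * d')"
  by (simp add: vec_eq_iff forall_2 matrix_matrix_mult_def sum_2)

lemma mat2_uminus: "- mat2 a b c d = mat2 (- a) (- b) (- c) (- d)"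
  by (simp add: vec_eq_iff forall_2)

lemma mat2_one: "mat 1 = mat2 1 0 0 1"
  by (simp add: vec_eq_iff forall_2 mat_def)

lemma conj_transpose_mat2: "conj_transpose (mat2 a b c d) = mat2 (qcnj a) (qcnj c) (qcnj b) (qcnj d)"
  by (simp add: vec_eq_iff forall_2 conj_transpose_def)

lemma matrix_uminus_mult:
  fixes S T :: "quat^2^2"
  shows "(- S) ** T = - (S ** T)" "S ** (- T) = - (S ** T)"
  by (cases S rule: mat2_cases; cases T rule: mat2_cases;
      simp add: mat2_mult mat2_uminus algebra_simps)+

lemma conj_transpose_mult: "conj_transpose (S ** T) = conj_transpose T ** conj_transpose S"
  by (cases S rule: mat2_cases; cases T rule: mat2_cases)
    (simp add: mat2_mult conj_transpose_mat2 qcnj_mult)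

lemma conj_transpose_uminus: "conj_transpose (- S) = - conj_transpose S"
  by (cases S rule: mat2_cases) (simp add: mat2_uminus conj_transpose_mat2)

text \<open>The determinant of \<open>S S\<dagger>\<close> written out, which is the square of the Dieudonne determinant. Matrices of
  determinant one are those at which it equals one.\<close>

definition study_det :: "quat^2^2 \<Rightarrow> real" where
  "study_det S = qnorm (S $ 1 $ 1) * qnorm (S $ 2 $ 2) + qnorm (S $ 1 $ 2) * qnorm (S $ 2 $ 1)
     - 2 * qRe (S $ 1 $ 1 * qcnj (S $ 2 $ 1) * S $ 2 $ 2 * qcnj (S $ 1 $ 2))"

lemma study_det_mat2:
  "study_det (mat2 a b c d) = qnorm a * qnorm d + qnorm b * qnorm c - 2 * qRe (a * qcnj c * d * qcnj b)"
  by (simp add: study_det_def)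

definition herm2 :: "real \<Rightarrow> quat \<Rightarrow> real \<Rightarrow> quat^2^2" where
  "herm2 p q r = mat2 (qreal p) q (qcnj q) (qreal r)"

lemma hermitian_det_herm2: "hermitian_det (herm2 p q r) = qreal (p * r - qnorm q)"
  by (simp add: hermitian_det_def herm2_def mult_qcnj)

lemma self_adjoint_real: "x + qcnj x = qreal (2 * qRe x)"
  by (simp add: quat_eq_iff)

lemma herm2_congruence:
  "mat2 a b c d ** herm2 p q r ** conj_transpose (mat2 a b c d) =
    herm2 (p * qnorm a + r * qnorm b + 2 * qRe (a * q * qcnj b))
      (qreal p * (a * qcnj c) + (a * q * qcnj d + b * qcnj q * qcnj c) + qreal r * (b * qcnj d))
      (p * qnorm c + r * qnorm d + 2 * qRe (c * q * qcnj d))"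
proof -
  have diagonal: "(x * qreal p + y * qcnj q) * qcnj x + (x * q + y * qreal r) * qcnj y =
      qreal (p * qnorm x + r * qnorm y + 2 * qRe (x * q * qcnj y))" for x y
  proof -
    have "(x * qreal p + y * qcnj q) * qcnj x + (x * q + y * qreal r) * qcnj y =
      qreal p * (x * qcnj x) + qreal r * (y * qcnj y) + (x * q * qcnj y + qcnj (x * q * qcnj y))"
      by (simp only: qcnj_mult qcnj_simps distrib_right qreal_commute mult.assoc add.assoc add.commute add.left_commute)
    then show ?thesis by (simp add: mult_qcnj self_adjoint_real)
  qed
  have off: "(x * qreal p + y * qcnj q) * qcnj z + (x * q + y * qreal r) * qcnj w =
    qreal p * (x * qcnj z) + (x * q * qcnj w + y * qcnj q * qcnj z) + qreal r * (y * qcnj w)" for x y z w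
    by (simp only: distrib_right qreal_commute mult.assoc add.assoc add.commute add.left_commute)
  show ?thesis
    unfolding herm2_def conj_transpose_mat2 mat2_mult mat2_eq_iff diagonal off
    by (simp add: qcnj_mult qreal_commute mult.assoc)
qed

text \<open>The determinant of \<open>S H S\<dagger>\<close> with the entries of \<open>herm2_congruence\<close>. The identity is compared
  coefficient by coefficient in \<open>p\<close> and \<open>r\<close>. All coefficients follow from cyclicity of the real part
  and multiplicativity of the norm, except the one without \<open>p\<close> and \<open>r\<close>, which needs
  \<open>2 Re x Re y = Re (x y) + Re (x y\<^sup>*)\<close>.\<close>

lemma herm2_congruence_det:
  "(p * qnorm a + r * qnorm b + 2 * qRe (a * q * qcnj b)) * (p * qnorm c + r * qnorm d + 2 * qRe (c * q * qcnj d))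
   - qnorm (qreal p * (a * qcnj c) + (a * q * qcnj d + b * qcnj q * qcnj c) + qreal r * (b * qcnj d))
   = (p * r - qnorm q) * study_det (mat2 a b c d)"
proof -
  define u v w where "u = a * qcnj c" and "v = a * q * qcnj d + b * qcnj q * qcnj c" and "w = b * qcnj d"
  have Re_sandwich: "qRe (x * y * qcnj x) = qnorm x * qRe y" for x y
    by (metis mult.assoc mult_qcnj(2) qRe_commute qRe_qreal_mult)
  have Re_cnj: "qRe (qcnj x) = qRe x" for x by simp
  have uv: "qRe (u * qcnj v) = qnorm a * qRe (c * q * qcnj d) + qnorm c * qRe (a * q * qcnj b)"
  proof -
    have "qRe (u * qcnj v) = qRe (a * (qcnj c * d * qcnj q) * qcnj a) + qRe (a * (qcnj c * c) * q * qcnj b)"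
      by (simp add: u_def v_def qcnj_mult algebra_simps)
    also have "qRe (a * (qcnj c * d * qcnj q) * qcnj a) = qnorm a * qRe (c * q * qcnj d)"
      unfolding Re_sandwich
      using Re_cnj[of "qcnj c * d * qcnj q"] qRe_commute[of q "qcnj d * c"] qRe_commute[of c "q * qcnj d"]
      by (simp add: qcnj_mult mult.assoc)
    also have "qRe (a * (qcnj c * c) * q * qcnj b) = qnorm c * qRe (a * q * qcnj b)"
      by (simp add: mult_qcnj qreal_commute mult.assoc)
    finally show ?thesis .
  qed
  have vw: "qRe (v * qcnj w) = qnorm d * qRe (a * q * qcnj b) + qnorm b * qRe (c * q * qcnj d)"
  proof -
    have "qRe (v * qcnj w) = qRe (a * q * (qcnj d * d) * qcnj b) + qRe (b * (qcnj q * qcnj c * d) * qcnj b)"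
      by (simp add: w_def v_def qcnj_mult algebra_simps)
    also have "qRe (b * (qcnj q * qcnj c * d) * qcnj b) = qnorm b * qRe (c * q * qcnj d)"
      unfolding Re_sandwich
      using Re_cnj[of "qcnj q * qcnj c * d"] qRe_commute[of "qcnj d" "c * q"]
      by (simp add: qcnj_mult mult.assoc)
    also have "qRe (a * q * (qcnj d * d) * qcnj b) = qnorm d * qRe (a * q * qcnj b)"
      by (simp add: mult_qcnj qreal_commute qreal_left_commute mult.assoc)
    finally show ?thesis .
  qed
  have uw: "qRe (u * qcnj w) = qRe (a * qcnj c * d * qcnj b)"
    by (simp add: u_def w_def qcnj_mult mult.assoc)
  have vv: "qnorm v = qnorm q * (qnorm a * qnorm d + qnorm b * qnorm c) + 2 * qRe (a * q * qcnj d * c * q * qcnj b)"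
    by (simp add: v_def qnorm_add qnorm_mult qcnj_mult algebra_simps)
  have four: "4 * qRe (a * q * qcnj b) * qRe (c * q * qcnj d) =
      2 * qRe (a * q * qcnj d * c * q * qcnj b) + 2 * qnorm q * qRe (a * qcnj c * d * qcnj b)"
  proof -
    define x y where "x = q * (qcnj b * a)" and "y = q * (qcnj d * c)"
    have x: "qRe (a * q * qcnj b) = qRe x"
      using qRe_commute[of a "q * qcnj b"] by (simp add: x_def mult.assoc)
    have y: "qRe (c * q * qcnj d) = qRe y"
      using qRe_commute[of c "q * qcnj d"] by (simp add: y_def mult.assoc)
    have xy: "qRe (x * y) = qRe (a * q * qcnj d * c * q * qcnj b)"
      using qRe_commute[of "q * qcnj b" "a * q * qcnj d * c"] by (simp add: x_def y_def mult.assoc)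
    have "x * qcnj y = q * (qcnj b * a * qcnj c * d) * qcnj q"
      by (simp add: x_def y_def qcnj_mult mult.assoc)
    then have "qRe (x * qcnj y) = qnorm q * qRe (qcnj b * a * qcnj c * d)"
      by (simp only: Re_sandwich)
    then have "qRe (x * qcnj y) = qnorm q * qRe (a * qcnj c * d * qcnj b)"
      using qRe_commute[of "qcnj b" "a * qcnj c * d"] by (simp add: mult.assoc)
    then show ?thesis using qRe_mult_sum[of x y] x y xy by simp
  qed
  have "qnorm (qreal p * u + v + qreal r * w) =
      p\<^sup>2 * qnorm u + qnorm v + r\<^sup>2 * qnorm w + 2 * p * qRe (u * qcnj v)
        + 2 * p * r * qRe (u * qcnj w) + 2 * r * qRe (v * qcnj w)"
    by (simp add: qnorm_add qnorm_mult qcnj_qreal_mult distrib_right mult.assoc qRe_mult_qreal)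
  moreover have "qnorm u = qnorm a * qnorm c" "qnorm w = qnorm b * qnorm d"
    by (simp_all add: u_def w_def qnorm_mult)
  ultimately show ?thesis
    using four
    unfolding u_def[symmetric] v_def[symmetric] w_def[symmetric] study_det_mat2 uv vw uw vv
    by (simp add: algebra_simps power2_eq_square)
qed

lemma mult_conj_transpose_herm2:
  obtains p q r where "S ** conj_transpose S = herm2 p q r" "study_det S = p * r - qnorm q"
proof -
  obtain a b c d where S: "S = mat2 a b c d" by (rule mat2_cases)
  have "mat 1 = herm2 1 0 1" by (simp add: herm2_def mat2_one)
  then have "S ** conj_transpose S = S ** herm2 1 0 1 ** conj_transpose S"
    by (metis matrix_mul_rid)
  then show ?thesis
    using herm2_congruence[of a b c d 1 0 1] herm2_congruence_det[of 1 a 1 b 0 c d] that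
    by (simp add: S)
qed

lemma hermitian_det_mult_conj_transpose:
  "hermitian_det (S ** conj_transpose S) = qreal (study_det S)"
  by (metis mult_conj_transpose_herm2 hermitian_det_herm2)

text \<open>Because \<open>S T (S T)\<dagger> = S (T T\<dagger>) S\<dagger>\<close> is a congruence of a Hermitian matrix.\<close>

lemma study_det_mult: "study_det (S ** T) = study_det S * study_det T"
proof -
  obtain a b c d where S: "S = mat2 a b c d" by (rule mat2_cases)
  obtain p q r where T: "T ** conj_transpose T = herm2 p q r" "study_det T = p * r - qnorm q"
    by (rule mult_conj_transpose_herm2)
  have "S ** T ** conj_transpose (S ** T) = S ** herm2 p q r ** conj_transpose S"
    by (simp add: conj_transpose_mult matrix_mul_assoc flip: T)
  then have "qreal (study_det (S ** T)) = hermitian_det (S ** herm2 p q r ** conj_transpose S)"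
    by (simp flip: hermitian_det_mult_conj_transpose)
  also have "\<dots> = qreal ((p * r - qnorm q) * study_det S)"
    unfolding S herm2_congruence hermitian_det_herm2 herm2_congruence_det ..
  finally show ?thesis using T by simp
qed

lemma study_det_uminus [simp]: "study_det (- S) = study_det S"
  by (simp add: study_det_def)

lemma study_det_one [simp]: "study_det (mat 1) = 1"
  by (simp add: mat2_one study_det_mat2)

definition adj2 :: "quat^2^2 \<Rightarrow> quat^2^2" where
  "adj2 S = mat2 (S $ 2 $ 2) (- S $ 1 $ 2) (- S $ 2 $ 1) (S $ 1 $ 1)"

lemma adj2_mat2: "adj2 (mat2 a b c d) = mat2 d (- b) (- c) a"
  by (simp add: adj2_def)

lemma herm2_adj2: "herm2 p q r ** adj2 (herm2 p q r) = mat2 (qreal (p * r - qnorm q)) 0 0 (qreal (p * r - qnorm q))"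
  by (simp add: herm2_def adj2_mat2 mat2_mult quat_eq_iff quat_mult_sel qnorm_def power2_eq_square
      algebra_simps)

text \<open>For \<open>S\<close> of determinant one, a right inverse can be read off from \<open>(S S\<dagger>) adj(S S\<dagger>) = 1\<close>; it is a left inverse because it has
  determinant one and hence a right inverse itself.\<close>

definition inv2 :: "quat^2^2 \<Rightarrow> quat^2^2" where
  "inv2 S = conj_transpose S ** adj2 (S ** conj_transpose S)"

lemma inv2_right: assumes "study_det S = 1" shows "S ** inv2 S = mat 1"
proof -
  obtain p q r where h: "S ** conj_transpose S = herm2 p q r" "study_det S = p * r - qnorm q"
    by (rule mult_conj_transpose_herm2)
  have "S ** inv2 S = herm2 p q r ** adj2 (herm2 p q r)"
    by (simp add: inv2_def matrix_mul_assoc h(1))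
  then show ?thesis using assms h(2) by (simp add: herm2_adj2 mat2_one)
qed

lemma study_det_inv2: "study_det S = 1 \<Longrightarrow> study_det (inv2 S) = 1"
  using study_det_mult[of S "inv2 S"] by (simp add: inv2_right)

lemma inv2_left: assumes "study_det S = 1" shows "inv2 S ** S = mat 1"
proof -
  define T where "T = inv2 S"
  have "T ** inv2 T = mat 1" "S ** T = mat 1"
    using assms by (auto simp: T_def inv2_right study_det_inv2)
  then have "inv2 T = S" by (metis matrix_mul_assoc matrix_mul_lid matrix_mul_rid)
  then show ?thesis using \<open>T ** inv2 T = mat 1\<close> by (simp add: T_def)
qed

lemma carrier_SL2_quat: "carrier SL2_quat = {S. study_det S = 1}"
  by (simp add: SL2_quat_def hermitian_det_mult_conj_transpose)

lemma group_SL2_quat: "group SL2_quat"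
proof (rule groupI)
  fix S assume "S \<in> carrier SL2_quat"
  then show "\<exists>T\<in>carrier SL2_quat. T \<otimes>\<^bsub>SL2_quat\<^esub> S = \<one>\<^bsub>SL2_quat\<^esub>"
    unfolding carrier_SL2_quat
    by (intro bexI[of _ "inv2 S"]) (auto simp: SL2_quat_def inv2_left study_det_inv2)
qed (unfold carrier_SL2_quat, auto simp: SL2_quat_def study_det_mult matrix_mul_assoc)


section \<open>The spin representation of the Weyl group\<close>

text \<open>The off-diagonal entries of the simple roots of \<open>F\<^sub>4\<close>: Hurwitz units for the long nodes 1 and 2, and
  short roots scaled by \<open>\<surd>2\<close> for the nodes 3 and 4. The affine node 0 uses the highest root \<open>1\<close>.\<close>

definition root_unit :: "int \<Rightarrow> quat" where
  "root_unit i =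
    (if i = 1 then Quat (1/2) (-1/2) (-1/2) (-1/2) else
     if i = 2 then Quat 0 1 0 0 else
     if i = 3 then Quat 0 (- sqrt 2 / 2) (sqrt 2 / 2) 0
     else Quat 0 0 (- sqrt 2 / 2) (sqrt 2 / 2))"

definition root_matrix :: "int \<Rightarrow> quat^2^2" where
  "root_matrix i =
    (if i = -1 then herm2 1 0 (-1) else if i = 0 then herm2 (-1) (-1) 0 else herm2 0 (root_unit i) 0)"

definition root_factor :: "bool \<Rightarrow> int \<Rightarrow> quat^2^2" where
  "root_factor e i = (if e then root_matrix i else adj2 (root_matrix i))"

text \<open>The flag says whether the word starts with a root matrix or with the adjugate of one. Both versions are
  needed because a relator can be inserted at an odd position.\<close>

fun spin :: "bool \<Rightarrow> int list \<Rightarrow> quat^2^2" where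
  "spin e [] = mat 1"
| "spin e (i # w) = root_factor e i ** spin (\<not> e) w"

lemma F4pp_nodes_eq: "F4pp_nodes = {-1, 0, 1, 2, 3, 4}"
  by (auto simp: F4pp_nodes_def)

lemma spin_append: "spin e (u @ v) = spin e u ** spin (e = even (length u)) v"
proof (induction u arbitrary: e)
  case (Cons i u)
  have "((\<not> e) = even (length u)) = (e = even (length (i # u)))" by auto
  then show ?case using Cons[of "\<not> e"] by (simp add: matrix_mul_assoc)
qed simp

lemma adj2_herm2: "adj2 (herm2 p q r) = herm2 r (- q) p"
  by (simp add: herm2_def adj2_mat2)

lemma conj_transpose_herm2: "conj_transpose (herm2 p q r) = herm2 p q r"
  by (simp add: herm2_def conj_transpose_mat2)

definition scalar2 :: "real \<Rightarrow> quat^2^2" where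
  "scalar2 c = mat2 (qreal c) 0 0 (qreal c)"

lemma scalar2_commute: "X ** scalar2 c = scalar2 c ** X"
  by (cases X rule: mat2_cases) (simp add: scalar2_def mat2_mult qreal_commute)

lemma scalar2_mult: "scalar2 c ** scalar2 d = scalar2 (c * d)"
  by (simp add: scalar2_def mat2_mult)

lemma scalar2_pm_one: "scalar2 1 = mat 1" "scalar2 (-1) = - mat 1" "scalar2 0 = 0"
  by (simp_all add: scalar2_def mat2_one mat2_uminus quat_eq_iff vec_eq_iff forall_2)

lemma mat2_add: "mat2 a b c d + mat2 a' b' c' d' = mat2 (a + a') (b + b') (c + c') (d + d')"
  by (simp add: vec_eq_iff forall_2)

lemma mat2_diff: "mat2 a b c d - mat2 a' b' c' d' = mat2 (a - a') (b - b') (c - c') (d - d')"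
  by (simp add: vec_eq_iff forall_2)

definition polar_det :: "quat^2^2 \<Rightarrow> quat^2^2 \<Rightarrow> real" where
  "polar_det X Y = qRe (X $ 1 $ 1) * qRe (Y $ 2 $ 2) + qRe (Y $ 1 $ 1) * qRe (X $ 2 $ 2)
     - 2 * qRe (X $ 1 $ 2 * qcnj (Y $ 1 $ 2))"

lemma polar_det_herm2: "polar_det (herm2 p q r) (herm2 p' q' r') = p * r' + p' * r - 2 * qRe (q * qcnj q')"
  by (simp add: polar_det_def herm2_def)

lemma matrix_add_rdistrib: "(X + Y) ** Z = X ** Z + Y ** Z"
  for X Y Z :: "quat^2^2"
  by (cases X rule: mat2_cases; cases Y rule: mat2_cases; cases Z rule: mat2_cases)
    (simp add: mat2_add mat2_mult algebra_simps)

lemma matrix_diff_distrib: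
  fixes X Y Z :: "quat^2^2"
  shows "(X - Y) ** Z = X ** Z - Y ** Z" "Z ** (X - Y) = Z ** X - Z ** Y"
  using matrix_add_rdistrib[of X "- Y" Z] matrix_add_ldistrib[of Z X "- Y"]
  by (simp_all add: matrix_uminus_mult)

lemma adj2_polar:
  "herm2 p q r ** adj2 (herm2 p' q' r') + herm2 p' q' r' ** adj2 (herm2 p q r) =
    scalar2 (polar_det (herm2 p q r) (herm2 p' q' r'))"
  unfolding polar_det_herm2
  by (simp add: herm2_def adj2_mat2 mat2_mult mat2_add scalar2_def quat_eq_iff quat_mult_sel algebra_simps)

lemma herm2_unit:
  assumes "p * r - qnorm q = -1"
  shows "herm2 p q r ** adj2 (herm2 p q r) = - mat 1" "adj2 (herm2 p q r) ** herm2 p q r = - mat 1"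
  using herm2_adj2[of p q r] herm2_adj2[of r "- q" p] assms
  by (simp_all add: adj2_herm2 mult.commute mat2_one mat2_uminus quat_eq_iff)

lemma matrix_move_summand: "X + Y = Z \<Longrightarrow> X = Z - (Y :: quat^2^2)"
  by (simp add: algebra_simps)

text \<open>Multiply the polarised identity \<open>H adj(X) + X adj(H) = c\<close> by \<open>H\<close> and use
  \<open>adj(H) H = -1\<close>.\<close>

lemma herm2_reflection:
  assumes "p * r - qnorm q = -1"
  shows "herm2 p q r ** adj2 (herm2 p' q' r') ** herm2 p q r =
    herm2 p' q' r' + scalar2 (polar_det (herm2 p q r) (herm2 p' q' r')) ** herm2 p q r"
proof -
  define H X c where "H = herm2 p q r" and "X = herm2 p' q' r'" and "c = polar_det (herm2 p q r) (herm2 p' q' r')"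
  have "H ** adj2 X = scalar2 c - (X ** adj2 H)"
    unfolding H_def X_def c_def by (rule matrix_move_summand, rule adj2_polar)
  then have "H ** adj2 X ** H = scalar2 c ** H - (X ** (adj2 H ** H))"
    by (simp add: matrix_diff_distrib matrix_mul_assoc)
  also have "adj2 H ** H = - mat 1" unfolding H_def by (rule herm2_unit(2)[OF assms])
  finally show ?thesis by (simp add: H_def X_def c_def matrix_uminus_mult add.commute)
qed

text \<open>With \<open>X = H adj(H')\<close> the matrix \<open>H' adj(H)\<close> is both \<open>X\<^sup>-\<^sup>1\<close> and, by polarisation,
  \<open>c - X\<close>.\<close>

lemma herm2_product_square:
  assumes "p * r - qnorm q = -1" "p' * r' - qnorm q' = -1"
  defines "X \<equiv> herm2 p q r ** adj2 (herm2 p' q' r')" and "c \<equiv> polar_det (herm2 p q r) (herm2 p' q' r')"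
  shows "X ** X = scalar2 c ** X - mat 1"
proof -
  define Y where "Y = herm2 p' q' r' ** adj2 (herm2 p q r)"
  have "X + Y = scalar2 c" unfolding X_def Y_def c_def by (rule adj2_polar)
  then have "X ** X + Y ** X = scalar2 c ** X" by (metis matrix_add_rdistrib)
  moreover have "Y ** X = herm2 p' q' r' ** (adj2 (herm2 p q r) ** herm2 p q r) ** adj2 (herm2 p' q' r')"
    by (simp add: X_def Y_def matrix_mul_assoc)
  then have "Y ** X = mat 1"
    by (simp add: herm2_unit[OF assms(1)] herm2_unit[OF assms(2)] matrix_uminus_mult)
  ultimately show ?thesis using matrix_move_summand by metis
qed

lemma root_matrix_herm2:
  assumes "i \<in> F4pp_nodes"
  obtains p q r where "root_matrix i = herm2 p q r" "p * r - qnorm q = -1"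
proof -
  have "qnorm (root_unit i) = 1"
    by (simp add: root_unit_def qnorm_def power_divide)
  then have "\<exists>p q r. root_matrix i = herm2 p q r \<and> p * r - qnorm q = -1"
    by (intro exI[of _ "if i = -1 then 1 else if i = 0 then -1 else 0"]
        exI[of _ "if i = -1 then 0 else if i = 0 then -1 else root_unit i"]
        exI[of _ "if i = -1 then -1 else 0"]) (simp add: root_matrix_def)
  then show ?thesis using that by blast
qed

lemma root_factor_herm2:
  assumes "i \<in> F4pp_nodes"
  obtains p q r where "root_factor e i = herm2 p q r" "p * r - qnorm q = -1"
  using assms
proof (rule root_matrix_herm2)
  fix p q r assume "root_matrix i = herm2 p q r" "p * r - qnorm q = -1"
  then show thesis
    using that[of p q r] that[of r "- q" p] by (cases e) (auto simp: root_factor_def adj2_herm2 mult.commute)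
qed

text \<open>This is where the Cartan matrix enters: up to the normalisation of the short roots, the polar determinant
  is the negative of the inner product of the roots.\<close>

lemma polar_det_roots:
  assumes "i \<in> F4pp_nodes" "j \<in> F4pp_nodes" "i \<noteq> j"
  shows "(polar_det (root_matrix i) (root_matrix j))\<^sup>2 = of_int (F4pp_cartan i j * F4pp_cartan j i)"
  using assms unfolding F4pp_nodes_eq insert_iff empty_iff
  by (elim disjE; simp add: root_matrix_def polar_det_herm2 root_unit_def F4pp_cartan_def quat_mult_sel
      power2_eq_square)

lemma adj2_adj2 [simp]: "adj2 (adj2 X) = X"
  by (cases X rule: mat2_cases) (simp add: adj2_mat2)

lemma polar_det_adj2: "polar_det (adj2 X) (adj2 Y) = polar_det X Y"
  by (cases X rule: mat2_cases; cases Y rule: mat2_cases)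
    (simp add: adj2_mat2 polar_det_def algebra_simps)

lemma root_factor_adj2: "adj2 (root_factor e i) = root_factor (\<not> e) i"
  by (simp add: root_factor_def)

lemma spin_square:
  assumes "i \<in> F4pp_nodes" shows "spin e [i, i] = - mat 1"
proof -
  obtain p q r where h: "root_factor e i = herm2 p q r" "p * r - qnorm q = -1"
    using root_factor_herm2[OF assms] by blast
  have "root_factor (\<not> e) i = adj2 (herm2 p q r)"
    unfolding h(1)[symmetric] root_factor_adj2 ..
  then show ?thesis using herm2_unit(1)[OF h(2)] by (simp add: h(1))
qed

text \<open>Powers of \<open>X\<close> reduce modulo \<open>X\<^sup>2 = c X - 1\<close>: for \<open>c\<^sup>2 = 0, 1, 2\<close> they give
  \<open>X\<^sup>2 = -1\<close>, \<open>X\<^sup>3 = -c\<close> and \<open>X\<^sup>4 = -1\<close>.\<close>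

lemma spin_braid:
  assumes ij: "i \<in> F4pp_nodes" "j \<in> F4pp_nodes" "i \<noteq> j"
    and m: "coxeter_exponent F4pp_cartan i j = enat m"
  shows "spin e (concat (replicate m [i, j])) \<in> {mat 1, - mat 1}"
proof -
  define c where "c = polar_det (root_matrix i) (root_matrix j)"
  define X where "X = root_factor e i ** root_factor (\<not> e) j"
  have c2: "c\<^sup>2 = of_int (F4pp_cartan i j * F4pp_cartan j i)"
    unfolding c_def by (rule polar_det_roots[OF ij])
  have X2: "X ** X = scalar2 c ** X - mat 1"
  proof -
    obtain p q r where h: "root_factor e i = herm2 p q r" "p * r - qnorm q = -1"
      using root_factor_herm2[OF ij(1)] by blast
    obtain p' q' r' where h': "root_factor e j = herm2 p' q' r'" "p' * r' - qnorm q' = -1"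
      using root_factor_herm2[OF ij(2)] by blast
    have "X = herm2 p q r ** adj2 (herm2 p' q' r')"
      unfolding X_def h(1)[symmetric] h'(1)[symmetric] root_factor_adj2 ..
    moreover have "polar_det (herm2 p q r) (herm2 p' q' r') = c"
      unfolding h(1)[symmetric] h'(1)[symmetric] c_def
      by (simp add: root_factor_def polar_det_adj2)
    ultimately show ?thesis using herm2_product_square[OF h(2) h'(2)] by simp
  qed
  have sp: "spin e (concat (replicate (Suc n) [i, j])) = X ** spin e (concat (replicate n [i, j]))" for n
    by (simp add: X_def matrix_mul_assoc)
  have s0: "spin e (concat (replicate 0 [i, j])) = mat 1" by simp
  have X3: "X ** (X ** X) = scalar2 (c\<^sup>2 - 1) ** X - scalar2 c"
  proof -
    have "X ** (X ** X) = (scalar2 c ** X - mat 1) ** X" by (metis X2 matrix_mul_assoc)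
    also have "\<dots> = scalar2 c ** (X ** X) - X"
      by (simp add: matrix_diff_distrib matrix_mul_assoc)
    also have "\<dots> = scalar2 (c\<^sup>2) ** X - scalar2 c - X"
      unfolding X2 by (simp add: matrix_diff_distrib matrix_mul_assoc scalar2_mult power2_eq_square)
    also have "\<dots> = scalar2 (c\<^sup>2 - 1) ** X - scalar2 c"
      by (cases X rule: mat2_cases)
        (simp add: scalar2_def mat2_mult mat2_diff quat_eq_iff quat_mult_sel algebra_simps)
    finally show ?thesis .
  qed
  consider "F4pp_cartan i j * F4pp_cartan j i = 0" "m = 2" | "F4pp_cartan i j * F4pp_cartan j i = 1" "m = 3"
    | "F4pp_cartan i j * F4pp_cartan j i = 2" "m = 4"
    using m ij unfolding F4pp_nodes_eq
    by (auto simp: coxeter_exponent_def F4pp_cartan_def numeral_eq_enat split: if_splits)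
  then show ?thesis
  proof cases
    case 1
    then have "c = 0" using c2 by (metis of_int_0 zero_eq_power2)
    then have "X ** X = - mat 1" using X2 by (simp add: scalar2_pm_one)
    then show ?thesis using 1 sp[of 0] sp[of 1] by (simp add: numeral_2_eq_2)
  next
    case 2
    then have c: "c\<^sup>2 = 1" using c2 by simp
    then have "X ** (X ** X) = - scalar2 c" using X3 by (simp add: scalar2_pm_one)
    moreover have "c = 1 \<or> c = -1" using c by (simp add: power2_eq_1_iff)
    ultimately have "X ** (X ** X) \<in> {mat 1, - mat 1}"
      by (auto simp: scalar2_pm_one)
    then show ?thesis using 2 sp[of 0] sp[of 1] sp[of 2] by (simp add: eval_nat_numeral)
  next
    case 3
    then have c: "c\<^sup>2 = 2" using c2 by simp
    then have "X ** (X ** (X ** X)) = X ** (X - scalar2 c)" using X3 by (simp add: scalar2_pm_one)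
    also have "\<dots> = - mat 1"
      by (simp add: matrix_diff_distrib X2 scalar2_commute)
    finally show ?thesis using 3 sp[of 0] sp[of 1] sp[of 2] sp[of 3] by (simp add: eval_nat_numeral)
  qed
qed

lemma spin_pres_eq:
  assumes "pres_eq F4pp_nodes (coxeter_relators F4pp_cartan F4pp_nodes) u v"
  shows "spin e (map fst u) = spin e (map fst v) \<or> spin e (map fst u) = - spin e (map fst v)"
  using assms
proof (induction arbitrary: e rule: pres_eq.induct)
  case (pres_sym u v)
  then show ?case by (metis minus_minus)
next
  case (pres_trans u v w)
  then show ?case by (metis minus_minus)
next
  case (pres_cancel x u b v)
  have "spin e (map fst (u @ [(x, b), (x, \<not> b)] @ v)) =
      spin e (map fst u @ [x, x] @ map fst v)" for e by simp
  then show ?case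
    unfolding map_append spin_append
    using spin_square[OF pres_cancel(1)]
    by (simp add: spin_append matrix_uminus_mult del: spin.simps append_Cons append_Nil)
next
  case (pres_relator r u v)
  have r: "spin e (map fst r) \<in> {mat 1, - mat 1}" for e
    using pres_relator
    by (auto simp: coxeter_relators_def map_concat spin_square dest: spin_braid simp del: spin.simps)
  have "even (length r)" using pres_relator by (rule even_length_coxeter_relator)
  then show ?case
    using r[of "e = even (length u)"]
    by (auto simp: spin_append matrix_uminus_mult)
qed auto

subsection \<open>The action on Hermitian matrices\<close>

text \<open>The lattice vector with coordinates \<open>v\<close>, that is, the sum of the \<open>v i\<close> times the simple roots. The short
  simple roots are here the ones of determinant \<open>-1/2\<close>, which \<open>root_matrix\<close> rescales.\<close>

definition lattice_matrix :: "(int \<Rightarrow> int) \<Rightarrow> quat^2^2" where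
  "lattice_matrix v = herm2 (v (-1) - v 0)
     (Quat (- v 0 + v 1 / 2) (- v 1 / 2 + v 2 - v 3 / 2) (- v 1 / 2 + v 3 / 2 - v 4 / 2) (- v 1 / 2 + v 4 / 2))
     (- v (-1))"

lemma herm2_eq_iff: "herm2 p q r = herm2 p' q' r' \<longleftrightarrow> p = p' \<and> q = q' \<and> r = r'"
  by (auto simp: herm2_def)

lemma lattice_matrix_inj:
  assumes "lattice_matrix v = lattice_matrix w" "i \<in> F4pp_nodes"
  shows "v i = w i"
proof -
  have e: "real_of_int (v (-1)) = w (-1)" "real_of_int (v 0) = w 0" "real_of_int (v 1) = w 1"
    "real_of_int (v 2) = w 2" "real_of_int (v 3) = w 3" "real_of_int (v 4) = w 4"
    using assms(1) unfolding lattice_matrix_def herm2_eq_iff quat.inject by linarith+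
  then show ?thesis using assms(2) unfolding F4pp_nodes_eq by auto
qed

lemma sqrt2_mult_sqrt2: "sqrt 2 * (sqrt 2 * x) = 2 * x"
  by (simp flip: mult.assoc)

lemma root_matrix_reflection:
  assumes "i \<in> F4pp_nodes"
  shows "root_matrix i ** adj2 (lattice_matrix v) ** root_matrix i =
    lattice_matrix (root_action F4pp_cartan F4pp_nodes [i] v)"
proof -
  obtain p q r where h: "root_matrix i = herm2 p q r" "p * r - qnorm q = -1"
    using root_matrix_herm2[OF assms] by blast
  have "root_matrix i ** adj2 (lattice_matrix v) ** root_matrix i =
    lattice_matrix v + scalar2 (polar_det (root_matrix i) (lattice_matrix v)) ** root_matrix i"
    unfolding h(1) lattice_matrix_def by (rule herm2_reflection[OF h(2)])
  also have "\<dots> = lattice_matrix (root_action F4pp_cartan F4pp_nodes [i] v)"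
    using assms unfolding F4pp_nodes_eq insert_iff empty_iff
    by (elim disjE; simp add: lattice_matrix_def root_matrix_def root_unit_def polar_det_herm2
        F4pp_cartan_def quat_mult_sel; simp add: herm2_def scalar2_def mat2_mult mat2_add quat_eq_iff
        quat_mult_sel field_simps sqrt2_mult_sqrt2)
  finally show ?thesis .
qed

text \<open>Words of odd length exchange the lattice with its image under the adjugate.\<close>

definition lattice_factor :: "bool \<Rightarrow> (int \<Rightarrow> int) \<Rightarrow> quat^2^2" where
  "lattice_factor e v = (if e then lattice_matrix v else adj2 (lattice_matrix v))"

lemma root_factor_reflection:
  assumes "i \<in> F4pp_nodes"
  shows "root_factor e i ** lattice_factor (\<not> e) v ** conj_transpose (root_factor e i) =
    lattice_factor e (root_action F4pp_cartan F4pp_nodes [i] v)"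
proof -
  have adj_triple: "adj2 H ** X ** adj2 H = adj2 (H ** adj2 X ** H)"
    if "H = herm2 p q r" "X = herm2 p' q' r'" "p * r - qnorm q = -1" for H X p q r p' q' r'
  proof -
    have "r * p - qnorm (- q) = -1" using that(3) by (simp add: mult.commute)
    note herm2_reflection[OF this, of r' "- q'" p'] 
    then have "adj2 H ** X ** adj2 H = adj2 X + scalar2 (polar_det (adj2 H) (adj2 X)) ** adj2 H"
      by (simp add: that(1,2) adj2_herm2)
    also have "\<dots> = adj2 (X + scalar2 (polar_det H X) ** H)"
      unfolding polar_det_adj2
      by (cases X rule: mat2_cases; cases H rule: mat2_cases)
        (simp add: adj2_mat2 scalar2_def mat2_mult mat2_add)
    also have "\<dots> = adj2 (H ** adj2 X ** H)"
      using herm2_reflection[OF that(3), of p' q' r'] by (simp add: that(1,2))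
    finally show ?thesis .
  qed
  obtain p q r where h: "root_matrix i = herm2 p q r" "p * r - qnorm q = -1"
    using root_matrix_herm2[OF assms] by blast
  have self: "conj_transpose (root_factor e i) = root_factor e i"
    by (simp add: root_factor_def h(1) adj2_herm2 conj_transpose_herm2)
  show ?thesis
    unfolding self using root_matrix_reflection[OF assms, of v] adj_triple[OF h(1) lattice_matrix_def h(2)]
    by (simp add: root_factor_def lattice_factor_def del: root_action.simps)
qed

lemma spin_action:
  assumes "w \<in> lists F4pp_nodes"
  shows "spin e w ** lattice_factor (e = even (length w)) v ** conj_transpose (spin e w) =
    lattice_factor e (root_action F4pp_cartan F4pp_nodes w v)"
  using assms
proof (induction w arbitrary: e)
  case Nil
  have "conj_transpose (mat 1) = mat 1" by (simp add: mat2_one conj_transpose_mat2)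
  then show ?case by simp
next
  case (Cons i w)
  have "((\<not> e) = even (length w)) = (e = even (length (i # w)))" by auto
  then have "spin e (i # w) ** lattice_factor (e = even (length (i # w))) v ** conj_transpose (spin e (i # w)) =
    root_factor e i ** (spin (\<not> e) w ** lattice_factor ((\<not> e) = even (length w)) v ** conj_transpose (spin (\<not> e) w))
      ** conj_transpose (root_factor e i)"
    by (simp add: conj_transpose_mult matrix_mul_assoc)
  also have "\<dots> = lattice_factor e (root_action F4pp_cartan F4pp_nodes [i] (root_action F4pp_cartan F4pp_nodes w v))"
    using Cons by (simp add: root_factor_reflection del: root_action.simps)
  finally show ?case by (simp add: root_action_append[of _ _ "[i]" w, simplified])
qed

interpretation F4pp: doubly_laced_cartan F4pp_cartan F4pp_nodes
  by unfold_locales (auto simp: F4pp_nodes_eq F4pp_cartan_def split: if_splits)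

lemma root_action_outside: "w \<in> lists I \<Longrightarrow> k \<notin> I \<Longrightarrow> root_action A I w v k = v k"
  by (induction w) (auto simp: Let_def)

text \<open>The signs cancel in \<open>S X S\<dagger>\<close>, so such a word fixes every simple root.\<close>

theorem spin_faithful:
  assumes w: "w \<in> lists F4pp_nodes" "even (length w)" and s: "spin True w \<in> {mat 1, - mat 1}"
  shows "F4pp.eqv w []"
proof (rule F4pp.root_action_faithful[OF w(1)])
  fix i assume i: "i \<in> F4pp_nodes"
  define v where "v = root_action F4pp_cartan F4pp_nodes w (simple_root i)"
  have "spin True w ** lattice_matrix (simple_root i) ** conj_transpose (spin True w) = lattice_matrix v"
    using spin_action[OF w(1), of True "simple_root i"] w(2) by (simp add: lattice_factor_def v_def)
  moreover have "conj_transpose (mat 1) = mat 1" by (simp add: mat2_one conj_transpose_mat2)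
  ultimately have "lattice_matrix v = lattice_matrix (simple_root i)"
    using s by (auto simp: conj_transpose_uminus matrix_uminus_mult)
  then have "v k = simple_root i k" for k
    using lattice_matrix_inj root_action_outside[OF w(1), of k] by (cases "k \<in> F4pp_nodes") (auto simp: v_def)
  then show "root_action F4pp_cartan F4pp_nodes w (simple_root i) = simple_root i"
    by (auto simp: v_def)
qed


section \<open>Hurwitz integers\<close>

lemma Hurwitz_uminus: "x \<in> Hurwitz \<Longrightarrow> - x \<in> Hurwitz"
  using Hurwitz_mult[OF Hurwitz_m1, of x] by simp

lemma Hurwitz_diff: "x \<in> Hurwitz \<Longrightarrow> y \<in> Hurwitz \<Longrightarrow> x - y \<in> Hurwitz"
  using Hurwitz_add[OF _ Hurwitz_uminus, of x y] by simp

lemma Hurwitz_uminus_iff [simp]: "- x \<in> Hurwitz \<longleftrightarrow> x \<in> Hurwitz"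
  using Hurwitz_uminus[of x] Hurwitz_uminus[of "- x"] by auto

lemma Hurwitz_intI: "{a, b, c, d} \<subseteq> \<int> \<Longrightarrow> Quat a b c d \<in> Hurwitz"
  unfolding Hurwitz_def by blast

lemma Hurwitz_halfI:
  assumes "{a, b, c, d} \<subseteq> {1/2, - 1/2}" shows "Quat a b c d \<in> Hurwitz"
proof -
  have "(1/2 :: real) \<in> (\<lambda>n. n + 1/2) ` \<int>" "(- 1/2 :: real) \<in> (\<lambda>n. n + 1/2) ` \<int>"
    by (rule image_eqI[of _ _ 0]; simp) (rule image_eqI[of _ _ "-1"]; simp)
  then have "{a, b, c, d} \<subseteq> (\<lambda>n. n + 1/2) ` \<int>" using assms by blast
  then show ?thesis unfolding Hurwitz_def by blast
qed

lemma Hurwitz_qcnj: assumes "x \<in> Hurwitz" shows "qcnj x \<in> Hurwitz"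
proof -
  obtain a b c d e :: int where x: "2 * qRe x = of_int (2 * a + e)" "2 * qI x = of_int (2 * b + e)"
    "2 * qJ x = of_int (2 * c + e)" "2 * qK x = of_int (2 * d + e)"
    using assms unfolding Hurwitz_iff by blast
  show ?thesis unfolding Hurwitz_iff
    using x by (intro exI[of _ a] exI[of _ "- b - e"] exI[of _ "- c - e"] exI[of _ "- d - e"] exI[of _ e]) simp
qed

lemma qnorm_Hurwitz_nat: assumes "x \<in> Hurwitz" obtains n :: nat where "qnorm x = real n"
proof -
  obtain a b c d e :: int where x: "2 * qRe x = of_int (2 * a + e)" "2 * qI x = of_int (2 * b + e)"
    "2 * qJ x = of_int (2 * c + e)" "2 * qK x = of_int (2 * d + e)"
    using assms unfolding Hurwitz_iff by blast
  have "4 * qnorm x = (2 * qRe x)\<^sup>2 + (2 * qI x)\<^sup>2 + (2 * qJ x)\<^sup>2 + (2 * qK x)\<^sup>2"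
    by (simp add: qnorm_def power2_eq_square algebra_simps)
  also have "\<dots> = 4 * of_int (a * a + b * b + c * c + d * d + e * (a + b + c + d) + e * e)"
    unfolding x by (simp add: power2_eq_square algebra_simps)
  finally have "qnorm x = of_int (a * a + b * b + c * c + d * d + e * (a + b + c + d) + e * e)" by simp
  moreover from this have "0 \<le> a * a + b * b + c * c + d * d + e * (a + b + c + d) + e * e"
    using qnorm_nonneg[of x] by (metis of_int_0_le_iff)
  ultimately show ?thesis using that by (metis of_nat_nat of_int_of_nat_eq)
qed

text \<open>Rounding each coordinate to an integer leaves a remainder of norm at most one. Equality forces all four
  remainders to be \<open>\<plusminus>1/2\<close>, and then \<open>x\<close> is itself a Hurwitz integer.\<close>

lemma Hurwitz_round: obtains q where "q \<in> Hurwitz" "qnorm (x - q) < 1"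
proof -
  define r where "r t = t - of_int (round t)" for t :: real
  have r: "\<bar>r t\<bar> \<le> 1/2" for t
    using of_int_round_abs_le[of t] by (simp add: r_def abs_minus_commute)
  define q where "q = Quat (of_int (round (qRe x))) (of_int (round (qI x))) (of_int (round (qJ x))) (of_int (round (qK x)))"
  have q: "q \<in> Hurwitz" unfolding q_def by (rule Hurwitz_intI) auto
  have n: "qnorm (x - q) = (r (qRe x))\<^sup>2 + (r (qI x))\<^sup>2 + (r (qJ x))\<^sup>2 + (r (qK x))\<^sup>2"
    by (simp add: qnorm_def q_def r_def)
  have sq: "(r t)\<^sup>2 \<le> 1/4" for t
    using power_mono[OF r[of t], of 2] by (simp add: power_divide)
  show ?thesis
  proof (cases "qnorm (x - q) < 1")
    case False
    then have "(r (qRe x))\<^sup>2 = (1/2)\<^sup>2 \<and> (r (qI x))\<^sup>2 = (1/2)\<^sup>2 \<and> (r (qJ x))\<^sup>2 = (1/2)\<^sup>2 \<and> (r (qK x))\<^sup>2 = (1/2)\<^sup>2"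
      using n sq[of "qRe x"] sq[of "qI x"] sq[of "qJ x"] sq[of "qK x"]
      by (simp add: power_divide)
    then have h: "r t = 1/2 \<or> r t = - 1/2" if "t \<in> {qRe x, qI x, qJ x, qK x}" for t
      using that by (auto simp: power2_eq_iff)
    have "t \<in> (\<lambda>n. n + 1/2) ` \<int>" if "t \<in> {qRe x, qI x, qJ x, qK x}" for t
      using h[OF that]
    proof
      assume "r t = 1/2"
      then show ?thesis by (intro image_eqI[of _ _ "of_int (round t)"]) (auto simp: r_def)
    next
      assume "r t = - 1/2"
      then show ?thesis by (intro image_eqI[of _ _ "of_int (round t - 1)"]) (auto simp: r_def)
    qed
    then have "Quat (qRe x) (qI x) (qJ x) (qK x) \<in> Hurwitz"
      unfolding Hurwitz_def by blast
    then show ?thesis using that[of x] by simp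
  qed (use q that in blast)
qed

lemma Hurwitz_division:
  assumes "a \<in> Hurwitz" "c \<in> Hurwitz" "c \<noteq> 0"
  obtains q where "q \<in> Hurwitz" "qnorm (a - q * c) < qnorm c"
proof -
  have nz: "qnorm c > 0" using assms(3) qnorm_nonneg[of c] qnorm_eq_0_iff[of c] by linarith
  define x where "x = qreal (1 / qnorm c) * (a * qcnj c)"
  obtain q where q: "q \<in> Hurwitz" "qnorm (x - q) < 1" by (rule Hurwitz_round)
  have "x * c = qreal (1 / qnorm c) * (a * (qcnj c * c))" by (simp add: x_def mult.assoc)
  also have "\<dots> = qreal (1 / qnorm c * qnorm c) * a"
    by (simp only: mult_qcnj qreal_commute[of a] mult.assoc[symmetric] qreal_simps)
  also have "\<dots> = a" using nz by simp
  finally have "a - q * c = (x - q) * c" by (simp add: algebra_simps)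
  then have "qnorm (a - q * c) < qnorm c" using q(2) nz by (simp add: qnorm_mult)
  then show ?thesis using q(1) that by blast
qed

text \<open>Together with \<open>i\<close> this generates the unit group. It has order six and permutes \<open>i, j, k\<close>
  cyclically by conjugation.\<close>

definition omega :: quat where "omega = Quat (1/2) (1/2) (1/2) (1/2)"

lemma omega_Hurwitz: "omega \<in> Hurwitz" "qnorm omega = 1"
  unfolding omega_def by (auto intro!: Hurwitz_halfI simp: qnorm_def power_divide)

definition quaternion_group :: "quat set" where
  "quaternion_group = {Quat 1 0 0 0, Quat (-1) 0 0 0, Quat 0 1 0 0, Quat 0 (-1) 0 0,
         Quat 0 0 1 0, Quat 0 0 (-1) 0, Quat 0 0 0 1, Quat 0 0 0 (-1)}"

lemma sum_four_squares_small:
  fixes a b c d :: int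
  assumes "a * a + b * b + c * c + d * d = 1"
  shows "(\<bar>a\<bar> = 1 \<and> b = 0 \<and> c = 0 \<and> d = 0) \<or> (a = 0 \<and> \<bar>b\<bar> = 1 \<and> c = 0 \<and> d = 0) \<or>
    (a = 0 \<and> b = 0 \<and> \<bar>c\<bar> = 1 \<and> d = 0) \<or> (a = 0 \<and> b = 0 \<and> c = 0 \<and> \<bar>d\<bar> = 1)"
proof -
  have small: "t \<in> {-1, 0, 1}" if "t * t \<le> 1" for t :: int
  proof -
    have "t\<^sup>2 \<le> 1" using that by (simp add: power2_eq_square)
    then have "\<bar>t\<bar> \<le> 1" by (simp add: abs_square_le_1)
    then show ?thesis by auto
  qed
  have "0 \<le> a * a" "0 \<le> b * b" "0 \<le> c * c" "0 \<le> d * d" by simp_all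
  then have "a \<in> {-1, 0, 1}" "b \<in> {-1, 0, 1}" "c \<in> {-1, 0, 1}" "d \<in> {-1, 0, 1}"
    using assms by (intro small; linarith)+
  then show ?thesis using assms unfolding insert_iff empty_iff by (elim disjE; simp)
qed

lemma odd_square_ge: "odd (t :: int) \<Longrightarrow> 1 \<le> t * t \<and> (t * t = 1 \<longrightarrow> t = 1 \<or> t = -1)"
  by (cases "t = 0") (auto simp: int_one_le_iff_zero_less zero_less_mult_iff zmult_eq_1_iff)

text \<open>The unit group is the binary tetrahedral group, in which the quaternion group has index three with coset
  representatives \<open>1, \<omega>, \<omega>\<^sup>2\<close>.\<close>

lemma Hurwitz_unit_cases:
  assumes "u \<in> Hurwitz" "qnorm u = 1"
  shows "u \<in> quaternion_group \<or> (\<exists>y\<in>quaternion_group. u = omega * y \<or> u = omega * (omega * y))"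
proof -
  obtain a b c d e :: int where u: "2 * qRe u = of_int (2 * a + e)" "2 * qI u = of_int (2 * b + e)"
    "2 * qJ u = of_int (2 * c + e)" "2 * qK u = of_int (2 * d + e)"
    using assms(1) unfolding Hurwitz_iff by blast
  define A B C D where "A = 2 * a + e" and "B = 2 * b + e" and "C = 2 * c + e" and "D = 2 * d + e"
  have uq: "u = Quat (A / 2) (B / 2) (C / 2) (D / 2)"
    using u by (simp add: quat_eq_iff A_def B_def C_def D_def)
  then have "real_of_int (A * A + B * B + C * C + D * D) = of_int 4"
    using assms(2) by (simp add: qnorm_def power2_eq_square)
  then have s: "A * A + B * B + C * C + D * D = 4" by linarith
  show ?thesis
  proof (cases "even e")
    case True
    then obtain f where f: "e = 2 * f" by blast
    define a' b' c' d' where "a' = a + f" and "b' = b + f" and "c' = c + f" and "d' = d + f"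
    have "A = 2 * a'" "B = 2 * b'" "C = 2 * c'" "D = 2 * d'"
      by (simp_all add: A_def B_def C_def D_def f a'_def b'_def c'_def d'_def)
    moreover from this have "a' * a' + b' * b' + c' * c' + d' * d' = 1" using s by simp
    ultimately have "u \<in> quaternion_group"
      using sum_four_squares_small[of a' b' c' d'] unfolding uq quaternion_group_def
      by (simp add: abs_if split: if_splits)
    then show ?thesis ..
  next
    case False
    then have o: "odd A" "odd B" "odd C" "odd D" by (auto simp: A_def B_def C_def D_def)
    then have "A \<in> {1, -1}" "B \<in> {1, -1}" "C \<in> {1, -1}" "D \<in> {1, -1}"
      using odd_square_ge[of A] odd_square_ge[of B] odd_square_ge[of C] odd_square_ge[of D] s by auto
    then have "\<exists>y\<in>quaternion_group. u = omega * y \<or> u = omega * (omega * y)"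
      unfolding uq insert_iff empty_iff quaternion_group_def bex_simps(5) bex_simps(7)
      by (elim disjE; simp add: omega_def Quat_arith)
    then show ?thesis ..
  qed
qed


section \<open>Generation of the special linear group\<close>

text \<open>Closed under signs by definition, so that it is the preimage of the image in \<open>PSL\<^sub>2\<close>.\<close>

definition spin_image :: "(quat^2^2) set" where
  "spin_image = {S. \<exists>w\<in>lists F4pp_nodes. even (length w) \<and> spin True w \<in> {S, - S}}"

lemma spin_imageI: "w \<in> lists F4pp_nodes \<Longrightarrow> even (length w) \<Longrightarrow> spin True w \<in> {S, - S} \<Longrightarrow> S \<in> spin_image"
  unfolding spin_image_def by blast

lemma spin_image_mult: "S \<in> spin_image \<Longrightarrow> T \<in> spin_image \<Longrightarrow> S ** T \<in> spin_image"
  unfolding spin_image_def mem_Collect_eq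
proof (elim bexE conjE)
  fix u v assume "u \<in> lists F4pp_nodes" "even (length u)" "spin True u \<in> {S, - S}"
    "v \<in> lists F4pp_nodes" "even (length v)" "spin True v \<in> {T, - T}"
  then show "\<exists>w\<in>lists F4pp_nodes. even (length w) \<and> spin True w \<in> {S ** T, - (S ** T)}"
    by (intro bexI[of _ "u @ v"]) (auto simp: spin_append matrix_uminus_mult)
qed

lemma spin_image_uminus: "S \<in> spin_image \<Longrightarrow> - S \<in> spin_image"
  unfolding spin_image_def by auto

lemma spin_image_one: "mat 1 \<in> spin_image"
  by (rule spin_imageI[of "[]"]) auto

lemmas spin_compute = root_factor_def root_matrix_def herm2_def root_unit_def adj2_mat2 mat2_mult
  mat2_one[unfolded one_quat_def zero_quat_def] mat2_uminus zero_quat_def one_quat_def qreal_def Quat_arith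

text \<open>Products of two factors from the nodes 1 to 4 are diagonal, with entries \<open>-u v\<^sup>*\<close> and \<open>-u\<^sup>* v\<close>.
  The words in this lemma and the next are shortest ones, up to sign, for the given diagonal matrices in the Weyl group of
  \<open>F\<^sub>4\<close>, found by enumerating that group.\<close>

lemma diag_omega_in: "mat2 omega 0 0 1 \<in> spin_image"
  by (rule spin_imageI[of "[1, 2, 3, 2, 3, 4, 3, 2]"])
    (auto simp: F4pp_nodes_eq spin_compute omega_def)

lemma diag_i_in: "mat2 (Quat 0 1 0 0) 0 0 1 \<in> spin_image"
  by (rule spin_imageI[of "[1, 3, 2, 1, 3, 4, 3, 2, 1, 3, 2, 4]"])
    (auto simp: F4pp_nodes_eq spin_compute)


definition unit_diag :: "quat \<Rightarrow> quat \<Rightarrow> quat^2^2" where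
  "unit_diag u v = mat2 u 0 0 v"

definition translation :: "quat \<Rightarrow> quat^2^2" where
  "translation q = mat2 1 q 0 1"

lemma unit_diag_mult: "unit_diag u v ** unit_diag u' v' = unit_diag (u * u') (v * v')"
  by (simp add: unit_diag_def mat2_mult)

lemma translation_mult: "translation q ** translation q' = translation (q + q')"
  by (simp add: translation_def mat2_mult add.commute)

lemma unit_diag_first:
  assumes "u \<in> Hurwitz" "qnorm u = 1"
  shows "unit_diag u 1 \<in> spin_image"
proof -
  define U where "U = {u. unit_diag u 1 \<in> spin_image}"
  have mult: "x * y \<in> U" if "x \<in> U" "y \<in> U" for x y
    using spin_image_mult[of "unit_diag x 1" "unit_diag y 1"] that by (simp add: U_def unit_diag_mult)
  have om: "omega \<in> U" and i: "Quat 0 1 0 0 \<in> U"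
    using diag_omega_in diag_i_in by (simp_all add: U_def unit_diag_def)
  have m1: "Quat (-1) 0 0 0 \<in> U" using mult[OF i i] by (simp add: Quat_arith)
  \<comment> \<open>Conjugation by \<open>omega\<close> permutes \<open>i, j, k\<close> cyclically, and \<open>omega\<^sup>3 = -1\<close>.\<close>
  have j: "Quat 0 0 1 0 \<in> U"
    using mult[OF m1 mult[OF om mult[OF i mult[OF om om]]]] by (simp add: omega_def Quat_arith)
  have k: "Quat 0 0 0 1 \<in> U" using mult[OF i j] by (simp add: Quat_arith)
  have "quaternion_group \<subseteq> U"
    using mult[OF m1 m1] m1 i j k mult[OF m1 i] mult[OF m1 j] mult[OF m1 k]
    by (simp add: quaternion_group_def Quat_arith)
  then have "u \<in> U" using Hurwitz_unit_cases[OF assms] om mult by auto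
  then show ?thesis by (simp add: U_def)
qed

lemma root_unit_Hurwitz: "root_unit 1 \<in> Hurwitz" "qnorm (root_unit 1) = 1"
  unfolding root_unit_def by (auto intro!: Hurwitz_halfI simp: qnorm_def power_divide)

lemma qreal_m1: "qreal (- 1) = - 1"
  by (simp add: quat_eq_iff)

lemma spin_m1_1: "spin True [-1, 1] = mat2 0 (- root_unit 1) (qcnj (root_unit 1)) 0"
  by (simp add: root_factor_def root_matrix_def herm2_def adj2_mat2 mat2_mult qreal_m1)

text \<open>Conjugation by the anti-diagonal matrix of the word \<open>-1, 1\<close> exchanges the two diagonal entries, up to an
  inner automorphism.\<close>

lemma unit_diag_second:
  assumes "v \<in> Hurwitz" "qnorm v = 1"
  shows "unit_diag 1 v \<in> spin_image"
proof -
  define a where "a = root_unit 1"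
  have a: "a \<in> Hurwitz" "qnorm a = 1" using root_unit_Hurwitz by (simp_all add: a_def)
  have aa: "a * qcnj a = 1" "qcnj a * a = 1" by (simp_all add: mult_qcnj a)
  define R where "R = spin True [-1, 1]"
  have R: "R = mat2 0 (- a) (qcnj a) 0"
    unfolding R_def a_def by (rule spin_m1_1)
  have Rin: "R \<in> spin_image" by (rule spin_imageI[of "[-1, 1]"]) (auto simp: R_def F4pp_nodes_eq)
  have "a * v * qcnj a \<in> Hurwitz" "qnorm (a * v * qcnj a) = 1"
    using assms a by (simp_all add: Hurwitz_mult Hurwitz_qcnj qnorm_mult)
  then have "unit_diag (a * v * qcnj a) 1 \<in> spin_image" by (rule unit_diag_first)
  then have "R ** unit_diag (a * v * qcnj a) 1 ** R \<in> spin_image"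
    using Rin spin_image_mult by blast
  moreover have "R ** unit_diag (a * v * qcnj a) 1 ** R = - unit_diag 1 v"
  proof -
    have "qcnj a * (a * v * qcnj a) * a = (qcnj a * a) * v * (qcnj a * a)" by (simp add: mult.assoc)
    then show ?thesis by (simp add: R unit_diag_def mat2_mult mat2_uminus aa)
  qed
  ultimately show ?thesis using spin_image_uminus by fastforce
qed

lemma unit_diag_in:
  assumes "u \<in> Hurwitz" "qnorm u = 1" "v \<in> Hurwitz" "qnorm v = 1"
  shows "unit_diag u v \<in> spin_image"
  using spin_image_mult[OF unit_diag_first[OF assms(1,2)] unit_diag_second[OF assms(3,4)]]
  by (simp add: unit_diag_mult)

definition rotation :: "quat^2^2" where
  "rotation = mat2 0 1 (-1) 0"

text \<open>A diagonal matrix of units turns the anti-diagonal matrix of the word \<open>-1, 1\<close> into this one.\<close>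

lemma rotation_in: "rotation \<in> spin_image"
proof -
  define a where "a = root_unit 1"
  have "unit_diag (- qcnj a) (- a) \<in> spin_image"
    using root_unit_Hurwitz by (intro unit_diag_in) (simp_all add: a_def Hurwitz_qcnj)
  moreover have "spin True [-1, 1] \<in> spin_image"
    by (rule spin_imageI[of "[-1, 1]"]) (auto simp: F4pp_nodes_eq)
  ultimately have "unit_diag (- qcnj a) (- a) ** spin True [-1, 1] \<in> spin_image"
    by (rule spin_image_mult)
  then show ?thesis
    using root_unit_Hurwitz unfolding spin_m1_1 by (simp add: unit_diag_def mat2_mult mult_qcnj rotation_def a_def)
qed

text \<open>The word \<open>-1, 0\<close> is a rotation times the translation by \<open>-1\<close>. Conjugation by diagonal matrices of units
  gives the translations by all units, and these span the Hurwitz integers.\<close>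

lemma translation_in: assumes "q \<in> Hurwitz" shows "translation q \<in> spin_image"
proof -
  define T where "T = {q. translation q \<in> spin_image}"
  have add: "x + y \<in> T" if "x \<in> T" "y \<in> T" for x y
    using spin_image_mult[of "translation x" "translation y"] that by (simp add: T_def translation_mult)
  have zero: "0 \<in> T" using spin_image_one by (simp add: T_def translation_def mat2_one)
  have m1: "- 1 \<in> T"
  proof -
    have "spin True [-1, 0] \<in> spin_image" by (rule spin_imageI[of "[-1, 0]"]) (auto simp: F4pp_nodes_eq)
    then have "- rotation ** spin True [-1, 0] \<in> spin_image"
      using rotation_in spin_image_uminus spin_image_mult by blast
    moreover have "- rotation ** spin True [-1, 0] = translation (- 1)"
      by (simp add: rotation_def translation_def root_factor_def root_matrix_def herm2_def adj2_mat2
          mat2_mult mat2_uminus quat_eq_iff)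
    ultimately show ?thesis by (simp add: T_def)
  qed
  have unit: "u \<in> T" if u: "u \<in> Hurwitz" "qnorm u = 1" for u
  proof -
    have "unit_diag (- u) 1 ** translation (- 1) ** unit_diag (- qcnj u) 1 \<in> spin_image"
      using u m1 by (intro spin_image_mult unit_diag_in) (simp_all add: T_def Hurwitz_qcnj Hurwitz_1)
    then show ?thesis
      using u by (simp add: T_def unit_diag_def translation_def mat2_mult mult_qcnj)
  qed
  have multiple: "qreal (of_int n) * u \<in> T" if u: "u \<in> Hurwitz" "qnorm u = 1" for u n
  proof (induction n rule: int_induct[of _ 0])
    case base
    then show ?case using zero by simp
  next
    case (step1 n)
    then show ?case using add[OF step1(2) unit[OF u]] by (simp add: distrib_right flip: qreal_simps(3))
  next
    case (step2 n)
    have "- u \<in> T" using u by (intro unit) simp_all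
    from add[OF step2(2) this] show ?case by (simp add: left_diff_distrib flip: qreal_simps(4))
  qed
  obtain a b c d e :: int where q: "2 * qRe q = of_int (2 * a + e)" "2 * qI q = of_int (2 * b + e)"
    "2 * qJ q = of_int (2 * c + e)" "2 * qK q = of_int (2 * d + e)"
    using assms unfolding Hurwitz_iff by blast
  have ijk: "Quat 0 1 0 0 \<in> Hurwitz" "Quat 0 0 1 0 \<in> Hurwitz" "Quat 0 0 0 1 \<in> Hurwitz"
    by (auto intro: Hurwitz_intI)
  \<comment> \<open>The coefficient of \<open>omega\<close> is forced by the real part.\<close>
  have "qreal (of_int (2 * a + e)) * omega + qreal (of_int (b - a)) * Quat 0 1 0 0
      + qreal (of_int (c - a)) * Quat 0 0 1 0 + qreal (of_int (d - a)) * Quat 0 0 0 1 \<in> T"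
    using omega_Hurwitz ijk by (intro add multiple) (simp_all add: qnorm_def)
  also have "qreal (of_int (2 * a + e)) * omega + qreal (of_int (b - a)) * Quat 0 1 0 0
      + qreal (of_int (c - a)) * Quat 0 0 1 0 + qreal (of_int (d - a)) * Quat 0 0 0 1 = q"
    using q by (simp add: quat_eq_iff quat_mult_sel omega_def field_simps)
  finally show ?thesis by (simp add: T_def)
qed

text \<open>The Euclidean algorithm on the first column: a translation replaces \<open>a\<close> by its remainder modulo \<open>c\<close>, and
  the rotation swaps the rows. Once \<open>c = 0\<close>, the determinant forces \<open>a\<close> and \<open>d\<close> to be units.\<close>

theorem SL2_Hurwitz_generated:
  assumes "study_det (mat2 a b c d) = 1" "{a, b, c, d} \<subseteq> Hurwitz"
  shows "mat2 a b c d \<in> spin_image"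
proof -
  obtain n where "qnorm c = real n" using assms(2) qnorm_Hurwitz_nat[of c] by blast
  then show ?thesis using assms
  proof (induction n arbitrary: a b c d rule: less_induct)
    case (less n)
    show ?case
    proof (cases "c = 0")
      case True
      obtain m where m: "qnorm a = real m" using less(4) qnorm_Hurwitz_nat[of a] by blast
      obtain k where k: "qnorm d = real k" using less(4) qnorm_Hurwitz_nat[of d] by blast
      have "qnorm a * qnorm d = 1" using less(3) True by (simp add: study_det_mat2)
      then have "real (m * k) = real 1" unfolding m k by simp
      then have "m * k = 1" by (simp only: of_nat_eq_iff)
      then have u: "qnorm a = 1" "qnorm d = 1" by (simp_all add: m k)
      have "unit_diag a d ** translation (qcnj a * b) \<in> spin_image"
        using less(4) u
        by (intro spin_image_mult unit_diag_in translation_in) (auto simp: Hurwitz_mult Hurwitz_qcnj)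
      then show ?thesis
        using True u by (simp add: unit_diag_def translation_def mat2_mult mult_qcnj flip: mult.assoc)
    next
      case False
      obtain q where q: "q \<in> Hurwitz" "qnorm (a - q * c) < qnorm c"
        using Hurwitz_division[of a c] less(4) False by auto
      define a' b' where "a' = a - q * c" and "b' = b - q * d"
      have e: "rotation ** translation (- q) ** mat2 a b c d = mat2 c d (- a') (- b')"
        by (simp add: rotation_def translation_def mat2_mult a'_def b'_def)
      have "study_det (mat2 c d (- a') (- b')) = 1"
        unfolding e[symmetric] study_det_mult less(3)
        by (simp add: rotation_def translation_def study_det_mat2)
      moreover have "{c, d, - a', - b'} \<subseteq> Hurwitz"
        using less(4) q by (auto simp: a'_def b'_def Hurwitz_diff Hurwitz_mult)
      moreover obtain k where k: "qnorm (- a') = real k"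
        using qnorm_Hurwitz_nat[of "- a'"] calculation(2) by blast
      moreover have "k < n" using q(2) k less(2) unfolding qnorm_simps a'_def by simp
      ultimately have "mat2 c d (- a') (- b') \<in> spin_image" using less(1) by blast
      then have "translation q ** - rotation ** mat2 c d (- a') (- b') \<in> spin_image"
        using q(1) by (intro spin_image_mult translation_in spin_image_uminus rotation_in)
      moreover have "translation q ** - rotation ** mat2 c d (- a') (- b') = mat2 a b c d"
        by (simp add: rotation_def translation_def mat2_mult mat2_uminus a'_def b'_def)
      ultimately show ?thesis by simp
    qed
  qed
qed


section \<open>Matrices with entries in the Hurwitz integers or in a twisted copy\<close>

text \<open>Conjugation by this unit quaternion maps the Hurwitz order to itself without being an inner automorphism of it.
  Up to sign it is the off-diagonal entry of the short root 3.\<close>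

definition theta :: quat where
  "theta = Quat 0 (sqrt 2 / 2) (- sqrt 2 / 2) 0"

lemma theta_theta: "theta * theta = - 1" "theta * (theta * x) = - x"
proof -
  show "theta * theta = - 1" by (simp add: theta_def one_quat_def Quat_arith)
  then show "theta * (theta * x) = - x" by (simp flip: mult.assoc)
qed

lemma theta_conjugation: "theta * x * theta = Quat (- qRe x) (qJ x) (qI x) (qK x)"
  by (cases x) (simp add: theta_def Quat_arith sqrt2_mult_sqrt2 field_simps)

lemma theta_conjugation_Hurwitz: assumes "x \<in> Hurwitz" shows "theta * x * theta \<in> Hurwitz"
proof -
  obtain a b c d e :: int where x: "2 * qRe x = of_int (2 * a + e)" "2 * qI x = of_int (2 * b + e)"
    "2 * qJ x = of_int (2 * c + e)" "2 * qK x = of_int (2 * d + e)"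
    using assms unfolding Hurwitz_iff by blast
  show ?thesis unfolding Hurwitz_iff theta_conjugation
    using x by (intro exI[of _ "- a - e"] exI[of _ c] exI[of _ b] exI[of _ d] exI[of _ e]) simp
qed

text \<open>For \<open>b = True\<close> this is \<open>theta\<close> times the Hurwitz order, because \<open>theta\<^sup>2 = -1\<close>.\<close>

definition twisted_Hurwitz :: "bool \<Rightarrow> quat set" where
  "twisted_Hurwitz b = {x. (if b then theta * x else x) \<in> Hurwitz}"

lemma twisted_Hurwitz_add: "x \<in> twisted_Hurwitz b \<Longrightarrow> y \<in> twisted_Hurwitz b \<Longrightarrow> x + y \<in> twisted_Hurwitz b"
  by (simp add: twisted_Hurwitz_def distrib_left Hurwitz_add split: if_splits)

lemma twisted_Hurwitz_uminus [simp]: "- x \<in> twisted_Hurwitz b \<longleftrightarrow> x \<in> twisted_Hurwitz b"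
  by (simp add: twisted_Hurwitz_def)

text \<open>Moving \<open>theta\<close> past a Hurwitz integer is an automorphism of the Hurwitz order, and two factors
  \<open>theta\<close> cancel up to sign.\<close>

lemma twisted_Hurwitz_mult:
  assumes "x \<in> twisted_Hurwitz b" "y \<in> twisted_Hurwitz b'"
  shows "x * y \<in> twisted_Hurwitz (b \<noteq> b')"
proof -
  have left: "theta * (x * y) = - (theta * x * theta * (theta * y))"
    by (simp add: theta_theta mult.assoc)
  have both: "x * y = theta * (theta * x) * theta * (theta * y)"
    by (simp add: theta_theta mult.assoc)
  consider "b" "b'" | "b" "\<not> b'" | "\<not> b" "b'" | "\<not> b" "\<not> b'" by blast
  then show ?thesis
  proof cases
    case 1
    then have "theta * (theta * x) * theta * (theta * y) \<in> Hurwitz"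
      using assms Hurwitz_mult[OF theta_conjugation_Hurwitz, of "theta * x" "theta * y"]
      by (simp add: twisted_Hurwitz_def)
    then have "x * y \<in> Hurwitz" by (simp only: both[symmetric])
    then show ?thesis using 1 by (simp add: twisted_Hurwitz_def)
  next
    case 2
    then show ?thesis
      using assms Hurwitz_mult[of "theta * x" y] by (simp add: twisted_Hurwitz_def mult.assoc)
  next
    case 3
    then have "theta * x * theta * (theta * y) \<in> Hurwitz"
      using assms Hurwitz_mult[OF theta_conjugation_Hurwitz, of x "theta * y"]
      by (simp add: twisted_Hurwitz_def)
    then have "theta * (x * y) \<in> Hurwitz" unfolding left by (rule Hurwitz_uminus)
    then show ?thesis using 3 by (simp add: twisted_Hurwitz_def)
  next
    case 4
    then show ?thesis using assms Hurwitz_mult by (simp add: twisted_Hurwitz_def)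
  qed
qed

lemma twisted_Hurwitz_qcnj:
  assumes "x \<in> twisted_Hurwitz b" shows "qcnj x \<in> twisted_Hurwitz b"
proof -
  have "qcnj theta = - theta" by (simp add: theta_def Quat_arith)
  then have "theta * qcnj x = qcnj (theta * (theta * x) * theta)"
    by (simp add: theta_theta qcnj_mult)
  then show ?thesis
    using assms Hurwitz_qcnj theta_conjugation_Hurwitz
    by (auto simp: twisted_Hurwitz_def split: if_splits)
qed

definition entries_in :: "bool \<Rightarrow> quat^2^2 \<Rightarrow> bool" where
  "entries_in b S \<longleftrightarrow> (\<forall>i j. S $ i $ j \<in> twisted_Hurwitz b)"

lemma entries_in_mat2:
  "entries_in b (mat2 p q r s) \<longleftrightarrow> {p, q, r, s} \<subseteq> twisted_Hurwitz b"
  by (auto simp: entries_in_def forall_2)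

lemma entries_in_mult:
  assumes "entries_in b S" "entries_in b' T" shows "entries_in (b \<noteq> b') (S ** T)"
proof -
  obtain p q r s where S: "S = mat2 p q r s" by (rule mat2_cases)
  obtain p' q' r' s' where T: "T = mat2 p' q' r' s'" by (rule mat2_cases)
  have "x * y + x' * y' \<in> twisted_Hurwitz (b \<noteq> b')"
    if "x \<in> {p, q, r, s}" "y \<in> {p', q', r', s'}" "x' \<in> {p, q, r, s}" "y' \<in> {p', q', r', s'}" for x x' y y'
    using that assms unfolding S T entries_in_mat2
    by (intro twisted_Hurwitz_add twisted_Hurwitz_mult) blast+
  then show ?thesis unfolding S T mat2_mult entries_in_mat2 by blast
qed

lemma entries_in_uminus [simp]: "entries_in b (- S) \<longleftrightarrow> entries_in b S"
  by (simp add: entries_in_def)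

lemma zero_one_twisted: "0 \<in> twisted_Hurwitz b" "1 \<in> twisted_Hurwitz False"
  by (simp_all add: twisted_Hurwitz_def Hurwitz_0 Hurwitz_1)

lemma entries_in_adj2: "entries_in b S \<Longrightarrow> entries_in b (adj2 S)"
  by (cases S rule: mat2_cases) (auto simp: adj2_mat2 entries_in_mat2)

lemma entries_in_inv2: assumes "entries_in b S" shows "entries_in b (inv2 S)"
proof -
  have t: "entries_in b (conj_transpose S)"
    using assms by (cases S rule: mat2_cases)
      (auto simp: conj_transpose_mat2 entries_in_mat2 twisted_Hurwitz_qcnj)
  have "(b \<noteq> (b \<noteq> b)) = b" by simp
  then show ?thesis
    using entries_in_mult[OF t entries_in_adj2[OF entries_in_mult[OF assms t]]] unfolding inv2_def by simp
qed

definition extended_SL2 :: "(quat^2^2) set" where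
  "extended_SL2 = {S. study_det S = 1 \<and> (\<exists>b. entries_in b S)}"

lemma spin_entries:
  assumes "w \<in> lists F4pp_nodes"
  shows "study_det (spin e w) = 1 \<and> (\<exists>b. entries_in b (spin e w))"
  using assms
proof (induction w arbitrary: e)
  case Nil
  have "entries_in False (mat 1)" by (simp add: mat2_one entries_in_mat2 zero_one_twisted)
  then show ?case by auto
next
  case (Cons i w)
  have u1: "1 \<in> Hurwitz" "root_unit 1 \<in> Hurwitz" "root_unit 2 \<in> Hurwitz" "theta * root_unit 3 \<in> Hurwitz"
    "theta * root_unit 4 \<in> Hurwitz"
  proof -
    show "root_unit 2 \<in> Hurwitz" by (auto simp: root_unit_def intro!: Hurwitz_intI)
    show "theta * root_unit 3 \<in> Hurwitz"
      by (auto simp: root_unit_def theta_def Quat_arith intro!: Hurwitz_intI)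
    show "theta * root_unit 4 \<in> Hurwitz"
      by (auto simp: root_unit_def theta_def Quat_arith intro!: Hurwitz_halfI)
  qed (simp_all add: Hurwitz_1 root_unit_Hurwitz)
  have "\<exists>b. entries_in b (root_matrix i)"
  proof (cases "i = 3 \<or> i = 4")
    case True
    then have "root_unit i \<in> twisted_Hurwitz True" using u1 by (auto simp: twisted_Hurwitz_def)
    then have "entries_in True (root_matrix i)"
      using True by (auto simp: root_matrix_def herm2_def entries_in_mat2 zero_one_twisted twisted_Hurwitz_qcnj)
    then show ?thesis ..
  next
    case False
    have r: "root_unit i \<in> twisted_Hurwitz False" if "i = 1 \<or> i = 2"
      using u1 that by (auto simp: twisted_Hurwitz_def)
    have "i \<in> F4pp_nodes" using Cons by simp
    then have "i = -1 \<or> i = 0 \<or> i = 1 \<or> i = 2"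
      using False unfolding F4pp_nodes_eq by blast
    then have "entries_in False (root_matrix i)"
      using r by (elim disjE) (simp_all add: root_matrix_def herm2_def entries_in_mat2 zero_one_twisted twisted_Hurwitz_qcnj qreal_m1)
    then show ?thesis ..
  qed
  then have "\<exists>b. entries_in b (root_factor e i)"
    using entries_in_adj2 by (auto simp: root_factor_def)
  moreover have "study_det (root_factor e i) = 1"
  proof -
    obtain p q r where h: "root_factor e i = herm2 p q r" "p * r - qnorm q = -1"
      using root_factor_herm2[of i e] Cons.hyps(1) by blast
    have "study_det (herm2 p q r) = (p * r - qnorm q)\<^sup>2"
    proof -
      have "qRe (q * (qreal r * qcnj q)) = r * qnorm q"
        by (simp add: mult_qcnj qreal_left_commute)
      then show ?thesis
        by (simp add: herm2_def study_det_mat2 power2_eq_square mult.assoc) (simp add: algebra_simps)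
    qed
    then show ?thesis by (simp add: h)
  qed
  moreover have "study_det (spin (\<not> e) w) = 1 \<and> (\<exists>b. entries_in b (spin (\<not> e) w))"
    using Cons by simp
  ultimately show ?case
    using entries_in_mult by (fastforce simp: study_det_mult)
qed

lemma spin_theta: "spin True [-1, 3] = mat2 0 theta theta 0"
  by (simp add: root_factor_def root_matrix_def root_unit_def theta_def herm2_def adj2_mat2 mat2_mult
      qreal_m1 Quat_arith)

text \<open>The word \<open>-1, 3\<close>, with one short letter, reduces a twisted matrix to one with Hurwitz entries.\<close>

theorem spin_image_eq: "spin_image = extended_SL2"
proof
  show "spin_image \<subseteq> extended_SL2"
  proof
    fix S assume "S \<in> spin_image"
    then obtain w where w: "w \<in> lists F4pp_nodes" "spin True w \<in> {S, - S}"
      unfolding spin_image_def by blast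
    then show "S \<in> extended_SL2"
      using spin_entries[OF w(1), of True] by (auto simp: extended_SL2_def)
  qed
  have untwisted: "S \<in> spin_image" if "study_det S = 1" "entries_in False S" for S
    using that by (cases S rule: mat2_cases)
      (auto simp: entries_in_mat2 twisted_Hurwitz_def intro: SL2_Hurwitz_generated)
  show "extended_SL2 \<subseteq> spin_image"
  proof
    fix S assume "S \<in> extended_SL2"
    then obtain b where S: "study_det S = 1" "entries_in b S" by (auto simp: extended_SL2_def)
    show "S \<in> spin_image"
    proof (cases b)
      case True
      define R where "R = spin True [-1, 3]"
      have R: "R = mat2 0 theta theta 0" unfolding R_def by (rule spin_theta)
      have Rin: "R \<in> spin_image"
        by (rule spin_imageI[of "[-1, 3]"]) (auto simp: R_def F4pp_nodes_eq)
      have "theta \<in> twisted_Hurwitz True" by (simp add: twisted_Hurwitz_def theta_theta Hurwitz_1)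
      then have "entries_in True R" by (simp add: R entries_in_mat2 zero_one_twisted)
      then have "entries_in False (R ** S)" using entries_in_mult[of True R True S] S True by simp
      moreover have "study_det R = 1"
        unfolding R_def using spin_entries[of "[-1, 3]" True] by (auto simp: F4pp_nodes_eq)
      ultimately have "R ** S \<in> spin_image" using untwisted S by (simp add: study_det_mult)
      then have "R ** (R ** S) \<in> spin_image" using Rin spin_image_mult by blast
      moreover have "R ** R = - mat 1"
        by (simp add: R mat2_mult theta_theta mat2_one mat2_uminus)
      ultimately have "- S \<in> spin_image" by (simp add: matrix_mul_assoc matrix_uminus_mult)
      then show ?thesis using spin_image_uminus by fastforce
    qed (use S untwisted in auto)
  qed
qed


section \<open>The commutator ideal\<close>

text \<open>The root lattice of \<open>D\<^sub>4\<close>, an explicit form of the commutator ideal.\<close>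

definition even_lattice :: "quat set" where
  "even_lattice = {x. \<exists>a b c d :: int. x = Quat a b c d \<and> even (a + b + c + d)}"

lemma even_lattice_subset: "even_lattice \<subseteq> Hurwitz"
  by (auto simp: even_lattice_def intro!: Hurwitz_intI)

lemma even_latticeI: "even (a + b + c + d) \<Longrightarrow> Quat (of_int a) (of_int b) (of_int c) (of_int d) \<in> even_lattice"
  unfolding even_lattice_def by blast

text \<open>The norm makes closure under multiplication by Hurwitz integers obvious, while the coordinates do so for
  addition. A Hurwitz integer with half-integral coordinates has odd norm.\<close>

lemma even_lattice_iff_norm:
  "x \<in> even_lattice \<longleftrightarrow> x \<in> Hurwitz \<and> (\<exists>n::int. qnorm x = of_int (2 * n))"
proof
  assume "x \<in> even_lattice"
  then obtain a b c d :: int where x: "x = Quat a b c d" "even (a + b + c + d)"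
    unfolding even_lattice_def by blast
  have "qnorm x = of_int (a * a + b * b + c * c + d * d)" by (simp add: x qnorm_def power2_eq_square)
  moreover have "even (a * a + b * b + c * c + d * d)" using x(2) by auto
  then obtain n where "a * a + b * b + c * c + d * d = 2 * n" by blast
  ultimately show "x \<in> Hurwitz \<and> (\<exists>n::int. qnorm x = of_int (2 * n))"
    using \<open>x \<in> even_lattice\<close> even_lattice_subset by auto
next
  assume "x \<in> Hurwitz \<and> (\<exists>n::int. qnorm x = of_int (2 * n))"
  then obtain n :: int where x: "x \<in> Hurwitz" "qnorm x = of_int (2 * n)" by blast
  obtain a b c d e :: int where c: "2 * qRe x = of_int (2 * a + e)" "2 * qI x = of_int (2 * b + e)"
    "2 * qJ x = of_int (2 * c + e)" "2 * qK x = of_int (2 * d + e)"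
    using x(1) unfolding Hurwitz_iff by blast
  have "4 * qnorm x = (2 * qRe x)\<^sup>2 + (2 * qI x)\<^sup>2 + (2 * qJ x)\<^sup>2 + (2 * qK x)\<^sup>2"
    by (simp add: qnorm_def power2_eq_square algebra_simps)
  also have "\<dots> = of_int (4 * (a * a + b * b + c * c + d * d + e * (a + b + c + d) + e * e))"
    unfolding c by (simp add: power2_eq_square algebra_simps)
  finally have "real_of_int (4 * (2 * n)) = of_int (4 * (a * a + b * b + c * c + d * d + e * (a + b + c + d) + e * e))"
    by (simp add: x(2))
  then have n: "2 * n = a * a + b * b + c * c + d * d + e * (a + b + c + d) + e * e"
    unfolding of_int_eq_iff by simp
  have "even e"
  proof (rule ccontr)
    assume "odd e"
    then have "odd (a * a + b * b + c * c + d * d + e * (a + b + c + d) + e * e)" by auto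
    then show False unfolding n[symmetric] by simp
  qed
  then obtain f where f: "e = 2 * f" by blast
  have "even (a * a + b * b + c * c + d * d + e * (a + b + c + d) + e * e)" unfolding n[symmetric] by simp
  then have "even (a + b + c + d)" using f by auto
  then have "even ((a + f) + (b + f) + (c + f) + (d + f))" by presburger
  moreover have "x = Quat (of_int (a + f)) (of_int (b + f)) (of_int (c + f)) (of_int (d + f))"
    using c by (simp add: quat_eq_iff f)
  ultimately show "x \<in> even_lattice" using even_latticeI by metis
qed

lemma even_lattice_add: "x \<in> even_lattice \<Longrightarrow> y \<in> even_lattice \<Longrightarrow> x + y \<in> even_lattice"
proof -
  assume "x \<in> even_lattice" "y \<in> even_lattice"
  then obtain a b c d a' b' c' d' :: int where
    "x = Quat a b c d" "even (a + b + c + d)" "y = Quat a' b' c' d'" "even (a' + b' + c' + d')"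
    unfolding even_lattice_def by blast
  moreover from this(2,4) have "even ((a + a') + (b + b') + (c + c') + (d + d'))" by presburger
  from even_latticeI[OF this] have "Quat (a + a') (b + b') (c + c') (d + d') \<in> even_lattice" by simp
  ultimately show ?thesis by (simp add: Quat_arith)
qed

lemma even_lattice_mult:
  assumes "x \<in> even_lattice" "y \<in> Hurwitz"
  shows "x * y \<in> even_lattice" "y * x \<in> even_lattice"
proof -
  obtain n :: int where n: "qnorm x = of_int (2 * n)" using assms(1) even_lattice_iff_norm by blast
  obtain m where m: "qnorm y = real m" using qnorm_Hurwitz_nat[OF assms(2)] by blast
  have "qnorm x * qnorm y = of_int (2 * (n * int m))" by (simp add: n m)
  then show "x * y \<in> even_lattice" "y * x \<in> even_lattice"
    using assms even_lattice_iff_norm Hurwitz_mult even_lattice_subset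
    by (metis qnorm_mult subsetD mult.commute)+
qed

lemma even_lattice_uminus: "x \<in> even_lattice \<Longrightarrow> - x \<in> even_lattice"
  using even_lattice_mult(1)[of x "- 1"] Hurwitz_m1 by simp

lemma even_lattice_diff: "x \<in> even_lattice \<Longrightarrow> y \<in> even_lattice \<Longrightarrow> x - y \<in> even_lattice"
  using even_lattice_add[OF _ even_lattice_uminus, of x y] by simp

lemma even_lattice_0: "0 \<in> even_lattice"
  using even_latticeI[of 0 0 0 0] by (simp add: zero_quat_def)

lemma commutator_even:
  assumes "x \<in> Hurwitz" "y \<in> Hurwitz"
  shows "x * y - y * x \<in> even_lattice"
proof -
  obtain a b c d e :: int where "2 * qRe x = of_int (2 * a + e)" "2 * qI x = of_int (2 * b + e)"
    "2 * qJ x = of_int (2 * c + e)" "2 * qK x = of_int (2 * d + e)"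
    using assms(1) unfolding Hurwitz_iff by blast
  then have x: "qRe x = of_int a + of_int e / 2" "qI x = of_int b + of_int e / 2"
    "qJ x = of_int c + of_int e / 2" "qK x = of_int d + of_int e / 2" by simp_all
  obtain a' b' c' d' f :: int where "2 * qRe y = of_int (2 * a' + f)" "2 * qI y = of_int (2 * b' + f)"
    "2 * qJ y = of_int (2 * c' + f)" "2 * qK y = of_int (2 * d' + f)"
    using assms(2) unfolding Hurwitz_iff by blast
  then have y: "qRe y = of_int a' + of_int f / 2" "qI y = of_int b' + of_int f / 2"
    "qJ y = of_int c' + of_int f / 2" "qK y = of_int d' + of_int f / 2" by simp_all
  define B C D where "B = 2 * (c * d' - d * c') + f * (c - d) + e * (d' - c')"
    and "C = 2 * (d * b' - b * d') + f * (d - b) + e * (b' - d')"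
    and "D = 2 * (b * c' - c * b') + f * (b - c) + e * (c' - b')"
  have "x * y - y * x = Quat (of_int 0) (of_int B) (of_int C) (of_int D)"
    by (simp add: quat_eq_iff quat_mult_sel x y B_def C_def D_def field_simps)
  moreover have "0 + B + C + D = 2 * ((c * d' - d * c') + (d * b' - b * d') + (b * c' - c * b'))"
    by (simp add: B_def C_def D_def algebra_simps)
  ultimately show ?thesis using even_latticeI[of 0 B C D] by simp
qed

text \<open>One inclusion is the computation of a commutator. For the other, the single commutator
  \<open>i \<omega> - \<omega> i = k - j\<close> generates the whole lattice as a right ideal.\<close>

theorem Hurwitz_commutator_ideal_eq: "Hurwitz_commutator_ideal = even_lattice"
proof
  interpret ring Hurwitz_ring by (rule ring_Hurwitz_ring)
  let ?X = "{a * b - b * a | a b. a \<in> Hurwitz \<and> b \<in> Hurwitz}"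
  have X: "?X \<subseteq> carrier Hurwitz_ring"
    by (auto simp: Hurwitz_ring_def Hurwitz_diff Hurwitz_mult)
  have "ideal even_lattice Hurwitz_ring"
  proof (rule idealI[OF ring_Hurwitz_ring])
    show "subgroup even_lattice (add_monoid Hurwitz_ring)"
    proof (rule group.subgroupI[OF a_group])
      show "even_lattice \<subseteq> carrier (add_monoid Hurwitz_ring)"
        using even_lattice_subset by (simp add: Hurwitz_ring_def)
      show "even_lattice \<noteq> {}" using even_lattice_0 by blast
    next
      fix x assume x: "x \<in> even_lattice"
      have "inv\<^bsub>add_monoid Hurwitz_ring\<^esub> x = - x"
        by (rule group.inv_equality[OF a_group])
          (use x even_lattice_subset in \<open>auto simp: Hurwitz_ring_def\<close>)
      then show "inv\<^bsub>add_monoid Hurwitz_ring\<^esub> x \<in> even_lattice"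
        using even_lattice_uminus[OF x] by simp
    next
      fix x y assume "x \<in> even_lattice" "y \<in> even_lattice"
      then show "x \<otimes>\<^bsub>add_monoid Hurwitz_ring\<^esub> y \<in> even_lattice"
        using even_lattice_add by (simp add: Hurwitz_ring_def)
    qed
  qed (auto simp: Hurwitz_ring_def even_lattice_mult)
  moreover have "?X \<subseteq> even_lattice" using commutator_even by auto
  ultimately show "Hurwitz_commutator_ideal \<subseteq> even_lattice"
    unfolding Hurwitz_commutator_ideal_def by (rule genideal_minimal)
  have idl: "ideal Hurwitz_commutator_ideal Hurwitz_ring"
    unfolding Hurwitz_commutator_ideal_def by (rule genideal_ideal[OF X])
  have "Quat 0 1 0 0 \<in> Hurwitz" by (auto intro!: Hurwitz_intI)
  with omega_Hurwitz(1) have "Quat 0 1 0 0 * omega - omega * Quat 0 1 0 0 \<in> Hurwitz_commutator_ideal"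
    unfolding Hurwitz_commutator_ideal_def using genideal_self[OF X] by blast
  then have gen: "Quat 0 0 (-1) 1 \<in> Hurwitz_commutator_ideal"
    by (simp add: omega_def Quat_arith)
  show "even_lattice \<subseteq> Hurwitz_commutator_ideal"
  proof
    fix x assume "x \<in> even_lattice"
    then obtain a b c d :: int where x: "x = Quat a b c d" "even (a + b + c + d)"
      unfolding even_lattice_def by blast
    \<comment> \<open>The quotient of \<open>x\<close> by the generator \<open>k - j\<close>.\<close>
    define y where "y = Quat (of_int (d - c) / 2) (of_int (c + d) / 2) (of_int (a - b) / 2) (of_int (- a - b) / 2)"
    obtain m where m: "a + b + c + d = 2 * m" using x(2) by blast
    have "d = 2 * m - a - b - c" using m by simp
    then have "y \<in> Hurwitz"
      unfolding Hurwitz_iff y_def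
      by (intro exI[of _ "m - b - c"] exI[of _ "m - b"] exI[of _ "a - b"] exI[of _ "- b"] exI[of _ "b - a"])
        simp
    then have "Quat 0 0 (-1) 1 \<otimes>\<^bsub>Hurwitz_ring\<^esub> y \<in> Hurwitz_commutator_ideal"
      using ideal.I_r_closed[OF idl gen] by (simp add: Hurwitz_ring_def)
    moreover have "Quat 0 0 (-1) 1 * y = x" by (simp add: y_def x Quat_arith field_simps)
    ultimately show "x \<in> Hurwitz_commutator_ideal" by (simp add: Hurwitz_ring_def)
  qed
qed

text \<open>Not a determinant over the quaternions, but it becomes one modulo the commutator ideal.\<close>

definition naive_det :: "quat^2^2 \<Rightarrow> quat" where
  "naive_det S = S $ 1 $ 1 * S $ 2 $ 2 - S $ 1 $ 2 * S $ 2 $ 1"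

lemma naive_det_mat2: "naive_det (mat2 a b c d) = a * d - b * c"
  by (simp add: naive_det_def)

lemma naive_det_uminus [simp]: "naive_det (- S) = naive_det S"
  by (simp add: naive_det_def)

lemma swap_even:
  assumes "p \<in> Hurwitz" "x \<in> Hurwitz" "y \<in> Hurwitz" "r \<in> Hurwitz"
  shows "p * (x * y - y * x) * r \<in> even_lattice"
  using assms by (intro even_lattice_mult commutator_even)

lemma reverse_even:
  assumes "p \<in> Hurwitz" "x \<in> Hurwitz" "y \<in> Hurwitz" "z \<in> Hurwitz"
  shows "p * (x * y * z - z * y * x) \<in> even_lattice"
proof -
  have "p * (x * y * z - z * y * x) = p * (x * (y * z) - (y * z) * x) + p * (y * z - z * y) * x"
    by (simp add: algebra_simps)
  moreover have "p * (x * (y * z) - (y * z) * x) \<in> even_lattice"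
    using assms by (intro even_lattice_mult(2) commutator_even Hurwitz_mult)
  moreover have "p * (y * z - z * y) * x \<in> even_lattice" using assms by (intro swap_even)
  ultimately show ?thesis using even_lattice_add by simp
qed

text \<open>Expand and pair the monomials that agree up to the order of their factors.\<close>

lemma naive_det_mult:
  assumes "entries_in False S" "entries_in False T"
  shows "naive_det (S ** T) - naive_det S * naive_det T \<in> even_lattice"
proof -
  obtain a b c d where S: "S = mat2 a b c d" by (rule mat2_cases)
  obtain a' b' c' d' where T: "T = mat2 a' b' c' d'" by (rule mat2_cases)
  have H: "a \<in> Hurwitz" "b \<in> Hurwitz" "c \<in> Hurwitz" "d \<in> Hurwitz"
    "a' \<in> Hurwitz" "b' \<in> Hurwitz" "c' \<in> Hurwitz" "d' \<in> Hurwitz"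
    using assms by (auto simp: S T entries_in_mat2 twisted_Hurwitz_def)
  have "naive_det (S ** T) - naive_det S * naive_det T =
      a * (a' * c * b' - b' * c * a') + a * (a' * d - d * a') * d' + b * (c' * (c * b') - (c * b') * c') * 1
      + b * (c' * d * d' - d' * d * c') - a * (b' * d - d * b') * c' - b * (d' * (c * a') - (c * a') * d') * 1"
    by (simp add: S T mat2_mult naive_det_mat2 algebra_simps)
  also have "\<dots> \<in> even_lattice"
    using H by (intro even_lattice_diff even_lattice_add swap_even reverse_even Hurwitz_mult Hurwitz_1)
  finally show ?thesis .
qed

text \<open>The norm of \<open>ad - bc\<close> differs from the Study determinant only by the order of factors under a real part,
  that is by twice the real part of an element of the commutator ideal, an even number. So it is odd.\<close>

lemma naive_det_odd:
  assumes "study_det S = 1" "entries_in False S"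
  shows "naive_det S \<in> Hurwitz" "naive_det S \<notin> even_lattice"
proof -
  obtain a b c d where S: "S = mat2 a b c d" by (rule mat2_cases)
  have H: "a \<in> Hurwitz" "b \<in> Hurwitz" "c \<in> Hurwitz" "d \<in> Hurwitz"
    using assms by (auto simp: S entries_in_mat2 twisted_Hurwitz_def)
  then show "naive_det S \<in> Hurwitz" by (simp add: S naive_det_mat2 Hurwitz_diff Hurwitz_mult)
  have "a * (qcnj c * d - d * qcnj c) * qcnj b \<in> even_lattice"
    using H by (intro swap_even Hurwitz_qcnj)
  then obtain n :: int where n: "qRe (a * (qcnj c * d - d * qcnj c) * qcnj b) = of_int n"
    unfolding even_lattice_def by auto
  have "qnorm (naive_det S) = study_det S + 2 * qRe (a * (qcnj c * d - d * qcnj c) * qcnj b)"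
    by (simp add: S naive_det_mat2 study_det_mat2 qnorm_diff qnorm_mult qcnj_mult algebra_simps)
  then have "qnorm (naive_det S) = of_int (1 + 2 * n)" using assms n by simp
  then show "naive_det S \<notin> even_lattice"
    unfolding even_lattice_iff_norm of_int_eq_iff by (metis of_int_eq_iff even_add even_mult_iff dvd_triv_left odd_one)
qed

text \<open>The quotient by the commutator ideal is the field with four elements.\<close>

lemma odd_Hurwitz_residue:
  assumes "x \<in> Hurwitz" "x \<notin> even_lattice"
  obtains "x - 1 \<in> even_lattice" | "x - omega \<in> even_lattice" | "x - omega * omega \<in> even_lattice"
proof -
  obtain a b c d e :: int where x: "2 * qRe x = of_int (2 * a + e)" "2 * qI x = of_int (2 * b + e)"
    "2 * qJ x = of_int (2 * c + e)" "2 * qK x = of_int (2 * d + e)"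
    using assms unfolding Hurwitz_iff by blast
  show ?thesis
  proof (cases "even e")
    case True
    then obtain f where f: "e = 2 * f" by blast
    have xq: "x = Quat (of_int (a + f)) (of_int (b + f)) (of_int (c + f)) (of_int (d + f))"
      using x by (simp add: quat_eq_iff f)
    then have "odd ((a + f) + (b + f) + (c + f) + (d + f))" using assms(2) even_latticeI by metis
    then have "even ((a + f - 1) + (b + f) + (c + f) + (d + f))" by presburger
    moreover have "x - 1 = Quat (of_int (a + f - 1)) (of_int (b + f)) (of_int (c + f)) (of_int (d + f))"
      by (simp add: xq one_quat_def Quat_arith)
    ultimately have "x - 1 \<in> even_lattice" using even_latticeI by metis
    then show ?thesis by (rule that)
  next
    case False
    then obtain f where f: "e = 2 * f + 1" using oddE by blast
    define a' b' c' d' where "a' = a + f" and "b' = b + f" and "c' = c + f" and "d' = d + f"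
    have xq: "x - omega = Quat (of_int a') (of_int b') (of_int c') (of_int d')"
      using x by (simp add: quat_eq_iff f a'_def b'_def c'_def d'_def omega_def)
    have xq2: "x - omega * omega = Quat (of_int (a' + 1)) (of_int b') (of_int c') (of_int d')"
      using x by (simp add: quat_eq_iff quat_mult_sel f a'_def b'_def c'_def d'_def omega_def)
    show ?thesis
    proof (cases "even (a' + b' + c' + d')")
      case True
      then show ?thesis using that(2) even_latticeI xq by metis
    next
      case False
      then have "even ((a' + 1) + b' + c' + d')" by presburger
      then show ?thesis using that(3) even_latticeI xq2 by metis
    qed
  qed
qed


section \<open>Semi-direct products\<close>

lemma (in group) semidirect_product_criterion:
  assumes N: "N \<lhd> G" and B: "group B" and f: "f \<in> hom B G" "inj_on f (carrier B)"
    and disjoint: "\<And>b. b \<in> carrier B \<Longrightarrow> f b \<in> N \<Longrightarrow> f b = \<one>"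
    and factor: "\<And>x. x \<in> carrier G \<Longrightarrow> \<exists>n\<in>N. \<exists>b\<in>carrier B. x = n \<otimes> f b"
  shows "is_semidirect_product G (G\<lparr>carrier := N\<rparr>) B"
proof -
  interpret f: group_hom B G f
    using B f(1) is_group by (simp add: group_hom_def group_hom_axioms_def)
  have K: "subgroup (f ` carrier B) G" by (rule f.img_is_subgroup)
  have "f \<in> iso B (G\<lparr>carrier := f ` carrier B\<rparr>)"
    using f by (auto simp: iso_def hom_def bij_betw_def)
  then have iso: "G\<lparr>carrier := f ` carrier B\<rparr> \<cong> B"
    by (meson group.iso_sym[OF B] is_isoI)
  have "N \<subseteq> carrier G" using N by (simp add: normal_imp_subgroup subgroup.subset)
  then have "N <#> f ` carrier B \<subseteq> carrier G" by (intro set_mult_closed subgroup.subset[OF K])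
  moreover have "carrier G \<subseteq> N <#> f ` carrier B"
  proof
    fix x assume "x \<in> carrier G"
    then obtain n b where "n \<in> N" "b \<in> carrier B" "x = n \<otimes> f b" using factor by blast
    then show "x \<in> N <#> f ` carrier B" by (auto simp: set_mult_def)
  qed
  ultimately have "N <#> f ` carrier B = carrier G" by (rule equalityI)
  moreover have "N \<inter> f ` carrier B = {\<one>}"
    using disjoint subgroup.one_closed[OF K] subgroup.one_closed[OF normal_imp_subgroup[OF N]] by auto
  moreover have "G\<lparr>carrier := N\<rparr> \<cong> G\<lparr>carrier := N\<rparr>" by (rule iso_refl)
  ultimately show ?thesis
    unfolding is_semidirect_product_def using N K iso by blast
qed

lemma semidirect_product_transfer:
  assumes G: "group G" and G': "group G'" and h: "h \<in> iso G' G"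
    and sd: "is_semidirect_product G' A B"
  shows "is_semidirect_product G A B"
proof -
  obtain N K where NK: "N \<lhd> G'" "subgroup K G'" "N \<inter> K = {\<one>\<^bsub>G'\<^esub>}" "N <#>\<^bsub>G'\<^esub> K = carrier G'"
    "G'\<lparr>carrier := N\<rparr> \<cong> A" "G'\<lparr>carrier := K\<rparr> \<cong> B"
    using sd unfolding is_semidirect_product_def by blast
  interpret h: group_hom G' G h
    using G G' h by (simp add: group_hom_def group_hom_axioms_def iso_def)
  have bij: "bij_betw h (carrier G') (carrier G)" using h by (simp add: iso_def)
  have N: "subgroup N G'" using NK(1) by (rule normal_imp_subgroup)
  have sub: "N \<subseteq> carrier G'" "K \<subseteq> carrier G'" using N NK(2) by (auto dest: subgroup.subset)
  have iso: "G\<lparr>carrier := h ` H\<rparr> \<cong> C" if "subgroup H G'" "G'\<lparr>carrier := H\<rparr> \<cong> C" for H C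
  proof -
    have "G'\<lparr>carrier := H\<rparr> \<cong> G\<lparr>carrier := h ` H\<rparr>"
      using iso_restrict[OF h G' G that(1)] by (rule is_isoI)
    moreover have "group (G'\<lparr>carrier := H\<rparr>)" using that(1) G' by (rule subgroup.subgroup_is_group)
    ultimately show ?thesis using that(2) group.iso_sym iso_trans by blast
  qed
  have "h ` N \<inter> h ` K = h ` (N \<inter> K)"
    using inj_on_image_Int[of h "carrier G'" N K] bij sub by (simp add: bij_betw_def)
  then have "h ` N \<inter> h ` K = {\<one>\<^bsub>G\<^esub>}" using NK(3) by simp
  moreover have "h (n \<otimes>\<^bsub>G'\<^esub> k) = h n \<otimes>\<^bsub>G\<^esub> h k" if "n \<in> N" "k \<in> K" for n k
    using that sub by (intro h.hom_mult) auto
  then have "h ` N <#>\<^bsub>G\<^esub> h ` K = h ` (N <#>\<^bsub>G'\<^esub> K)"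
    unfolding set_mult_def image_UN by simp
  then have "h ` N <#>\<^bsub>G\<^esub> h ` K = carrier G" using NK(4) bij by (simp add: bij_betw_def)
  moreover have "h ` N \<lhd> G" by (rule iso_normal_subgroup[OF h G' G NK(1)])
  moreover have "subgroup (h ` K) G" by (rule subgroup.iso_subgroup[OF NK(2) G' G h])
  ultimately show ?thesis
    unfolding is_semidirect_product_def using iso[OF N NK(5)] iso[OF NK(2,6)] by blast
qed


section \<open>The projective groups\<close>

definition projective :: "quat^2^2 \<Rightarrow> (quat^2^2) set" where
  "projective S = {S, - S}"

lemma projective_eq_iff: "projective S = projective T \<longleftrightarrow> S = T \<or> S = - T"
  by (auto simp: projective_def doubleton_eq_iff)

lemma projective_uminus [simp]: "projective (- S) = projective S"
  by (simp add: projective_eq_iff)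

lemma SL2_quat_simps: "S \<otimes>\<^bsub>SL2_quat\<^esub> T = S ** T" "\<one>\<^bsub>SL2_quat\<^esub> = mat 1"
  by (simp_all add: SL2_quat_def)

lemma projective_normal: "{mat 1, - mat 1} \<lhd> SL2_quat"
proof (rule group.normal_invI[OF group_SL2_quat])
  show sg: "subgroup {mat 1, - mat 1} SL2_quat"
  proof (rule group.subgroupI[OF group_SL2_quat])
    fix S assume S: "S \<in> {mat 1, - mat 1 :: quat^2^2}"
    then have "inv\<^bsub>SL2_quat\<^esub> S = S"
      by (intro group.inv_equality[OF group_SL2_quat])
        (auto simp: SL2_quat_simps carrier_SL2_quat matrix_uminus_mult)
    then show "inv\<^bsub>SL2_quat\<^esub> S \<in> {mat 1, - mat 1}" using S by simp
  qed (auto simp: SL2_quat_simps carrier_SL2_quat matrix_uminus_mult)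
  fix S T :: "quat^2^2" assume S: "S \<in> carrier SL2_quat" and T: "T \<in> {mat 1, - mat 1}"
  have "S ** inv\<^bsub>SL2_quat\<^esub> S = mat 1"
    using group.r_inv[OF group_SL2_quat S] by (simp add: SL2_quat_simps)
  then show "S \<otimes>\<^bsub>SL2_quat\<^esub> T \<otimes>\<^bsub>SL2_quat\<^esub> inv\<^bsub>SL2_quat\<^esub> S \<in> {mat 1, - mat 1}"
    using T by (auto simp: SL2_quat_simps matrix_uminus_mult)
qed

lemma carrier_PSL2_quat: "carrier PSL2_quat = projective ` {S. study_det S = 1}"
proof -
  have "{mat 1, - mat 1} #>\<^bsub>SL2_quat\<^esub> S = projective S" for S
    by (auto simp: r_coset_def SL2_quat_simps projective_def matrix_uminus_mult)
  then show ?thesis by (simp add: PSL2_quat_def carrier_FactGroup carrier_SL2_quat)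
qed

lemma group_PSL2_quat: "group PSL2_quat"
  unfolding PSL2_quat_def by (rule normal.factorgroup_is_group[OF projective_normal])

lemma projective_mult: "projective S \<otimes>\<^bsub>PSL2_quat\<^esub> projective T = projective (S ** T)"
  by (auto simp: PSL2_quat_def set_mult_def SL2_quat_simps projective_def matrix_uminus_mult)

lemma projective_one: "\<one>\<^bsub>PSL2_quat\<^esub> = projective (mat 1)"
  by (simp add: PSL2_quat_def projective_def)

lemma projective_inv:
  assumes "study_det S = 1" shows "inv\<^bsub>PSL2_quat\<^esub> (projective S) = projective (inv2 S)"
  by (rule group.inv_equality[OF group_PSL2_quat])
    (use assms in \<open>auto simp: projective_mult projective_one inv2_left carrier_PSL2_quat study_det_inv2\<close>)

lemma projective_subgroup:
  assumes "X \<subseteq> {S. study_det S = 1}" "mat 1 \<in> X"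
    and "\<And>S T. S \<in> X \<Longrightarrow> T \<in> X \<Longrightarrow> S ** T \<in> X" and "\<And>S. S \<in> X \<Longrightarrow> inv2 S \<in> X"
  shows "subgroup (projective ` X) PSL2_quat"
proof (rule group.subgroupI[OF group_PSL2_quat])
  fix P assume "P \<in> projective ` X"
  then obtain S where S: "S \<in> X" "P = projective S" by blast
  then have "inv\<^bsub>PSL2_quat\<^esub> P = projective (inv2 S)" using projective_inv assms(1) by blast
  then show "inv\<^bsub>PSL2_quat\<^esub> P \<in> projective ` X" using assms(4) S by blast
qed (use assms in \<open>auto simp: carrier_PSL2_quat projective_mult\<close>)

definition SL2_Hurwitz :: "(quat^2^2) set" where
  "SL2_Hurwitz = {S. study_det S = 1 \<and> entries_in False S}"

definition SL2_0_Hurwitz :: "(quat^2^2) set" where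
  "SL2_0_Hurwitz = {S \<in> SL2_Hurwitz. naive_det S - 1 \<in> even_lattice}"

lemma SL2_Hurwitz_uminus [simp]: "- S \<in> SL2_Hurwitz \<longleftrightarrow> S \<in> SL2_Hurwitz"
  "- S \<in> SL2_0_Hurwitz \<longleftrightarrow> S \<in> SL2_0_Hurwitz"
  by (simp_all add: SL2_Hurwitz_def SL2_0_Hurwitz_def)

lemma projective_image_iff:
  assumes "\<And>S. - S \<in> X \<longleftrightarrow> S \<in> X"
  shows "projective S \<in> projective ` X \<longleftrightarrow> S \<in> X"
  using assms by (auto simp: projective_eq_iff)

lemma carrier_PSL2_Hurwitz: "carrier PSL2_Hurwitz = projective ` SL2_Hurwitz"
  unfolding PSL2_Hurwitz_def
  by (auto simp: carrier_PSL2_quat SL2_Hurwitz_def entries_in_def twisted_Hurwitz_def projective_def)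

lemma carrier_PSL2_0_Hurwitz: "carrier PSL2_0_Hurwitz = projective ` SL2_0_Hurwitz"
proof -
  have "(\<exists>S\<in>projective T. S $ 1 $ 1 * S $ 2 $ 2 - S $ 1 $ 2 * S $ 2 $ 1 - 1 \<in> Hurwitz_commutator_ideal)
    \<longleftrightarrow> naive_det T - 1 \<in> even_lattice" for T
    by (simp add: projective_def Hurwitz_commutator_ideal_eq naive_det_def)
  then show ?thesis
    by (auto simp: PSL2_0_Hurwitz_def carrier_PSL2_Hurwitz SL2_0_Hurwitz_def)
qed

definition extended_PSL2 :: "(quat^2^2) set monoid" where
  "extended_PSL2 = PSL2_quat\<lparr>carrier := projective ` extended_SL2\<rparr>"

lemma entries_in_one: "entries_in False (mat 1)"
  by (simp add: mat2_one entries_in_mat2 zero_one_twisted)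

lemma extended_PSL2_subgroup: "subgroup (projective ` extended_SL2) PSL2_quat"
proof (rule projective_subgroup)
  show "S ** T \<in> extended_SL2" if "S \<in> extended_SL2" "T \<in> extended_SL2" for S T
    using that entries_in_mult by (fastforce simp: extended_SL2_def study_det_mult)
qed (use entries_in_one entries_in_inv2 study_det_inv2 in \<open>auto simp: extended_SL2_def\<close>)

lemma group_extended_PSL2: "group extended_PSL2"
  unfolding extended_PSL2_def
  by (rule subgroup.subgroup_is_group[OF extended_PSL2_subgroup group_PSL2_quat])

lemma extended_PSL2_simps:
  "carrier extended_PSL2 = projective ` extended_SL2"
  "projective S \<otimes>\<^bsub>extended_PSL2\<^esub> projective T = projective (S ** T)"
  "\<one>\<^bsub>extended_PSL2\<^esub> = projective (mat 1)"
  by (simp_all add: extended_PSL2_def projective_mult projective_one)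

lemma extended_PSL2_inv:
  assumes "S \<in> extended_SL2"
  shows "inv\<^bsub>extended_PSL2\<^esub> (projective S) = projective (inv2 S)"
  using group.m_inv_consistent[OF group_PSL2_quat extended_PSL2_subgroup, of "projective S"] assms
    projective_inv[of S]
  by (simp add: extended_PSL2_def extended_SL2_def)

lemma restricted_groups:
  "extended_PSL2\<lparr>carrier := projective ` SL2_Hurwitz\<rparr> = PSL2_Hurwitz"
  "extended_PSL2\<lparr>carrier := projective ` SL2_0_Hurwitz\<rparr> = PSL2_0_Hurwitz"
proof -
  have "PSL2_quat\<lparr>carrier := carrier PSL2_Hurwitz\<rparr> = PSL2_Hurwitz"
    by (simp add: PSL2_Hurwitz_def)
  then show "extended_PSL2\<lparr>carrier := projective ` SL2_Hurwitz\<rparr> = PSL2_Hurwitz"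
    unfolding extended_PSL2_def carrier_PSL2_Hurwitz by simp
  have "PSL2_quat\<lparr>carrier := carrier PSL2_0_Hurwitz\<rparr> = PSL2_0_Hurwitz"
    by (simp add: PSL2_0_Hurwitz_def PSL2_Hurwitz_def)
  then show "extended_PSL2\<lparr>carrier := projective ` SL2_0_Hurwitz\<rparr> = PSL2_0_Hurwitz"
    unfolding extended_PSL2_def carrier_PSL2_0_Hurwitz by simp
qed

lemma inv2_unique: assumes "study_det S = 1" "T ** S = mat 1" shows "inv2 S = T"
  by (metis assms inv2_right matrix_mul_assoc matrix_mul_lid matrix_mul_rid)

text \<open>Reduction of normality in the projective group to a computation with representatives.\<close>

lemma normal_in_extended_PSL2:
  assumes X: "X \<subseteq> SL2_Hurwitz" "mat 1 \<in> X" "\<And>S. - S \<in> X \<longleftrightarrow> S \<in> X"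
    and mult: "\<And>S T. S \<in> X \<Longrightarrow> T \<in> X \<Longrightarrow> S ** T \<in> X" and inv: "\<And>S. S \<in> X \<Longrightarrow> inv2 S \<in> X"
    and conj: "\<And>S T. S \<in> extended_SL2 \<Longrightarrow> T \<in> X \<Longrightarrow> S ** T ** inv2 S \<in> X"
  shows "projective ` X \<lhd> extended_PSL2"
proof (rule group.normal_invI[OF group_extended_PSL2])
  have "subgroup (projective ` X) PSL2_quat"
    using X mult inv by (intro projective_subgroup) (auto simp: SL2_Hurwitz_def)
  moreover have "projective ` X \<subseteq> projective ` extended_SL2"
    using X(1) by (auto simp: SL2_Hurwitz_def extended_SL2_def)
  ultimately show "subgroup (projective ` X) extended_PSL2"
    unfolding extended_PSL2_def
    by (intro group.subgroup_incl[OF group_PSL2_quat _ extended_PSL2_subgroup])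
  fix P Q assume "P \<in> carrier extended_PSL2" "Q \<in> projective ` X"
  then obtain S T where "S \<in> extended_SL2" "P = projective S" "T \<in> X" "Q = projective T"
    by (auto simp: extended_PSL2_simps)
  then show "P \<otimes>\<^bsub>extended_PSL2\<^esub> Q \<otimes>\<^bsub>extended_PSL2\<^esub> inv\<^bsub>extended_PSL2\<^esub> P \<in> projective ` X"
    using conj by (simp add: extended_PSL2_inv extended_PSL2_simps(2))
qed

lemma SL2_Hurwitz_normal: "projective ` SL2_Hurwitz \<lhd> extended_PSL2"
proof (rule normal_in_extended_PSL2)
  show "S ** T \<in> SL2_Hurwitz" if "S \<in> SL2_Hurwitz" "T \<in> SL2_Hurwitz" for S T
    using that entries_in_mult[of False S False T] by (simp add: SL2_Hurwitz_def study_det_mult)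
  show "S ** T ** inv2 S \<in> SL2_Hurwitz" if ST: "S \<in> extended_SL2" "T \<in> SL2_Hurwitz" for S T
  proof -
    obtain b where b: "study_det S = 1" "entries_in b S" using ST(1) by (auto simp: extended_SL2_def)
    have T: "study_det T = 1" "entries_in False T" using ST(2) by (auto simp: SL2_Hurwitz_def)
    have "((b \<noteq> False) \<noteq> b) = False" by simp
    then have "entries_in False (S ** T ** inv2 S)"
      using entries_in_mult[OF entries_in_mult[OF b(2) T(2)] entries_in_inv2[OF b(2)]] by simp
    then show ?thesis using b T by (simp add: SL2_Hurwitz_def study_det_mult study_det_inv2)
  qed
qed (use entries_in_one entries_in_inv2 study_det_inv2 in \<open>auto simp: SL2_Hurwitz_def\<close>)

text \<open>Congruence modulo the commutator ideal.\<close>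

lemma even_lattice_trans: "x - y \<in> even_lattice \<Longrightarrow> y - z \<in> even_lattice \<Longrightarrow> x - z \<in> even_lattice"
  using even_lattice_add[of "x - y" "y - z"] by simp

lemma even_lattice_cong_mult:
  assumes "x - x' \<in> even_lattice" "y - y' \<in> even_lattice" "x' \<in> Hurwitz" "y \<in> Hurwitz"
  shows "x * y - x' * y' \<in> even_lattice"
proof -
  have "x * y - x' * y' = (x - x') * y + x' * (y - y')" by (simp add: algebra_simps)
  then show ?thesis using assms even_lattice_mult even_lattice_add by metis
qed

lemma naive_det_one: "naive_det (mat 1) = 1"
  by (simp add: mat2_one naive_det_mat2)

lemma SL2_0_Hurwitz_mult: assumes "S \<in> SL2_0_Hurwitz" "T \<in> SL2_0_Hurwitz" shows "S ** T \<in> SL2_0_Hurwitz"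
proof -
  have ST: "study_det S = 1" "entries_in False S" "study_det T = 1" "entries_in False T"
    "naive_det S - 1 \<in> even_lattice" "naive_det T - 1 \<in> even_lattice"
    using assms by (auto simp: SL2_0_Hurwitz_def SL2_Hurwitz_def)
  have "naive_det S * naive_det T - 1 * 1 \<in> even_lattice"
    using ST naive_det_odd by (intro even_lattice_cong_mult Hurwitz_1) auto
  then have "naive_det (S ** T) - 1 \<in> even_lattice"
    using even_lattice_trans[OF naive_det_mult[OF ST(2,4)]] by simp
  then show ?thesis
    using ST entries_in_mult[OF ST(2,4)] by (simp add: SL2_0_Hurwitz_def SL2_Hurwitz_def study_det_mult)
qed

text \<open>Modulo the commutator ideal \<open>ad - bc\<close> is a homomorphism to a commutative group.\<close>

lemma naive_det_conj:
  assumes S: "study_det S = 1" "entries_in False S" and T: "study_det T = 1" "entries_in False T"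
  shows "naive_det (S ** T ** inv2 S) - naive_det T \<in> even_lattice"
proof -
  define R where "R = inv2 S"
  have R: "study_det R = 1" "entries_in False R"
    using S by (simp_all add: R_def study_det_inv2 entries_in_inv2)
  have ST: "entries_in False (S ** T)" using entries_in_mult[OF S(2) T(2)] by simp
  define s t r where "s = naive_det S" and "t = naive_det T" and "r = naive_det R"
  have H: "s \<in> Hurwitz" "t \<in> Hurwitz" "r \<in> Hurwitz"
    using naive_det_odd S T R by (auto simp: s_def t_def r_def)
  have "naive_det (S ** R) - s * r \<in> even_lattice"
    unfolding s_def r_def by (rule naive_det_mult[OF S(2) R(2)])
  then have "1 - s * r \<in> even_lattice" using S by (simp add: R_def inv2_right naive_det_one)
  then have sr: "s * r - 1 \<in> even_lattice" using even_lattice_uminus[of "1 - s * r"] by simp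
  have "naive_det (S ** T ** R) - naive_det (S ** T) * r \<in> even_lattice"
    unfolding r_def by (rule naive_det_mult[OF ST R(2)])
  moreover have "naive_det (S ** T) * r - (s * t) * r \<in> even_lattice"
    using even_lattice_mult(1)[OF naive_det_mult[OF S(2) T(2)] H(3)]
    by (simp add: s_def t_def left_diff_distrib)
  moreover have "(s * t) * r - t \<in> even_lattice"
  proof -
    have "(s * t) * r - t = 1 * (s * t - t * s) * r + t * (s * r - 1)" by (simp add: algebra_simps)
    then show ?thesis
      using swap_even[OF Hurwitz_1 H] even_lattice_mult(2)[OF sr H(2)] even_lattice_add by simp
  qed
  ultimately show ?thesis unfolding R_def[symmetric] t_def[symmetric] by (meson even_lattice_trans)
qed

definition scalar_matrix :: "quat \<Rightarrow> quat^2^2" where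
  "scalar_matrix q = mat2 q 0 0 q"

lemma scalar_matrix_mult: "scalar_matrix p ** scalar_matrix q = scalar_matrix (p * q)"
  by (simp add: scalar_matrix_def mat2_mult)

lemma study_det_scalar_matrix: "qnorm q = 1 \<Longrightarrow> study_det (scalar_matrix q) = 1"
  by (simp add: scalar_matrix_def study_det_mat2)

lemma scalar_matrix_theta:
  "scalar_matrix theta ** scalar_matrix (- theta) = mat 1"
  "scalar_matrix (- theta) ** scalar_matrix theta = mat 1"
  "study_det (scalar_matrix theta) = 1" "study_det (scalar_matrix (- theta)) = 1"
  "entries_in True (scalar_matrix theta)" "entries_in True (scalar_matrix (- theta))"
proof -
  have "qnorm theta = 1" by (simp add: theta_def qnorm_def power_divide)
  then show "study_det (scalar_matrix theta) = 1" "study_det (scalar_matrix (- theta)) = 1"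
    by (simp_all add: study_det_scalar_matrix)
  have "theta \<in> twisted_Hurwitz True" by (simp add: twisted_Hurwitz_def theta_theta Hurwitz_1)
  then show "entries_in True (scalar_matrix theta)" "entries_in True (scalar_matrix (- theta))"
    by (simp_all add: scalar_matrix_def entries_in_mat2 zero_one_twisted)
qed (simp_all add: scalar_matrix_def mat2_mult theta_theta mat2_one)

lemma theta_conjugation_even: assumes "x \<in> even_lattice" shows "theta * x * theta \<in> even_lattice"
proof -
  have "qnorm (theta * x * theta) = qnorm x"
    by (simp add: theta_conjugation qnorm_def power2_eq_square)
  then show ?thesis using assms theta_conjugation_Hurwitz by (simp add: even_lattice_iff_norm)
qed

text \<open>For conjugation by a twisted matrix, split off the scalar \<open>theta\<close>. Conjugation by that scalar applies the
  automorphism \<open>x \<mapsto> theta x theta\<^sup>-\<^sup>1\<close> of the Hurwitz order to \<open>ad - bc\<close>, and it preserves the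
  commutator ideal.\<close>

lemma SL2_0_Hurwitz_normal: "projective ` SL2_0_Hurwitz \<lhd> extended_PSL2"
proof (rule normal_in_extended_PSL2)
  show "SL2_0_Hurwitz \<subseteq> SL2_Hurwitz" by (auto simp: SL2_0_Hurwitz_def)
  show "mat 1 \<in> SL2_0_Hurwitz"
    using entries_in_one even_lattice_0 by (simp add: SL2_0_Hurwitz_def SL2_Hurwitz_def naive_det_one)
  show "inv2 S \<in> SL2_0_Hurwitz" if "S \<in> SL2_0_Hurwitz" for S
  proof -
    have S: "study_det S = 1" "entries_in False S" "naive_det S - 1 \<in> even_lattice"
      using that by (auto simp: SL2_0_Hurwitz_def SL2_Hurwitz_def)
    have R: "study_det (inv2 S) = 1" "entries_in False (inv2 S)"
      using S by (simp_all add: study_det_inv2 entries_in_inv2)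
    have RH: "naive_det (inv2 S) \<in> Hurwitz" by (rule naive_det_odd(1)[OF R])
    have "naive_det (S ** inv2 S) - naive_det S * naive_det (inv2 S) \<in> even_lattice"
      by (rule naive_det_mult[OF S(2) R(2)])
    moreover have "naive_det S * naive_det (inv2 S) - naive_det (inv2 S) \<in> even_lattice"
      using even_lattice_mult(1)[OF S(3) RH] by (simp add: left_diff_distrib)
    ultimately have "1 - naive_det (inv2 S) \<in> even_lattice"
      using even_lattice_trans S(1) by (metis inv2_right naive_det_one)
    then have "naive_det (inv2 S) - 1 \<in> even_lattice"
      using even_lattice_uminus[of "1 - naive_det (inv2 S)"] by simp
    then show ?thesis using R by (simp add: SL2_0_Hurwitz_def SL2_Hurwitz_def)
  qed
  have untwisted: "S ** T ** inv2 S \<in> SL2_0_Hurwitz"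
    if "study_det S = 1" "entries_in False S" "T \<in> SL2_0_Hurwitz" for S T
  proof -
    have T: "study_det T = 1" "entries_in False T" "naive_det T - 1 \<in> even_lattice"
      using that by (auto simp: SL2_0_Hurwitz_def SL2_Hurwitz_def)
    have "naive_det (S ** T ** inv2 S) - 1 \<in> even_lattice"
      using even_lattice_trans[OF naive_det_conj[OF that(1,2) T(1,2)] T(3)] .
    moreover have "entries_in False (S ** T ** inv2 S)"
      using entries_in_mult[OF entries_in_mult[OF that(2) T(2)] entries_in_inv2[OF that(2)]] by simp
    ultimately show ?thesis
      using that(1) T(1) by (simp add: SL2_0_Hurwitz_def SL2_Hurwitz_def study_det_mult study_det_inv2)
  qed
  show "S ** T ** inv2 S \<in> SL2_0_Hurwitz" if ST: "S \<in> extended_SL2" "T \<in> SL2_0_Hurwitz" for S T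
  proof -
    obtain b where b: "study_det S = 1" "entries_in b S" using ST(1) by (auto simp: extended_SL2_def)
    show ?thesis
    proof (cases b)
      case True
      define P Q where "P = scalar_matrix theta" and "Q = scalar_matrix (- theta)"
      define R where "R = Q ** S"
      have PQ: "P ** Q = mat 1" "Q ** P = mat 1"
        by (simp_all add: P_def Q_def scalar_matrix_theta)
      have R: "study_det R = 1" "entries_in False R"
        using b True entries_in_mult[OF scalar_matrix_theta(6) b(2)]
        by (simp_all add: R_def Q_def study_det_mult scalar_matrix_theta)
      have S: "S = P ** R" by (simp add: R_def matrix_mul_assoc PQ)
      have "(inv2 R ** Q) ** (P ** R) = inv2 R ** (Q ** P) ** R" by (simp add: matrix_mul_assoc)
      also have "\<dots> = mat 1" using R by (simp add: PQ inv2_left)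
      finally have "inv2 S = inv2 R ** Q"
        using inv2_unique[OF b(1)] S by simp
      then have e: "S ** T ** inv2 S = P ** (R ** T ** inv2 R) ** Q"
        by (simp add: S matrix_mul_assoc)
      define M where "M = R ** T ** inv2 R"
      have "M \<in> SL2_0_Hurwitz" unfolding M_def by (rule untwisted[OF R ST(2)])
      then have M: "study_det M = 1" "entries_in False M" "naive_det M - 1 \<in> even_lattice"
        by (auto simp: SL2_0_Hurwitz_def SL2_Hurwitz_def)
      have "naive_det (P ** M ** Q) = - (theta * naive_det M * theta)"
        by (cases M rule: mat2_cases)
          (simp add: P_def Q_def scalar_matrix_def mat2_mult naive_det_mat2 theta_theta mult.assoc
            right_diff_distrib left_diff_distrib)
      then have "naive_det (P ** M ** Q) - 1 = - (theta * (naive_det M - 1) * theta)"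
        by (simp add: theta_theta left_diff_distrib right_diff_distrib)
      then have "naive_det (P ** M ** Q) - 1 \<in> even_lattice"
        using theta_conjugation_even[OF M(3)] even_lattice_uminus by simp
      moreover have "entries_in False (P ** M ** Q)"
        using entries_in_mult[OF entries_in_mult[OF scalar_matrix_theta(5) M(2)] scalar_matrix_theta(6)]
        by (simp add: P_def Q_def)
      moreover have "study_det (P ** M ** Q) = 1"
        using M by (simp add: P_def Q_def study_det_mult scalar_matrix_theta)
      ultimately show ?thesis
        by (simp add: e SL2_0_Hurwitz_def SL2_Hurwitz_def flip: M_def)
    qed (use b untwisted ST(2) in auto)
  qed
qed (auto simp: SL2_0_Hurwitz_mult)


section \<open>The complements\<close>

text \<open>A unit quaternion whose conjugation action on the imaginary axes \<open>i, j, k\<close> is the permutation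
  with \<open>1 \<mapsto> a\<close> and \<open>2 \<mapsto> b\<close>. It is unique up to sign once the even permutations are required to come from
  powers of \<open>omega\<close> and the odd ones from \<open>(e\<^sub>a - e\<^sub>b)/\<surd>2\<close>.\<close>

definition axis_quat :: "nat \<Rightarrow> nat \<Rightarrow> quat" where
  "axis_quat a b =
    (if a = 1 \<and> b = 2 then 1 else
     if a = 2 \<and> b = 3 then omega else
     if a = 3 \<and> b = 1 then omega * omega else
     if a = 2 \<and> b = 1 then theta else
     if a = 1 \<and> b = 3 then Quat 0 0 (sqrt 2 / 2) (- sqrt 2 / 2)
     else Quat 0 (- sqrt 2 / 2) 0 (sqrt 2 / 2))"

definition perm_class :: "(nat \<Rightarrow> nat) \<Rightarrow> (quat^2^2) set" where
  "perm_class p = projective (scalar_matrix (axis_quat (p 1) (p 2)))"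

lemma permutes_three_cases:
  assumes "p permutes {1..3::nat}"
  shows "(p 1, p 2, p 3) \<in> {(1,2,3), (2,3,1), (3,1,2), (2,1,3), (1,3,2), (3,2,1)}"
proof -
  have "p 1 \<in> {1..3}" "p 2 \<in> {1..3}" "p 3 \<in> {1..3}"
    using permutes_in_image[OF assms] by auto
  then have "p 1 \<in> {1, 2, 3}" "p 2 \<in> {1, 2, 3}" "p 3 \<in> {1, 2, 3}" by auto
  moreover have "p 1 \<noteq> p 2" "p 1 \<noteq> p 3" "p 2 \<noteq> p 3"
    by (simp_all add: inj_eq[OF permutes_inj[OF assms]])
  ultimately show ?thesis unfolding insert_iff empty_iff by (elim disjE; simp)
qed

lemma permutes_three_eqI:
  assumes "p permutes {1..3::nat}" "q permutes {1..3}" "p 1 = q 1" "p 2 = q 2" shows "p = q"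
proof
  fix n :: nat
  have "p 1 + p 2 + p 3 = 6" "q 1 + q 2 + q 3 = 6"
    using permutes_three_cases[OF assms(1)] permutes_three_cases[OF assms(2)] by auto
  then have "p 3 = q 3" using assms(3,4) by linarith
  moreover have "n = 1 \<or> n = 2 \<or> n = 3 \<or> n \<notin> {1..3}" by auto
  ultimately show "p n = q n"
    using assms permutes_not_in[OF assms(1), of n] permutes_not_in[OF assms(2), of n] by auto
qed

lemma axis_quat_compose:
  assumes "p permutes {1..3}" "q permutes {1..3}"
  shows "axis_quat (p 1) (p 2) * axis_quat (q 1) (q 2) \<in>
    {axis_quat (p (q 1)) (p (q 2)), - axis_quat (p (q 1)) (p (q 2))}"
  using permutes_three_cases[OF assms(1)] permutes_three_cases[OF assms(2)]
  unfolding insert_iff empty_iff prod.inject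
  by (elim disjE conjE; simp add: axis_quat_def omega_def theta_def one_quat_def Quat_arith)

lemma axis_quat_inj:
  assumes "p permutes {1..3}" "q permutes {1..3}"
    and "axis_quat (p 1) (p 2) \<in> {axis_quat (q 1) (q 2), - axis_quat (q 1) (q 2)}"
  shows "p 1 = q 1 \<and> p 2 = q 2"
  using permutes_three_cases[OF assms(1)] permutes_three_cases[OF assms(2)] assms(3)
  unfolding insert_iff empty_iff prod.inject
  by (elim disjE conjE; simp add: axis_quat_def omega_def theta_def one_quat_def Quat_arith)

lemma scalar_matrix_eq_iff: "scalar_matrix p = scalar_matrix q \<longleftrightarrow> p = q"
  by (simp add: scalar_matrix_def)

lemma scalar_matrix_uminus: "- scalar_matrix q = scalar_matrix (- q)"
  by (simp add: scalar_matrix_def mat2_uminus)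

lemma scalar_matrix_one: "scalar_matrix 1 = mat 1"
  by (simp add: scalar_matrix_def mat2_one)

lemma projective_scalar_eq_iff:
  "projective (scalar_matrix p) = projective (scalar_matrix q) \<longleftrightarrow> p \<in> {q, - q}"
  by (simp add: projective_eq_iff scalar_matrix_uminus scalar_matrix_eq_iff)

lemma sqrt2_not_int: "sqrt 2 \<noteq> of_int n"
proof
  assume "sqrt 2 = of_int n"
  then have "of_int (n * n) = (of_int 2 :: real)" by (simp flip: \<open>sqrt 2 = of_int n\<close>)
  then have n: "n * n = 2" by linarith
  then have "\<bar>n\<bar> * \<bar>n\<bar> = 2" by simp
  moreover have "\<bar>n\<bar> \<le> 1 \<or> 2 \<le> \<bar>n\<bar>" by linarith
  ultimately show False
  proof (elim disjE)
    assume "\<bar>n\<bar> \<le> 1"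
    then have "n = 0 \<or> n = 1 \<or> n = -1" by linarith
    then show False using n by auto
  next
    assume "2 \<le> \<bar>n\<bar>"
    then have "2 * 2 \<le> \<bar>n\<bar> * \<bar>n\<bar>" by (intro mult_mono) auto
    then show False using n by simp
  qed
qed

lemma not_Hurwitz_sqrt2:
  assumes "sqrt 2 \<in> {2 * qI x, 2 * qJ x}" shows "x \<notin> Hurwitz"
proof
  assume "x \<in> Hurwitz"
  then obtain b c e :: int where "2 * qI x = of_int (2 * b + e)" "2 * qJ x = of_int (2 * c + e)"
    unfolding Hurwitz_iff by blast
  then have "sqrt 2 = of_int (2 * b + e) \<or> sqrt 2 = of_int (2 * c + e)"
    using assms by (metis insertE singletonD)
  then show False using sqrt2_not_int by blast
qed

lemma theta_not_Hurwitz: "theta \<notin> Hurwitz"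
  by (rule not_Hurwitz_sqrt2) (simp add: theta_def)

lemma axis_quat_Hurwitz:
  assumes "p permutes {1..3}"
  shows "axis_quat (p 1) (p 2) \<in> Hurwitz \<longleftrightarrow> (p 1, p 2) \<in> {(1,2), (2,3), (3,1)}"
proof -
  have "Quat 0 0 (sqrt 2 / 2) (- sqrt 2 / 2) \<notin> Hurwitz" by (rule not_Hurwitz_sqrt2) simp
  moreover have "- Quat 0 (- sqrt 2 / 2) 0 (sqrt 2 / 2) \<notin> Hurwitz" by (rule not_Hurwitz_sqrt2) (simp add: Quat_arith)
  then have "Quat 0 (- sqrt 2 / 2) 0 (sqrt 2 / 2) \<notin> Hurwitz" using Hurwitz_uminus by blast
  ultimately show ?thesis
    using permutes_three_cases[OF assms]
    by (auto simp: axis_quat_def theta_not_Hurwitz Hurwitz_1 omega_Hurwitz Hurwitz_mult)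
qed

lemma even_lattice_qRe: "x \<in> even_lattice \<Longrightarrow> \<exists>n::int. qRe x = of_int n"
  unfolding even_lattice_def by auto

lemma not_int_half: "- (3/2) \<noteq> (of_int n :: real)"
proof
  assume "- (3/2) = (of_int n :: real)"
  then have "of_int (2 * n) = (of_int (-3) :: real)" by simp
  then show False unfolding of_int_eq_iff by presburger
qed

lemma entries_in_scalar_matrix: "entries_in False (scalar_matrix q) \<longleftrightarrow> q \<in> Hurwitz"
  by (simp add: scalar_matrix_def entries_in_mat2 twisted_Hurwitz_def Hurwitz_0)

lemma naive_det_scalar_matrix: "naive_det (scalar_matrix q) = q * q"
  by (simp add: scalar_matrix_def naive_det_mat2)

lemma qnorm_axis_quat: "qnorm (axis_quat a b) = 1"
  by (simp add: axis_quat_def qnorm_mult omega_Hurwitz) (simp add: qnorm_def theta_def power_divide)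

lemma scalar_axis_extended:
  assumes "p permutes {1..3}"
  shows "scalar_matrix (axis_quat (p 1) (p 2)) \<in> extended_SL2"
proof -
  have t: "x \<in> twisted_Hurwitz True" if "theta * x \<in> Hurwitz" for x using that by (simp add: twisted_Hurwitz_def)
  have "theta \<in> twisted_Hurwitz True" by (rule t) (simp add: theta_theta Hurwitz_1)
  moreover have "Quat 0 0 (sqrt 2 / 2) (- sqrt 2 / 2) \<in> twisted_Hurwitz True"
    by (rule t) (auto simp: theta_def Quat_arith intro!: Hurwitz_halfI)
  moreover have "Quat 0 (- sqrt 2 / 2) 0 (sqrt 2 / 2) \<in> twisted_Hurwitz True"
    by (rule t) (auto simp: theta_def Quat_arith intro!: Hurwitz_halfI)
  moreover have "1 \<in> twisted_Hurwitz False" "omega \<in> twisted_Hurwitz False" "omega * omega \<in> twisted_Hurwitz False"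
    using omega_Hurwitz by (auto simp: twisted_Hurwitz_def Hurwitz_1 Hurwitz_mult)
  ultimately have "axis_quat (p 1) (p 2) \<in> twisted_Hurwitz False \<or> axis_quat (p 1) (p 2) \<in> twisted_Hurwitz True"
    by (simp add: axis_quat_def)
  then obtain b where "axis_quat (p 1) (p 2) \<in> twisted_Hurwitz b" by blast
  then have "entries_in b (scalar_matrix (axis_quat (p 1) (p 2)))"
    by (simp add: scalar_matrix_def entries_in_mat2 zero_one_twisted)
  then show ?thesis
    using study_det_scalar_matrix[OF qnorm_axis_quat] by (auto simp: extended_SL2_def)
qed

lemma perm_class_hom: "perm_class \<in> hom (sym_group 3) extended_PSL2"
proof (rule homI)
  fix p assume "p \<in> carrier (sym_group 3)"
  then show "perm_class p \<in> carrier extended_PSL2"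
    using scalar_axis_extended by (simp add: perm_class_def extended_PSL2_simps sym_group_carrier)
next
  fix p q assume "p \<in> carrier (sym_group 3)" "q \<in> carrier (sym_group 3)"
  then show "perm_class (p \<otimes>\<^bsub>sym_group 3\<^esub> q) = perm_class p \<otimes>\<^bsub>extended_PSL2\<^esub> perm_class q"
    using axis_quat_compose[of p q]
    by (auto simp: perm_class_def extended_PSL2_simps sym_group_carrier sym_group_mult
        scalar_matrix_mult projective_scalar_eq_iff)
qed

text \<open>The scalar matrix of a unit \<open>q\<close> has \<open>ad - bc = q\<^sup>2\<close>, and squaring is a bijection of the nonzero residues
  \<open>1, \<omega>, \<omega>\<^sup>2\<close>. So one of these scalars corrects \<open>ad - bc\<close> to \<open>1\<close>.\<close>

lemma SL2_Hurwitz_factor: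
  assumes "S \<in> SL2_Hurwitz"
  shows "\<exists>T\<in>SL2_0_Hurwitz. \<exists>p. p permutes {1..3} \<and> projective S = projective T \<otimes>\<^bsub>extended_PSL2\<^esub> perm_class p"
proof -
  have S: "study_det S = 1" "entries_in False S" using assms by (auto simp: SL2_Hurwitz_def)
  have factor: ?thesis
    if k: "naive_det S - k \<in> even_lattice" and q: "q \<in> Hurwitz" "qnorm q = 1" "k * (qcnj q * qcnj q) - 1 \<in> even_lattice"
      and p: "p permutes {1..3}" "axis_quat (p 1) (p 2) = q" for k q p
  proof -
    define Q where "Q = scalar_matrix (qcnj q)"
    have Q: "study_det Q = 1" "entries_in False Q"
      using q by (simp_all add: Q_def study_det_scalar_matrix entries_in_scalar_matrix Hurwitz_qcnj)
    have "naive_det (S ** Q) - naive_det S * naive_det Q \<in> even_lattice"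
      by (rule naive_det_mult[OF S(2) Q(2)])
    moreover have "naive_det S * naive_det Q - k * (qcnj q * qcnj q) \<in> even_lattice"
      using even_lattice_mult(1)[OF k, of "qcnj q * qcnj q"] q
      by (simp add: Q_def naive_det_scalar_matrix left_diff_distrib Hurwitz_mult Hurwitz_qcnj)
    ultimately have "naive_det (S ** Q) - 1 \<in> even_lattice"
      using q(3) by (meson even_lattice_trans)
    then have "S ** Q \<in> SL2_0_Hurwitz"
      using S Q entries_in_mult[OF S(2) Q(2)] by (simp add: SL2_0_Hurwitz_def SL2_Hurwitz_def study_det_mult)
    moreover have "S ** Q ** scalar_matrix q = S"
      using q(2) by (simp add: Q_def scalar_matrix_mult mult_qcnj scalar_matrix_one flip: matrix_mul_assoc)
    then have "projective S = projective (S ** Q) \<otimes>\<^bsub>extended_PSL2\<^esub> perm_class p"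
      unfolding perm_class_def p(2) extended_PSL2_simps by simp
    ultimately show ?thesis using p(1) by blast
  qed
  have cycle: "(transpose 1 2 \<circ> transpose 2 3) permutes {1..3::nat}" "(transpose 2 3 \<circ> transpose 1 2) permutes {1..3::nat}"
    by (intro permutes_compose permutes_swap_id; simp)+
  have om: "omega * (qcnj (omega * omega) * qcnj (omega * omega)) - 1 \<in> even_lattice"
    using even_latticeI[of "-2" 0 0 0] by (simp add: omega_def Quat_arith one_quat_def)
  have om2: "omega * omega * (qcnj omega * qcnj omega) - 1 \<in> even_lattice"
    using even_lattice_0 by (simp add: omega_def Quat_arith one_quat_def zero_quat_def)
  show ?thesis
  proof (cases rule: odd_Hurwitz_residue[OF naive_det_odd[OF S]])
    case 1
    then show ?thesis
      using factor[of 1 1 id] even_lattice_0 by (simp add: Hurwitz_1 permutes_id axis_quat_def)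
  next
    case 2
    then show ?thesis
      using factor[OF 2 _ _ om cycle(2)] omega_Hurwitz
      by (simp add: Hurwitz_mult qnorm_mult axis_quat_def transpose_def)
  next
    case 3
    then show ?thesis
      using factor[OF 3 _ _ om2 cycle(1)] omega_Hurwitz
      by (simp add: axis_quat_def transpose_def)
  qed
qed

lemma extended_SL2_untwist:
  assumes "S \<in> extended_SL2" "S \<notin> SL2_Hurwitz"
  obtains R where "R \<in> SL2_Hurwitz" "S = R ** scalar_matrix theta"
proof -
  obtain b where S: "study_det S = 1" "entries_in b S" using assms(1) by (auto simp: extended_SL2_def)
  then have b using assms(2) by (cases b) (auto simp: SL2_Hurwitz_def)
  define R where "R = S ** scalar_matrix (- theta)"
  have "R \<in> SL2_Hurwitz"
    using S \<open>b\<close> entries_in_mult[OF S(2) scalar_matrix_theta(6)]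
    by (simp add: R_def SL2_Hurwitz_def study_det_mult scalar_matrix_theta)
  moreover have "S = R ** scalar_matrix theta"
    by (simp add: R_def scalar_matrix_theta flip: matrix_mul_assoc)
  ultimately show ?thesis by (rule that)
qed

text \<open>An element of the complement that lies in the normal subgroup is untwisted, hence a power of \<open>omega\<close>, and its
  square is \<open>1\<close> modulo the commutator ideal only for the identity.\<close>

theorem extended_PSL2_semidirect_S3: "is_semidirect_product extended_PSL2 PSL2_0_Hurwitz (sym_group 3)"
proof -
  interpret group extended_PSL2 by (rule group_extended_PSL2)
  have "is_semidirect_product extended_PSL2 (extended_PSL2\<lparr>carrier := projective ` SL2_0_Hurwitz\<rparr>) (sym_group 3)"
  proof (rule semidirect_product_criterion[where f = perm_class])
    show "projective ` SL2_0_Hurwitz \<lhd> extended_PSL2" by (rule SL2_0_Hurwitz_normal)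
    show "group (sym_group 3)" by (rule sym_group_is_group)
    show "perm_class \<in> hom (sym_group 3) extended_PSL2" by (rule perm_class_hom)
    show "inj_on perm_class (carrier (sym_group 3))"
    proof (rule inj_onI)
      fix p q assume pq: "p \<in> carrier (sym_group 3)" "q \<in> carrier (sym_group 3)"
        and "perm_class p = perm_class q"
      then have "axis_quat (p 1) (p 2) \<in> {axis_quat (q 1) (q 2), - axis_quat (q 1) (q 2)}"
        by (simp add: perm_class_def projective_scalar_eq_iff)
      then show "p = q"
        using pq axis_quat_inj permutes_three_eqI by (simp add: sym_group_carrier)
    qed
  next
    fix p assume p: "p \<in> carrier (sym_group 3)" and "perm_class p \<in> projective ` SL2_0_Hurwitz"
    then have "scalar_matrix (axis_quat (p 1) (p 2)) \<in> SL2_0_Hurwitz"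
      by (simp add: perm_class_def projective_image_iff)
    then have q: "axis_quat (p 1) (p 2) \<in> Hurwitz"
      "axis_quat (p 1) (p 2) * axis_quat (p 1) (p 2) - 1 \<in> even_lattice"
      by (simp_all add: SL2_0_Hurwitz_def SL2_Hurwitz_def entries_in_scalar_matrix naive_det_scalar_matrix)
    have "(p 1, p 2) \<in> {(1,2), (2,3), (3,1)}"
      using q(1) axis_quat_Hurwitz p by (simp add: sym_group_carrier)
    moreover have "omega * omega - 1 \<notin> even_lattice" "omega * omega * (omega * omega) - 1 \<notin> even_lattice"
      using not_int_half by (auto dest!: even_lattice_qRe simp: omega_def Quat_arith one_quat_def)
    ultimately have "p 1 = 1 \<and> p 2 = 2"
      using q(2) by (auto simp: axis_quat_def)
    then show "perm_class p = \<one>\<^bsub>extended_PSL2\<^esub>"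
      by (simp add: perm_class_def extended_PSL2_simps axis_quat_def scalar_matrix_one)
  next
    fix X assume "X \<in> carrier extended_PSL2"
    then obtain S where S: "X = projective S" "S \<in> extended_SL2"
      by (auto simp: extended_PSL2_simps)
    have mem: "projective T \<in> carrier extended_PSL2" if "T \<in> SL2_0_Hurwitz" for T
      using that by (auto simp: extended_PSL2_simps SL2_0_Hurwitz_def SL2_Hurwitz_def extended_SL2_def)
    show "\<exists>n\<in>projective ` SL2_0_Hurwitz. \<exists>p\<in>carrier (sym_group 3). X = n \<otimes>\<^bsub>extended_PSL2\<^esub> perm_class p"
    proof (cases "S \<in> SL2_Hurwitz")
      case True
      obtain T p where "T \<in> SL2_0_Hurwitz" "p permutes {1..3}"
        "projective S = projective T \<otimes>\<^bsub>extended_PSL2\<^esub> perm_class p"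
        using SL2_Hurwitz_factor[OF True] by blast
      then show ?thesis
        unfolding S(1)
        by (intro bexI[of _ "projective T"] bexI[of _ p]) (simp_all add: sym_group_carrier)
    next
      case False
      obtain R where R: "R \<in> SL2_Hurwitz" "S = R ** scalar_matrix theta"
        using extended_SL2_untwist[OF S(2) False] by blast
      obtain T p where T: "T \<in> SL2_0_Hurwitz" "p permutes {1..3}"
        "projective R = projective T \<otimes>\<^bsub>extended_PSL2\<^esub> perm_class p"
        using SL2_Hurwitz_factor[OF R(1)] by blast
      have swap: "transpose 1 2 \<in> carrier (sym_group 3)"
        by (simp add: sym_group_carrier permutes_swap_id)
      have p: "p \<in> carrier (sym_group 3)" using T(2) by (simp add: sym_group_carrier)
      have pt: "p \<otimes>\<^bsub>sym_group 3\<^esub> transpose 1 2 \<in> carrier (sym_group 3)"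
        using p swap by (rule monoid.m_closed[OF group.is_monoid[OF sym_group_is_group]])
      have theta: "projective (scalar_matrix theta) = perm_class (transpose 1 2)"
        by (simp add: perm_class_def axis_quat_def)
      have "X = projective R \<otimes>\<^bsub>extended_PSL2\<^esub> perm_class (transpose 1 2)"
        by (simp only: S(1) R(2) extended_PSL2_simps theta[symmetric])
      also have "\<dots> = projective T \<otimes>\<^bsub>extended_PSL2\<^esub> (perm_class p \<otimes>\<^bsub>extended_PSL2\<^esub> perm_class (transpose 1 2))"
        unfolding T(3) using mem[OF T(1)] hom_in_carrier[OF perm_class_hom] p swap by (intro m_assoc)
      also have "\<dots> = projective T \<otimes>\<^bsub>extended_PSL2\<^esub> perm_class (p \<otimes>\<^bsub>sym_group 3\<^esub> transpose 1 2)"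
        using hom_mult[OF perm_class_hom p swap] by simp
      finally show ?thesis using T(1) pt by blast
    qed
  qed
  then show ?thesis by (simp only: restricted_groups)
qed

definition parity_class :: "int \<Rightarrow> (quat^2^2) set" where
  "parity_class n = projective (if n = 0 then mat 1 else scalar_matrix theta)"

theorem extended_PSL2_semidirect_Z2: "is_semidirect_product extended_PSL2 PSL2_Hurwitz (integer_mod_group 2)"
proof -
  interpret group extended_PSL2 by (rule group_extended_PSL2)
  have theta: "scalar_matrix theta \<notin> SL2_Hurwitz" "scalar_matrix theta \<in> extended_SL2"
    using scalar_matrix_theta theta_not_Hurwitz
    by (auto simp: SL2_Hurwitz_def extended_SL2_def entries_in_scalar_matrix)
  have one: "mat 1 \<in> SL2_Hurwitz" "mat 1 \<in> extended_SL2"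
    using entries_in_one by (auto simp: SL2_Hurwitz_def extended_SL2_def)
  have Z2: "carrier (integer_mod_group 2) = {0, 1}"
    by (auto simp: integer_mod_group_def)
  have square: "projective (scalar_matrix theta ** scalar_matrix theta) = projective (mat 1)"
    by (simp add: scalar_matrix_mult theta_theta flip: scalar_matrix_uminus scalar_matrix_one)
  have ne: "projective (mat 1) \<noteq> projective (scalar_matrix theta)"
    using theta(1) one(1) by (metis SL2_Hurwitz_uminus(1) projective_image_iff image_eqI)
  have "is_semidirect_product extended_PSL2 (extended_PSL2\<lparr>carrier := projective ` SL2_Hurwitz\<rparr>) (integer_mod_group 2)"
  proof (rule semidirect_product_criterion[where f = parity_class])
    show "projective ` SL2_Hurwitz \<lhd> extended_PSL2" by (rule SL2_Hurwitz_normal)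
    show "group (integer_mod_group 2)" by simp
    show "parity_class \<in> hom (integer_mod_group 2) extended_PSL2"
    proof (rule homI)
      show "parity_class m \<in> carrier extended_PSL2" for m
        using theta(2) one(2) by (simp add: parity_class_def extended_PSL2_simps)
      show "parity_class (m \<otimes>\<^bsub>integer_mod_group 2\<^esub> n) = parity_class m \<otimes>\<^bsub>extended_PSL2\<^esub> parity_class n"
        if "m \<in> carrier (integer_mod_group 2)" "n \<in> carrier (integer_mod_group 2)" for m n
        using that unfolding Z2 insert_iff empty_iff
        by (elim disjE) (simp_all add: parity_class_def extended_PSL2_simps square)
    qed
    show "inj_on parity_class (carrier (integer_mod_group 2))"
      using ne by (auto simp: inj_on_def Z2 parity_class_def)
    show "parity_class n = \<one>\<^bsub>extended_PSL2\<^esub>"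
      if "n \<in> carrier (integer_mod_group 2)" "parity_class n \<in> projective ` SL2_Hurwitz" for n
      using that theta(1) by (auto simp: Z2 parity_class_def extended_PSL2_simps projective_image_iff)
    fix X assume "X \<in> carrier extended_PSL2"
    then obtain S where S: "X = projective S" "S \<in> extended_SL2"
      by (auto simp: extended_PSL2_simps)
    show "\<exists>n\<in>projective ` SL2_Hurwitz. \<exists>b\<in>carrier (integer_mod_group 2). X = n \<otimes>\<^bsub>extended_PSL2\<^esub> parity_class b"
    proof (cases "S \<in> SL2_Hurwitz")
      case True
      then show ?thesis
        by (intro bexI[of _ "projective S"] bexI[of _ 0]) (auto simp: S(1) Z2 parity_class_def extended_PSL2_simps)
    next
      case False
      obtain R where "R \<in> SL2_Hurwitz" "S = R ** scalar_matrix theta"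
        using extended_SL2_untwist[OF S(2) False] by blast
      then show ?thesis
        by (intro bexI[of _ "projective R"] bexI[of _ 1]) (auto simp: S(1) Z2 parity_class_def extended_PSL2_simps)
    qed
  qed
  then show ?thesis by (simp only: restricted_groups)
qed


section \<open>The even Weyl group\<close>

lemma pres_class_eq_iff: "pres_class X R u = pres_class X R v \<longleftrightarrow> pres_eq X R u v"
  unfolding pres_class_def by (auto intro: pres_eq.intros)

lemma pres_class_self: "u \<in> pres_class X R u"
  by (simp add: pres_class_def pres_refl)

lemma pres_class_mult:
  "(\<Union>u\<in>pres_class X R p. \<Union>v\<in>pres_class X R q. pres_class X R (u @ v)) = pres_class X R (p @ q)"
proof -
  have "pres_class X R (u @ v) = pres_class X R (p @ q)"
    if "u \<in> pres_class X R p" "v \<in> pres_class X R q" for u v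
    unfolding pres_class_eq_iff
    using that by (intro pres_sym[OF pres_eq_append]) (simp_all add: pres_class_def)
  moreover have "pres_class X R u \<noteq> {}" for u using pres_class_self by blast
  ultimately show ?thesis by (simp cong: SUP_cong)
qed

abbreviation "F4pp_even \<equiv> even_weyl_group F4pp_cartan F4pp_nodes"

definition weyl_element :: "int list \<Rightarrow> (int \<times> bool) list set" where
  "weyl_element w = pres_class F4pp_nodes (coxeter_relators F4pp_cartan F4pp_nodes) (pos_word w)"

lemma weyl_element_eq_iff: "weyl_element u = weyl_element v \<longleftrightarrow> F4pp.eqv u v"
  by (simp add: weyl_element_def pres_class_eq_iff F4pp.eqv_def)

lemma F4pp_even_simps:
  "carrier F4pp_even = weyl_element ` {w \<in> lists F4pp_nodes. even (length w)}"
  "weyl_element u \<otimes>\<^bsub>F4pp_even\<^esub> weyl_element v = weyl_element (u @ v)"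
  "\<one>\<^bsub>F4pp_even\<^esub> = weyl_element []"
  by (auto simp: even_weyl_group_def weyl_group_def presented_group_def weyl_element_def pres_class_mult)

lemma group_F4pp_even: "group F4pp_even"
proof (rule groupI)
  fix P assume "P \<in> carrier F4pp_even"
  then obtain w where w: "w \<in> lists F4pp_nodes" "even (length w)" "P = weyl_element w"
    by (auto simp: F4pp_even_simps)
  have "rev w \<in> lists F4pp_nodes" using w(1) by (simp add: in_lists_conv_set)
  then have "F4pp.eqv (rev w @ w) []" using F4pp.eqv_rev[of "rev w"] by simp
  then show "\<exists>Q\<in>carrier F4pp_even. Q \<otimes>\<^bsub>F4pp_even\<^esub> P = \<one>\<^bsub>F4pp_even\<^esub>"
    using w by (intro bexI[of _ "weyl_element (rev w)"]) (auto simp: F4pp_even_simps weyl_element_eq_iff)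
qed (auto simp: F4pp_even_simps in_lists_conv_set intro!: imageI)

definition spin_class :: "(int \<times> bool) list set \<Rightarrow> (quat^2^2) set" where
  "spin_class P = projective (spin True (map fst (SOME u. u \<in> P)))"

lemma spin_class_weyl_element: "spin_class (weyl_element w) = projective (spin True w)"
proof -
  define u where "u = (SOME u. u \<in> weyl_element w)"
  have "u \<in> weyl_element w" unfolding u_def weyl_element_def by (rule someI, rule pres_class_self)
  then have "pres_eq F4pp_nodes (coxeter_relators F4pp_cartan F4pp_nodes) (pos_word w) u"
    by (simp add: weyl_element_def pres_class_def)
  from spin_pres_eq[OF this, of True] show ?thesis
    by (auto simp: spin_class_def projective_eq_iff comp_def simp flip: u_def)
qed

lemma spin_extended: "w \<in> lists F4pp_nodes \<Longrightarrow> spin e w \<in> extended_SL2"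
  using spin_entries by (simp add: extended_SL2_def)

text \<open>Injectivity is \<open>spin_faithful\<close> and surjectivity is \<open>spin_image_eq\<close>.\<close>

lemma spin_class_iso: "spin_class \<in> iso F4pp_even extended_PSL2"
proof (rule isoI)
  show "spin_class \<in> hom F4pp_even extended_PSL2"
  proof (rule homI)
    fix P assume "P \<in> carrier F4pp_even"
    then show "spin_class P \<in> carrier extended_PSL2"
      by (auto simp: F4pp_even_simps extended_PSL2_simps spin_class_weyl_element
          intro!: imageI spin_extended)
  next
    fix P Q assume "P \<in> carrier F4pp_even" "Q \<in> carrier F4pp_even"
    then show "spin_class (P \<otimes>\<^bsub>F4pp_even\<^esub> Q) = spin_class P \<otimes>\<^bsub>extended_PSL2\<^esub> spin_class Q"
      by (auto simp: F4pp_even_simps extended_PSL2_simps spin_class_weyl_element spin_append)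
  qed
  show "bij_betw spin_class (carrier F4pp_even) (carrier extended_PSL2)"
    unfolding bij_betw_def
  proof
    show "inj_on spin_class (carrier F4pp_even)"
    proof (rule inj_onI)
      fix P Q assume "P \<in> carrier F4pp_even" "Q \<in> carrier F4pp_even" and eq: "spin_class P = spin_class Q"
      then obtain u v where u: "u \<in> lists F4pp_nodes" "even (length u)" "P = weyl_element u"
        and v: "v \<in> lists F4pp_nodes" "even (length v)" "Q = weyl_element v"
        by (auto simp: F4pp_even_simps)
      have "spin True u = spin True v \<or> spin True u = - spin True v"
        using eq by (simp add: u v spin_class_weyl_element projective_eq_iff)
      then have "spin True (u @ rev v) \<in> {spin True (v @ rev v), - spin True (v @ rev v)}"
        using u(2) v(2) by (auto simp: spin_append matrix_uminus_mult)
      moreover have "weyl_element (v @ rev v) = weyl_element []"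
        using F4pp.eqv_rev[OF v(1)] by (simp add: weyl_element_eq_iff)
      then have "projective (spin True (v @ rev v)) = projective (mat 1)"
        using spin_class_weyl_element[of "v @ rev v"] spin_class_weyl_element[of "[]"] by simp
      ultimately have "spin True (u @ rev v) \<in> {mat 1, - mat 1}"
        by (auto simp: projective_eq_iff)
      then have "F4pp.eqv (u @ rev v) []"
        using u v by (intro spin_faithful) auto
      then have "F4pp.eqv u v" using F4pp.eqv_move[of u "rev v"] v(1) by (simp add: in_lists_conv_set)
      then show "P = Q" by (simp add: u v weyl_element_eq_iff)
    qed
    show "spin_class ` carrier F4pp_even = carrier extended_PSL2"
    proof
      show "spin_class ` carrier F4pp_even \<subseteq> carrier extended_PSL2"
        by (auto simp: F4pp_even_simps extended_PSL2_simps spin_class_weyl_element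
          intro!: imageI spin_extended)
      show "carrier extended_PSL2 \<subseteq> spin_class ` carrier F4pp_even"
      proof
        fix X assume "X \<in> carrier extended_PSL2"
        then obtain S where S: "X = projective S" "S \<in> spin_image"
          by (auto simp: extended_PSL2_simps spin_image_eq)
        then obtain w where w: "w \<in> lists F4pp_nodes" "even (length w)" "spin True w \<in> {S, - S}"
          unfolding spin_image_def by blast
        then have "X = spin_class (weyl_element w)"
          by (auto simp: S(1) spin_class_weyl_element projective_eq_iff)
        then show "X \<in> spin_class ` carrier F4pp_even"
          using w by (auto simp: F4pp_even_simps)
      qed
    qed
  qed
qed

theorem proposition12:
  shows "is_semidirect_product (even_weyl_group F4pp_cartan F4pp_nodes) PSL2_0_Hurwitz (sym_group 3) \<and>
         is_semidirect_product (even_weyl_group F4pp_cartan F4pp_nodes) PSL2_Hurwitz (integer_mod_group 2)"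
proof -
  have inv: "inv_into (carrier F4pp_even) spin_class \<in> iso extended_PSL2 F4pp_even"
    by (rule group.iso_set_sym[OF group_F4pp_even spin_class_iso])
  note transfer = semidirect_product_transfer[OF group_F4pp_even group_extended_PSL2 inv]
  show ?thesis
    using transfer[OF extended_PSL2_semidirect_S3] transfer[OF extended_PSL2_semidirect_Z2] by blast
qed

end
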